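(* Let $\alpha\in(0,2]$. There is a constant $c_\alpha>0$, depending only on $\alpha$, such that the following holds for every $n\times n$ Wigner matrix $X$ having the concentration property $\mathcal{C}_\alpha$ with some $\kappa>0$. If $\alpha\in[1,2]$ and $f:\mathbb{R}\to\mathbb{R}$ is $1$-Lipschitz, then for any $t>0$, $$\mathbb{P}\big(\mu_{X/\sqrt n}(f)-m_f>t\big)\le2\exp\Big(-c_\alpha\min\Big(\frac{n^2t^2}{\kappa^2},\frac{n^{1+\frac\alpha2}t^\alpha}{\kappa^\alpha}\Big)\Big).$$ If $\alpha\in(0,1)$, $f:\mathbb{R}\to\mathbb{R}$ is $1$-Lipschitz and moreover $f=\mathcal{I}_\pm^{\alpha+1}(\sigma)$ (i.e. $f=\mathcal{I}_+^{\alpha+1}(\sigma)$ or $f=\mathcal{I}_-^{\alpha+1}(\sigma)$) for some $\sigma\in\mathcal{M}_s^\alpha$ such that $|\sigma|(\mathbb{R})\le m$, then for any $t>0$, $$\mathbb{P}\big(\mu_{X/\sqrt n}(f)-m_f>t\big)\le4\exp\Big(-c_\alpha\min\Big(\frac{n^2t^2}{\kappa^2(\log n)^{2(\frac1\alpha-1)}},\frac{n^{\frac32}t}{\kappa(\log n)^{\frac1\alpha-1}},\frac{n^{1+\frac\alpha2}t}{\kappa m}\Big)\Big).$$ Here $m_f$ denotes a median of $\mu_{X/\sqrt n}(f)$.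
   Context: $\mathcal{H}_n^{(\beta)}$ is the set of $n\times n$ Hermitian matrices if $\beta=2$ and real symmetric matrices if $\beta=1$. A Wigner matrix is a random matrix in $\mathcal{H}_n^{(\beta)}$ with independent coefficients up to the symmetry, such that $(X_{i,i})_i$ are identically distributed and $(X_{i,j})_{i<j}$ are identically distributed. $\mu_A$ is the empirical spectral measure $\frac1n\sum_i\delta_{\lambda_i}$ of $A$ ($\lambda_i$ its eigenvalues), and $\mu(f)=\int f\,d\mu$. For $p>0$ and $Y\in\mathcal{H}_n^{(\beta)}$, $\|Y\|_{\ell^p}^p=\sum_{i,j}|Y_{i,j}|^p$ and $B_{\ell^p}=\{Y\in\mathcal{H}_n^{(\beta)}:\|Y\|_{\ell^p}\le1\}$. Concentration property $\mathcal{C}_\alpha$ with constant $\kappa>0$: for any Borel subset $A$ of $\mathcal{H}_n^{(\beta)}$ with $\mathbb{P}(X\in A)\ge1/2$ and any $t>0$, if $\alpha\in[1,2]$: $\mathbb{P}(X\notin A+\kappa\sqrt t\,B_{\ell^2}+\kappa t^{1/\alpha}B_{\ell^\alpha})\le2e^{-t}$; if $\alpha\in(0,1)$: $\mathbb{P}\big(X\notin A+\kappa(\log n)^{\frac1\alpha-1}(\sqrt t\,B_{\ell^2}+t\,B_{\ell^1})+\kappa t^{1/\alpha}B_{\ell^\alpha}\big)\le4e^{-t}$. $\mathcal{M}_s^\alpha$ is the set of finite signed measures $\sigma$ on $\mathbb{R}$ whose total variation $|\sigma|$ has a finite $\alpha$-th moment. For $\alpha\in(0,1)$ and $\sigma\in\mathcal{M}_s^\alpha$,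 $$(\mathcal{I}_+^{\alpha+1}\sigma)(t)=\frac1{\Gamma(\alpha+1)}\int_{-\infty}^t(t-x)^\alpha d\sigma(x),\qquad(\mathcal{I}_-^{\alpha+1}\sigma)(t)=\frac1{\Gamma(\alpha+1)}\int_t^{+\infty}(x-t)^\alpha d\sigma(x).$$
   Formalization: For α<1 the third rate has κ^α m in place of κ m: the printed bound fails for small κ (n=2, diagonal Bernoulli(p) entries, p→0), while for κ≥1 the corrected bound implies it. X is defined on a fixed sample space that realizes every law of a random matrix. *)

theory Defs
  imports
    "HOL-Probability.Probability"
    "HOL-Computational_Algebra.Fundamental_Theorem_Algebra"
    "Jordan_Normal_Form.Char_Poly"
begin

section \<open>Matrices\<close>

text \<open>Real symmetric matrices (\<open>\<beta> = 1\<close>) are represented as complex matrices with real entries.\<close>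

definition herm_mat :: "nat \<Rightarrow> nat \<Rightarrow> complex mat set" where
  "herm_mat \<beta> n = {A \<in> carrier_mat n n.
     (\<forall>i<n. \<forall>j<n. A $$ (j, i) = cnj (A $$ (i, j))) \<and>
     (\<beta> = 1 \<longrightarrow> (\<forall>i<n. \<forall>j<n. A $$ (i, j) \<in> \<real>))}"

text \<open>The Borel sets of \<^term>\<open>herm_mat \<beta> n\<close>, a subspace of the space of all \<open>n \<times> n\<close> matrices,
  identified entrywise with a finite power of the complex plane.\<close>

definition borel_herm_mat :: "nat \<Rightarrow> nat \<Rightarrow> complex mat measure" where
  "borel_herm_mat \<beta> n =
     vimage_algebra (herm_mat \<beta> n) (\<lambda>A. \<lambda>(i, j)\<in>{..<n} \<times> {..<n}. A $$ (i, j))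
       (\<Pi>\<^sub>M ij\<in>{..<n} \<times> {..<n}. borel)"

definition lp_norm_mat :: "nat \<Rightarrow> real \<Rightarrow> complex mat \<Rightarrow> real" where
  "lp_norm_mat n p Y = (\<Sum>i<n. \<Sum>j<n. norm (Y $$ (i, j)) powr p) powr (1 / p)"

definition lp_ball :: "nat \<Rightarrow> nat \<Rightarrow> real \<Rightarrow> complex mat set" where
  "lp_ball \<beta> n p = {Y \<in> herm_mat \<beta> n. lp_norm_mat n p Y \<le> 1}"

definition mat_set_plus :: "complex mat set \<Rightarrow> complex mat set \<Rightarrow> complex mat set"
    (infixl "+\<^sub>S" 65) where
  "A +\<^sub>S B = {a + b | a b. a \<in> A \<and> b \<in> B}"

definition mat_set_scale :: "real \<Rightarrow> complex mat set \<Rightarrow> complex mat set"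
    (infixr "\<cdot>\<^sub>S" 70) where
  "r \<cdot>\<^sub>S A = (\<lambda>a. complex_of_real r \<cdot>\<^sub>m a) ` A"

text \<open>Over the complex numbers \<^term>\<open>proots (char_poly A)\<close> is the multiset of the eigenvalues of
  \<open>A\<close>, with multiplicity; they are real for Hermitian \<open>A\<close>.\<close>

definition empirical_spectral_measure :: "complex mat \<Rightarrow> real measure" where
  "empirical_spectral_measure A =
     measure_pmf (pmf_of_multiset (image_mset Re (proots (char_poly A))))"

definition spectral_mean :: "nat \<Rightarrow> ('a \<Rightarrow> complex mat) \<Rightarrow> (real \<Rightarrow> real) \<Rightarrow> 'a \<Rightarrow> real" where
  "spectral_mean n X f \<omega> =
     (\<integral>x. f x \<partial>empirical_spectral_measure (complex_of_real (1 / sqrt (real n)) \<cdot>\<^sub>m X \<omega>))"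

section \<open>Random matrices\<close>

definition wigner :: "'a measure \<Rightarrow> nat \<Rightarrow> nat \<Rightarrow> ('a \<Rightarrow> complex mat) \<Rightarrow> bool" where
  "wigner M \<beta> n X \<longleftrightarrow>
     prob_space M \<and> X \<in> measurable M (borel_herm_mat \<beta> n) \<and>
     prob_space.indep_vars M (\<lambda>_. borel) (\<lambda>(i, j) \<omega>. X \<omega> $$ (i, j)) {(i, j). i \<le> j \<and> j < n} \<and>
     (\<forall>i<n. \<forall>k<n. distr M borel (\<lambda>\<omega>. X \<omega> $$ (i, i)) = distr M borel (\<lambda>\<omega>. X \<omega> $$ (k, k))) \<and>
     (\<forall>i j k l. i < j \<and> j < n \<and> k < l \<and> l < n \<longrightarrow>
        distr M borel (\<lambda>\<omega>. X \<omega> $$ (i, j)) = distr M borel (\<lambda>\<omega>. X \<omega> $$ (k, l)))"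

text \<open>For a Borel set \<open>A\<close> the enlargements below are in general only analytic, hence universally
  measurable; the \<^const>\<open>completion\<close> assigns such events their probability.\<close>

definition concentration_property ::
    "'a measure \<Rightarrow> nat \<Rightarrow> nat \<Rightarrow> ('a \<Rightarrow> complex mat) \<Rightarrow> real \<Rightarrow> real \<Rightarrow> bool" where
  "concentration_property M \<beta> n X \<alpha> \<kappa> \<longleftrightarrow>
     (\<forall>A \<in> sets (borel_herm_mat \<beta> n). \<forall>t>0.
        measure M {\<omega> \<in> space M. X \<omega> \<in> A} \<ge> 1/2 \<longrightarrow>
        (\<alpha> \<in> {1..2} \<longrightarrow>
           measure (completion M) {\<omega> \<in> space M.
              X \<omega> \<notin> A +\<^sub>S (\<kappa> * sqrt t) \<cdot>\<^sub>S lp_ball \<beta> n 2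
                     +\<^sub>S (\<kappa> * t powr (1/\<alpha>)) \<cdot>\<^sub>S lp_ball \<beta> n \<alpha>}
             \<le> 2 * exp (- t)) \<and>
        (\<alpha> \<in> {0<..<1} \<longrightarrow>
           measure (completion M) {\<omega> \<in> space M.
              X \<omega> \<notin> A +\<^sub>S (\<kappa> * ln (real n) powr (1/\<alpha> - 1)) \<cdot>\<^sub>S
                         (sqrt t \<cdot>\<^sub>S lp_ball \<beta> n 2 +\<^sub>S t \<cdot>\<^sub>S lp_ball \<beta> n 1)
                     +\<^sub>S (\<kappa> * t powr (1/\<alpha>)) \<cdot>\<^sub>S lp_ball \<beta> n \<alpha>}
             \<le> 4 * exp (- t)))"

definition is_median :: "'a measure \<Rightarrow> ('a \<Rightarrow> real) \<Rightarrow> real \<Rightarrow> bool" where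
  "is_median M Z m \<longleftrightarrow>
     measure M {\<omega> \<in> space M. Z \<omega> \<le> m} \<ge> 1/2 \<and> measure M {\<omega> \<in> space M. Z \<omega> \<ge> m} \<ge> 1/2"

section \<open>Finite signed measures and fractional integrals\<close>

definition signed_measure :: "(real set \<Rightarrow> real) \<Rightarrow> bool" where
  "signed_measure \<sigma> \<longleftrightarrow>
     \<sigma> {} = 0 \<and>
     (\<forall>A :: nat \<Rightarrow> real set. range A \<subseteq> sets borel \<longrightarrow> disjoint_family A \<longrightarrow>
        (\<lambda>i. \<sigma> (A i)) sums \<sigma> (\<Union>i. A i))"

text \<open>The positive part of the Jordan decomposition; the negative part is
  \<open>upper_variation (\<lambda>E. - \<sigma> E)\<close>.  Truncation by \<^const>\<open>ennreal\<close> is harmless, since \<open>B = {}\<close> is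
  admitted.\<close>

definition upper_variation :: "(real set \<Rightarrow> real) \<Rightarrow> real measure" where
  "upper_variation \<sigma> =
     measure_of UNIV (sets borel) (\<lambda>E. SUP B\<in>{B \<in> sets borel. B \<subseteq> E}. ennreal (\<sigma> B))"

definition total_variation :: "(real set \<Rightarrow> real) \<Rightarrow> real measure" where
  "total_variation \<sigma> =
     measure_of UNIV (sets borel)
       (\<lambda>E. emeasure (upper_variation \<sigma>) E + emeasure (upper_variation (\<lambda>E. - \<sigma> E)) E)"

definition signed_integral :: "(real set \<Rightarrow> real) \<Rightarrow> (real \<Rightarrow> real) \<Rightarrow> real" where
  "signed_integral \<sigma> g =
     (\<integral>x. g x \<partial>upper_variation \<sigma>) - (\<integral>x. g x \<partial>upper_variation (\<lambda>E. - \<sigma> E))"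

definition signed_measures_moment :: "real \<Rightarrow> (real set \<Rightarrow> real) set" where
  "signed_measures_moment \<alpha> =
     {\<sigma>. signed_measure \<sigma> \<and> (\<integral>\<^sup>+x. ennreal (\<bar>x\<bar> powr \<alpha>) \<partial>total_variation \<sigma>) < \<infinity>}"

text \<open>The fractional integrals of order \<open>\<alpha> + 1\<close>.\<close>

definition frac_int_plus :: "real \<Rightarrow> (real set \<Rightarrow> real) \<Rightarrow> real \<Rightarrow> real" where
  "frac_int_plus \<alpha> \<sigma> t =
     1 / Gamma (\<alpha> + 1) * signed_integral \<sigma> (\<lambda>x. indicator {..t} x * (t - x) powr \<alpha>)"

definition frac_int_minus :: "real \<Rightarrow> (real set \<Rightarrow> real) \<Rightarrow> real \<Rightarrow> real" where
  "frac_int_minus \<alpha> \<sigma> t =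
     1 / Gamma (\<alpha> + 1) * signed_integral \<sigma> (\<lambda>x. indicator {t..} x * (x - t) powr \<alpha>)"

text \<open>Both variations are what they should be on Borel sets: the set functions passed to
  \<^const>\<open>measure_of\<close> are countably additive, so it does not collapse to the zero measure.\<close>

lemma sets_upper_variation [simp]: "sets (upper_variation \<sigma>) = sets borel"
  unfolding upper_variation_def by (simp add: sets.sigma_sets_eq[of borel, simplified])

lemma space_upper_variation [simp]: "space (upper_variation \<sigma>) = UNIV"
  unfolding upper_variation_def by (simp add: space_measure_of_conv)

lemma signed_measure_uminus: "signed_measure \<sigma> \<Longrightarrow> signed_measure (\<lambda>E. - \<sigma> E)"
  unfolding signed_measure_def by (auto intro: sums_minus)

lemma signed_measure_Un:
  assumes "signed_measure \<sigma>" "A \<in> sets borel" "B \<in> sets borel" "A \<inter> B = {}"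
  shows "\<sigma> (A \<union> B) = \<sigma> A + \<sigma> B"
proof -
  have "range (binaryset A B) \<subseteq> sets borel" "disjoint_family (binaryset A B)"
    using assms by (auto simp: binaryset_def disjoint_family_on_def)
  then have "(\<lambda>i. \<sigma> (binaryset A B i)) sums \<sigma> (A \<union> B)"
    using assms(1) unfolding signed_measure_def by (metis UN_binaryset_eq)
  moreover have "(\<lambda>i. \<sigma> (binaryset A B i)) sums (\<sigma> A + \<sigma> B)"
    using binaryset_sums[of \<sigma> A B] assms(1) by (simp add: signed_measure_def)
  ultimately show ?thesis by (rule sums_unique2)
qed

lemma emeasure_upper_variation:
  assumes \<sigma>: "signed_measure \<sigma>" and E: "E \<in> sets borel"
  shows "emeasure (upper_variation \<sigma>) E = (SUP B\<in>{B \<in> sets borel. B \<subseteq> E}. ennreal (\<sigma> B))"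
proof -
  define u where "u E = (SUP B\<in>{B \<in> sets borel. B \<subseteq> E}. ennreal (\<sigma> B))" for E :: "real set"
  have upper: "ennreal (\<sigma> B) \<le> u E" if "B \<in> sets borel" "B \<subseteq> E" for B E
    unfolding u_def using that by (auto intro: SUP_upper)
  have mono: "u A \<le> u B" if "A \<subseteq> B" for A B
    unfolding u_def using that by (intro SUP_subset_mono) auto
  have empty: "u {} = 0"
    using \<sigma> unfolding u_def signed_measure_def by (auto intro!: antisym SUP_least)
  have fin: "u A + u B \<le> u (A \<union> B)" if AB: "A \<inter> B = {}" for A B
  proof -
    have *: "ennreal (\<sigma> C) + ennreal (\<sigma> D) \<le> u (A \<union> B)"
      if C: "C \<in> sets borel" "C \<subseteq> A" and D: "D \<in> sets borel" "D \<subseteq> B" for C D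
    proof (cases "\<sigma> C \<ge> 0 \<and> \<sigma> D \<ge> 0")
      case True
      have "C \<inter> D = {}" using C D AB by blast
      then have "ennreal (\<sigma> C) + ennreal (\<sigma> D) = ennreal (\<sigma> (C \<union> D))"
        using signed_measure_Un[OF \<sigma> C(1) D(1)] True by (simp add: ennreal_plus)
      also have "\<dots> \<le> u (A \<union> B)" using C D by (intro upper) auto
      finally show ?thesis .
    next
      case False
      then consider "ennreal (\<sigma> C) = 0" | "ennreal (\<sigma> D) = 0"
        by (metis ennreal_neg linorder_le_cases)
      then show ?thesis
        using upper[of C "A \<union> B"] upper[of D "A \<union> B"] C D by cases auto
    qed
    have "u A + u B = (SUP C\<in>{C \<in> sets borel. C \<subseteq> A}. ennreal (\<sigma> C) + u B)"
      unfolding u_def[of A] by (rule ennreal_SUP_add_left[symmetric]) auto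
    also have "\<dots> \<le> u (A \<union> B)"
    proof (rule SUP_least)
      fix C assume C: "C \<in> {C \<in> sets borel. C \<subseteq> A}"
      have "ennreal (\<sigma> C) + u B = (SUP D\<in>{D \<in> sets borel. D \<subseteq> B}. ennreal (\<sigma> C) + ennreal (\<sigma> D))"
        unfolding u_def by (rule ennreal_SUP_add_right) auto
      also have "\<dots> \<le> u (A \<union> B)" using C by (intro SUP_least *) auto
      finally show "ennreal (\<sigma> C) + u B \<le> u (A \<union> B)" .
    qed
    finally show ?thesis .
  qed
  have "countably_additive (sets borel) u"
    unfolding countably_additive_def
  proof (intro allI impI)
    fix A :: "nat \<Rightarrow> real set"
    assume A: "range A \<subseteq> sets borel" "disjoint_family A"
    show "(\<Sum>i. u (A i)) = u (\<Union>i. A i)"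
    proof (rule antisym)
      have "(\<Sum>i<n. u (A i)) \<le> u (\<Union>i<n. A i)" for n
      proof (induction n)
        case (Suc n)
        have "(\<Sum>i<Suc n. u (A i)) \<le> u (\<Union>i<n. A i) + u (A n)"
          using Suc by (simp add: add_right_mono)
        also have "\<dots> \<le> u ((\<Union>i<n. A i) \<union> A n)"
        proof (rule fin)
          have "A i \<inter> A n = {}" if "i < n" for i
            using A(2) that by (simp add: disjoint_family_on_def)
          then show "(\<Union>i<n. A i) \<inter> A n = {}" by blast
        qed
        finally show ?case by (simp add: lessThan_Suc Un_commute)
      qed (simp add: empty)
      also have "u (\<Union>i<n. A i) \<le> u (\<Union>i. A i)" for n by (intro mono) auto
      finally show "(\<Sum>i. u (A i)) \<le> u (\<Union>i. A i)" by (intro suminf_le_const) auto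
    next
      show "u (\<Union>i. A i) \<le> (\<Sum>i. u (A i))"
        unfolding u_def[of "\<Union>i. A i"]
      proof (rule SUP_least)
        fix B assume "B \<in> {B \<in> sets borel. B \<subseteq> (\<Union>i. A i)}"
        then have B: "B \<in> sets borel" and "B \<subseteq> (\<Union>i. A i)" by auto
        then have BA: "(\<Union>i. B \<inter> A i) = B" by blast
        have "range (\<lambda>i. B \<inter> A i) \<subseteq> sets borel" "disjoint_family (\<lambda>i. B \<inter> A i)"
          using A B by (auto simp: disjoint_family_on_def)
        then have "(\<lambda>i. \<sigma> (B \<inter> A i)) sums \<sigma> (\<Union>i. B \<inter> A i)"
          using \<sigma> unfolding signed_measure_def by blast
        then have "(\<lambda>n. ennreal (\<Sum>i<n. \<sigma> (B \<inter> A i))) \<longlonglongrightarrow> ennreal (\<sigma> B)"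
          unfolding sums_def BA by (rule tendsto_ennrealI)
        moreover have "ennreal (\<Sum>i<n. \<sigma> (B \<inter> A i)) \<le> (\<Sum>i. u (A i))" for n
        proof -
          have "ennreal (\<Sum>i<n. \<sigma> (B \<inter> A i)) \<le> ennreal (\<Sum>i<n. max 0 (\<sigma> (B \<inter> A i)))"
            by (intro ennreal_leI sum_mono) auto
          also have "\<dots> = (\<Sum>i<n. ennreal (max 0 (\<sigma> (B \<inter> A i))))"
            by (rule sum_ennreal[symmetric]) simp
          also have "\<dots> = (\<Sum>i<n. ennreal (\<sigma> (B \<inter> A i)))"
            by (intro sum.cong) (auto simp: max_def ennreal_neg)
          also have "\<dots> \<le> (\<Sum>i<n. u (A i))"
            using A B by (intro sum_mono upper) auto
          also have "\<dots> \<le> (\<Sum>i. u (A i))" by (rule sum_le_suminf) auto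
          finally show ?thesis .
        qed
        ultimately show "ennreal (\<sigma> B) \<le> (\<Sum>i. u (A i))" using LIMSEQ_le_const2 by blast
      qed
    qed
  qed
  moreover have "upper_variation \<sigma> = measure_of UNIV (sets borel) u"
    unfolding upper_variation_def u_def ..
  ultimately have "emeasure (upper_variation \<sigma>) E = u E"
    using E empty by (intro emeasure_measure_of[of _ UNIV "sets borel"]) (simp_all add: positive_def sets.sigma_sets_eq[of borel, simplified])
  then show ?thesis by (simp add: u_def)
qed

lemma emeasure_total_variation:
  assumes "E \<in> sets borel"
  shows "emeasure (total_variation \<sigma>) E =
    emeasure (upper_variation \<sigma>) E + emeasure (upper_variation (\<lambda>E. - \<sigma> E)) E"
proof (rule emeasure_measure_of[OF total_variation_def])
  show "countably_additive (sets (total_variation \<sigma>))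
     (\<lambda>E. emeasure (upper_variation \<sigma>) E + emeasure (upper_variation (\<lambda>E. - \<sigma> E)) E)"
    unfolding countably_additive_def total_variation_def
    by (auto simp: sets.sigma_sets_eq[of borel, simplified] suminf_add[symmetric] suminf_emeasure)
qed (use assms in \<open>auto simp: positive_def total_variation_def sets.sigma_sets_eq[of borel, simplified]\<close>)

section \<open>Tail bounds with infinite rates\<close>

text \<open>The rates of the case \<open>\<alpha> < 1\<close> are extended reals: their denominators vanish for \<open>n = 1\<close> or
  \<open>m = 0\<close>, and then a positive number divided by \<open>0\<close> is \<open>\<infinity>\<close>, whereas it is \<open>0\<close> in type
  \<^typ>\<open>real\<close>.\<close>

definition exp_neg :: "ereal \<Rightarrow> real" where
  "exp_neg r = (if r = \<infinity> then 0 else exp (- real_of_ereal r))"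

end

theory Submission
  imports Defs "Jordan_Normal_Form.Schur_Decomposition"
begin

text \<open>
  Put \<open>A = {Y. \<mu>_{Y/\<surd>n}(f) \<le> m_f}\<close>, an event of probability at least \<open>1/2\<close>.  The concentration
  property says that, outside an event of probability at most \<open>2 e^{-s}\<close> (or \<open>4 e^{-s}\<close>), the matrix
  \<open>X\<close> is an element of \<open>A\<close> plus small elements of \<open>\<ell>\<^sup>p\<close> balls.  So everything reduces to a deterministic
  question: how much can the trace \<open>tr f(Y)\<close> (below: \<open>spectral_sum\<close>) change when an element of an
  \<open>\<ell>\<^sup>p\<close> ball is added to \<open>Y\<close>?  Choosing \<open>s\<close> so that each of the two or three balls contributes at
  most \<open>t/3\<close> to the spectral mean gives the rate.

  The basic tool is the overlap matrix of two eigenbases \<open>(a\<^sub>i, u\<^sub>i)\<close> of \<open>A\<close> and \<open>(b\<^sub>j, v\<^sub>j)\<close> of \<open>B\<close>, with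
  entries \<open>|\<langle>u\<^sub>i, v\<^sub>j\<rangle>|\<^sup>2\<close>.  It is doubly stochastic, so \<open>tr f(B) - tr f(A)\<close> is the sum of
  \<open>f(b\<^sub>j) - f(a\<^sub>i)\<close> weighted by the overlaps (\<open>spectral_sum_diff\<close>).  Its first moment in \<open>b\<^sub>j - a\<^sub>i\<close> is
  \<open>\<langle>u\<^sub>i, (B - A) u\<^sub>i\<rangle>\<close> and its second moment is the squared Frobenius norm of \<open>B - A\<close>, so a Taylor
  expansion of \<open>f\<close> to second order is a Taylor expansion of \<open>tr f\<close>.  Moving from \<open>A\<close> to \<open>A + H\<close> in many
  small steps yields a mean value theorem for \<open>tr f\<close>, which extends to Lipschitz \<open>f\<close> by smoothing
  (\<open>spectral_sum_mean_value\<close>).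

  For \<open>1\<close>-Lipschitz \<open>f\<close> this bounds the change of \<open>tr f\<close> by the trace norm of \<open>H\<close>, and hence by
  \<open>n^{1-1/p} \<parallel>H\<parallel>\<close> in the entrywise \<open>\<ell>\<^sup>p\<close> norm for every \<open>1 \<le> p \<le> 2\<close> (\<open>spectral_sum_lp_perturb\<close>),
  because the Schatten \<open>p\<close>-norm is at most the entrywise one for \<open>p \<le> 2\<close> (\<open>schatten_le_entries\<close>).

  For \<open>\<alpha> < 1\<close> the \<open>\<ell>\<^sup>\<alpha>\<close> ball needs more than the Lipschitz property: a fractional integral \<open>f\<close> is a mixture
  of the functions \<open>x \<mapsto> (x - y)_+^\<alpha>\<close> or \<open>x \<mapsto> (y - x)_+^\<alpha>\<close>, with total weight at most \<open>m\<close> up to a Gamma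
  factor.  For each of them the change of the trace is at most the sum of \<open>|H\<^sub>k\<^sub>l|^\<alpha>\<close>
  (\<open>spectral_sum_pos_powr_perturb\<close>): adding \<open>t v v\<^sup>*\<close> with a unit vector \<open>v\<close> changes the trace by at most
  \<open>|t|^\<alpha>\<close>, and \<open>H\<close> is a sum of such terms over its own eigenvectors.

  Finally, the enlargement of a Borel set need not be a Borel set, and a probability bound
  for a non-measurable event would carry no information.  Here \<open>A\<close> is closed, since spectral sums are
  continuous, and the balls are compact, so the enlargement is closed
  (\<open>closed_herm_plus\<close>, \<open>tail_le_completion\<close>).
\<close>

section \<open>Spectral decomposition and spectral sums\<close>

definition matrix_trace :: "complex mat \<Rightarrow> complex" where
  "matrix_trace A = (\<Sum>i<dim_row A. A $$ (i, i))"

lemma matrix_trace_mult_commute: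
  assumes "A \<in> carrier_mat n k" "B \<in> carrier_mat k n"
  shows "matrix_trace (A * B) = matrix_trace (B * A)"
proof -
  have "matrix_trace (A * B) = (\<Sum>i<n. \<Sum>j<k. A $$ (i, j) * B $$ (j, i))"
    using assms by (simp add: matrix_trace_def scalar_prod_def lessThan_atLeast0)
  also have "\<dots> = (\<Sum>j<k. \<Sum>i<n. B $$ (j, i) * A $$ (i, j))"
    by (subst sum.swap) (simp add: mult.commute)
  also have "\<dots> = matrix_trace (B * A)"
    using assms by (simp add: matrix_trace_def scalar_prod_def lessThan_atLeast0)
  finally show ?thesis .
qed

text \<open>The trace is the sum of the eigenvalues with multiplicity (by triangularisation), so if they
  were all equal to \<open>\<tau>\<close>, the trace would be \<open>n \<tau>\<close>.\<close>

lemma exists_eigenvalue_neq: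
  assumes A: "A \<in> carrier_mat n n" and tr: "matrix_trace A \<noteq> of_nat n * \<tau>"
  shows "\<exists>e. eigenvalue A e \<and> e \<noteq> \<tau>"
proof -
  obtain es where es: "char_poly A = (\<Prod>e\<leftarrow>es. [:- e, 1:])" and len: "length es = n"
    using char_poly_factorized[OF A] by blast
  obtain B P Q where "schur_decomposition A es = (B, P, Q)"
    by (cases "schur_decomposition A es")
  then have sim: "similar_mat_wit A B P Q" and diag: "diag_mat B = es"
    using schur_decomposition[OF A es] by auto
  have car: "B \<in> carrier_mat n n" "P \<in> carrier_mat n n" "Q \<in> carrier_mat n n"
    and QP: "Q * P = 1\<^sub>m n" and APBQ: "A = P * B * Q"
    using similar_mat_witD2[OF A sim] by auto
  have "matrix_trace A = matrix_trace (Q * (P * B))"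
    unfolding APBQ using car by (intro matrix_trace_mult_commute[of _ n n]) auto
  also have "Q * (P * B) = B"
    using car QP by (simp add: assoc_mult_mat[of Q n n P n B n, symmetric])
  also have "matrix_trace B = sum_list es"
    using car unfolding diag[symmetric] diag_mat_def matrix_trace_def
    by (simp add: sum_list_sum_nth lessThan_atLeast0)
  finally have "sum_list es \<noteq> of_nat n * \<tau>" using tr by simp
  moreover have "sum_list es = of_nat n * \<tau>" if "\<forall>e\<in>set es. e = \<tau>"
  proof -
    have "es = replicate n \<tau>" using that len by (simp add: replicate_eqI)
    then show ?thesis by (simp add: sum_list_replicate)
  qed
  ultimately obtain e where "e \<in> set es" "e \<noteq> \<tau>" by blast
  then show ?thesis
    unfolding eigenvalue_root_char_poly[OF A] es poly_prod_list by (auto intro!: exI[of _ e] simp: prod_list_zero_iff image_iff)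
qed

definition cip :: "nat \<Rightarrow> (nat \<Rightarrow> complex) \<Rightarrow> (nat \<Rightarrow> complex) \<Rightarrow> complex" where
  "cip n x y = (\<Sum>k<n. cnj (x k) * y k)"

text \<open>From here on a matrix is a kernel on indices, of which only the values below \<open>n\<close> matter; this
  keeps sums and scalings of matrices free of dimension side conditions.\<close>

definition mat_vec :: "nat \<Rightarrow> (nat \<Rightarrow> nat \<Rightarrow> complex) \<Rightarrow> (nat \<Rightarrow> complex) \<Rightarrow> nat \<Rightarrow> complex" where
  "mat_vec n A x k = (\<Sum>l<n. A k l * x l)"

text \<open>Oriented so that the condition terminates as a rewrite rule.\<close>

definition hermitian :: "nat \<Rightarrow> (nat \<Rightarrow> nat \<Rightarrow> complex) \<Rightarrow> bool" where
  "hermitian n A \<longleftrightarrow> (\<forall>k<n. \<forall>l<n. cnj (A k l) = A l k)"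

definition orthonormal :: "nat \<Rightarrow> nat \<Rightarrow> (nat \<Rightarrow> nat \<Rightarrow> complex) \<Rightarrow> bool" where
  "orthonormal n m u \<longleftrightarrow> (\<forall>i<m. \<forall>j<m. cip n (u i) (u j) = (if i = j then 1 else 0))"

lemma cip_commute: "cip n y x = cnj (cip n x y)"
  by (simp add: cip_def mult.commute)

lemma cip_sum_right: "cip n x (\<lambda>k. \<Sum>i\<in>I. f i k) = (\<Sum>i\<in>I. cip n x (f i))"
  unfolding cip_def by (simp add: sum_distrib_left sum.swap[of _ I])

lemma cip_scale_right: "cip n x (\<lambda>k. c * y k) = c * cip n x y"
  by (simp add: cip_def sum_distrib_left mult_ac)

lemma cip_diff_right: "cip n x (\<lambda>k. y k - z k) = cip n x y - cip n x z"
  by (simp add: cip_def sum_subtractf right_diff_distrib)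

lemma cip_self: "cip n x x = of_real (\<Sum>k<n. (cmod (x k))\<^sup>2)"
  by (simp add: cip_def complex_norm_square of_real_power[symmetric] mult.commute del: of_real_power)

lemma hermitian_cip_mat_vec:
  assumes "hermitian n A"
  shows "cip n (mat_vec n A x) y = cip n x (mat_vec n A y)"
proof -
  have "cip n (mat_vec n A x) y = (\<Sum>k<n. \<Sum>l<n. cnj (A k l) * cnj (x l) * y k)"
    by (simp add: cip_def mat_vec_def sum_distrib_right)
  also have "\<dots> = (\<Sum>l<n. \<Sum>k<n. cnj (A k l) * cnj (x l) * y k)" by (rule sum.swap)
  also have "\<dots> = (\<Sum>l<n. \<Sum>k<n. A l k * cnj (x l) * y k)"
    using assms by (intro sum.cong refl) (auto simp: hermitian_def)
  also have "\<dots> = cip n x (mat_vec n A y)"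
    by (simp add: cip_def mat_vec_def sum_distrib_left mult_ac)
  finally show ?thesis .
qed

text \<open>The inductive step of the spectral theorem, by deflation: moving the known eigenvalues
  \<open>a\<^sub>i\<close> to a common value \<open>\<tau>\<close> gives a Hermitian matrix \<open>B\<close> with eigenvectors \<open>u\<^sub>i\<close> of eigenvalue \<open>\<tau>\<close>.
  For suitable \<open>\<tau>\<close> the trace forces an eigenvalue different from \<open>\<tau>\<close>, and its eigenvectors are
  orthogonal to all \<open>u\<^sub>i\<close>, so that \<open>A\<close> and \<open>B\<close> agree on them.\<close>

lemma exists_eigenvector_orthogonal:
  fixes a :: "nat \<Rightarrow> real"
  assumes herm: "hermitian n A" and "m < n" and on: "orthonormal n m u"
    and ev: "\<And>i k. i < m \<Longrightarrow> k < n \<Longrightarrow> mat_vec n A (u i) k = of_real (a i) * u i k"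
  obtains v :: "nat \<Rightarrow> complex" and e :: real where
    "cip n v v = 1" "\<And>i. i < m \<Longrightarrow> cip n (u i) v = 0"
    "\<And>k. k < n \<Longrightarrow> mat_vec n A v k = of_real e * v k"
proof -
  \<comment> \<open>The trace of the deflated matrix is then \<open>n \<tau> - 1\<close>.\<close>
  define \<tau> where "\<tau> = (Re (\<Sum>k<n. A k k) - sum a {..<m} + 1) / (real n - real m)"
  define B where "B k l = A k l - (\<Sum>i<m. of_real (a i - \<tau>) * u i k * cnj (u i l))" for k l
  have Bv: "mat_vec n B x k = mat_vec n A x k - (\<Sum>i<m. of_real (a i - \<tau>) * cip n (u i) x * u i k)"
    for x k
  proof -
    have "(\<Sum>l<n. \<Sum>i<m. of_real (a i - \<tau>) * u i k * cnj (u i l) * x l)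
        = (\<Sum>i<m. of_real (a i - \<tau>) * cip n (u i) x * u i k)"
      unfolding cip_def sum_distrib_left sum_distrib_right by (subst sum.swap) (simp only: mult_ac)
    then show ?thesis
      by (simp add: mat_vec_def B_def left_diff_distrib sum_subtractf sum_distrib_right)
  qed
  have hermB: "hermitian n B"
    using herm unfolding hermitian_def B_def by (simp add: mult_ac)
  have "matrix_trace (mat n n (\<lambda>(i, j). B i j)) = (\<Sum>k<n. A k k) - (\<Sum>i<m. of_real (a i - \<tau>) * cip n (u i) (u i))"
  proof -
    have "(\<Sum>k<n. \<Sum>i<m. of_real (a i - \<tau>) * u i k * cnj (u i k))
        = (\<Sum>i<m. of_real (a i - \<tau>) * cip n (u i) (u i))"
      unfolding cip_def sum_distrib_left by (subst sum.swap) (simp only: mult_ac)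
    then show ?thesis by (simp add: matrix_trace_def B_def sum_subtractf)
  qed
  also have "(\<Sum>i<m. of_real (a i - \<tau>) * cip n (u i) (u i)) = (\<Sum>i<m. of_real (a i - \<tau>) :: complex)"
    using on by (intro sum.cong) (auto simp: orthonormal_def)
  finally have "Re (matrix_trace (mat n n (\<lambda>(i, j). B i j))) = Re (\<Sum>k<n. A k k) - sum a {..<m} + real m * \<tau>"
    by (simp add: sum_subtractf)
  also have "\<dots> \<noteq> real n * \<tau>"
  proof -
    have "(real n - real m) * \<tau> = Re (\<Sum>k<n. A k k) - sum a {..<m} + 1"
      using \<open>m < n\<close> by (simp add: \<tau>_def)
    then show ?thesis by (simp add: algebra_simps)
  qed
  finally have "matrix_trace (mat n n (\<lambda>(i, j). B i j)) \<noteq> of_nat n * of_real \<tau>" by auto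
  then obtain e where "eigenvalue (mat n n (\<lambda>(i, j). B i j)) e" and e: "e \<noteq> of_real \<tau>"
    using exists_eigenvalue_neq[of "mat n n (\<lambda>(i, j). B i j)" n] by auto
  then obtain w where w: "w \<in> carrier_vec n" "w \<noteq> 0\<^sub>v n"
      "mat n n (\<lambda>(i, j). B i j) *\<^sub>v w = e \<cdot>\<^sub>v w"
    unfolding eigenvalue_def eigenvector_def by auto
  define v where "v k = w $ k" for k
  have Bve: "mat_vec n B v k = e * v k" if "k < n" for k
    using arg_cong[OF w(3), of "\<lambda>x. x $ k"] that w(1)
    by (simp add: mat_vec_def v_def scalar_prod_def lessThan_atLeast0)
  have orth: "cip n (u i) v = 0" if "i < m" for i
  proof -
    have "mat_vec n B (u i) k = of_real \<tau> * u i k" if "k < n" for k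
    proof -
      have "(\<Sum>j<m. of_real (a j - \<tau>) * cip n (u j) (u i) * u j k)
          = (\<Sum>j<m. if j = i then of_real (a i - \<tau>) * u i k else 0)"
        using on \<open>i < m\<close> by (intro sum.cong) (auto simp: orthonormal_def)
      then show ?thesis
        using \<open>i < m\<close> ev[OF \<open>i < m\<close> \<open>k < n\<close>] by (simp add: Bv left_diff_distrib)
    qed
    then have "cip n (mat_vec n B (u i)) v = of_real \<tau> * cip n (u i) v"
      by (simp add: cip_def sum_distrib_left mult_ac)
    moreover have "cip n (u i) (mat_vec n B v) = e * cip n (u i) v"
      using Bve by (simp add: cip_def sum_distrib_left mult_ac)
    ultimately show ?thesis using hermitian_cip_mat_vec[OF hermB, of "u i" v] e by auto
  qed
  have Av: "mat_vec n A v k = e * v k" if "k < n" for k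
    using Bve[OF that] by (simp add: Bv orth)
  have pos: "(\<Sum>k<n. (cmod (v k))\<^sup>2) > 0"
  proof -
    obtain k where "k < n" "w $ k \<noteq> 0"
      using w(1,2) by (metis carrier_vecD eq_vecI index_zero_vec)
    then show ?thesis by (intro sum_pos2[of _ k]) (auto simp: v_def)
  qed
  have "cnj e * cip n v v = e * cip n v v"
  proof -
    have "cip n (mat_vec n A v) v = cnj e * cip n v v"
      using Av by (simp add: cip_def sum_distrib_left mult_ac)
    moreover have "cip n v (mat_vec n A v) = e * cip n v v"
      using Av by (simp add: cip_def sum_distrib_left mult_ac)
    ultimately show ?thesis using hermitian_cip_mat_vec[OF herm, of v v] by auto
  qed
  moreover have "cip n v v \<noteq> 0" using pos unfolding cip_self by (simp del: of_real_sum)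
  ultimately have "cnj e = e" by auto
  then have e_real: "e = of_real (Re e)" by (simp add: complex_eq_iff)
  define N where "N = sqrt (\<Sum>k<n. (cmod (v k))\<^sup>2)"
  have N: "N > 0" using pos by (simp add: N_def)
  show ?thesis
  proof
    show "cip n (\<lambda>k. v k / of_real N) (\<lambda>k. v k / of_real N) = 1"
    proof -
      have "cip n (\<lambda>k. v k / of_real N) (\<lambda>k. v k / of_real N) = cip n v v / of_real (N\<^sup>2)"
        by (simp add: cip_def sum_divide_distrib power2_eq_square)
      also have "N\<^sup>2 = (\<Sum>k<n. (cmod (v k))\<^sup>2)" using pos by (simp add: N_def)
      finally show ?thesis using pos by (simp add: cip_self del: of_real_sum)
    qed
    show "cip n (u i) (\<lambda>k. v k / of_real N) = 0" if "i < m" for i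
      using orth[OF that] by (simp add: cip_def sum_divide_distrib[symmetric])
    show "mat_vec n A (\<lambda>k. v k / of_real N) k = of_real (Re e) * (v k / of_real N)" if "k < n" for k
      using Av[OF that] e_real by (simp add: mat_vec_def sum_divide_distrib[symmetric])
  qed
qed

lemma exists_orthonormal_eigenvectors:
  assumes herm: "hermitian n A" and "m \<le> n"
  shows "\<exists>u a. orthonormal n m u \<and> (\<forall>i<m. \<forall>k<n. mat_vec n A (u i) k = of_real (a i :: real) * u i k)"
  using \<open>m \<le> n\<close>
proof (induction m)
  case 0
  show ?case by (auto simp: orthonormal_def)
next
  case (Suc m)
  then obtain u a where u: "orthonormal n m u" and
    a: "\<forall>i<m. \<forall>k<n. mat_vec n A (u i) k = of_real (a i :: real) * u i k" by auto
  obtain v e where v: "cip n v v = 1" "\<And>i. i < m \<Longrightarrow> cip n (u i) v = 0"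
    "\<And>k. k < n \<Longrightarrow> mat_vec n A v k = of_real (e::real) * v k"
    using exists_eigenvector_orthogonal[OF herm _ u, of a] a Suc.prems by (metis Suc_le_eq)
  have "cip n v (u i) = 0" if "i < m" for i using v(2)[OF that] cip_commute[of n v "u i"] by simp
  then have "orthonormal n (Suc m) (u(m := v))"
    using u v by (auto simp: orthonormal_def less_Suc_eq)
  moreover have "\<forall>i<Suc m. \<forall>k<n. mat_vec n A ((u(m := v)) i) k = of_real ((a(m := e)) i) * (u(m := v)) i k"
    using a v by (auto simp: less_Suc_eq)
  ultimately show ?case by blast
qed


definition eigen_decomp ::
    "nat \<Rightarrow> (nat \<Rightarrow> nat \<Rightarrow> complex) \<Rightarrow> (nat \<Rightarrow> real) \<Rightarrow> (nat \<Rightarrow> nat \<Rightarrow> complex) \<Rightarrow> bool" where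
  "eigen_decomp n A a u \<longleftrightarrow>
     orthonormal n n u \<and> (\<forall>i<n. \<forall>k<n. mat_vec n A (u i) k = of_real (a i) * u i k)"

lemma exists_eigen_decomp: "hermitian n A \<Longrightarrow> \<exists>a u. eigen_decomp n A a u"
  using exists_orthonormal_eigenvectors[of n A n] by (auto simp: eigen_decomp_def)

text \<open>A left inverse of a square matrix is a right inverse.\<close>

lemma orthonormal_complete:
  assumes "orthonormal n n u" "k < n" "l < n"
  shows "(\<Sum>i<n. u i k * cnj (u i l)) = (if k = l then 1 else 0)"
proof -
  define U where "U = mat n n (\<lambda>(k, i). u i k)"
  define V where "V = mat n n (\<lambda>(i, k). cnj (u i k))"
  have car: "U \<in> carrier_mat n n" "V \<in> carrier_mat n n" by (auto simp: U_def V_def)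
  have "V * U = 1\<^sub>m n"
    using assms(1) by (intro eq_matI)
      (auto simp: U_def V_def scalar_prod_def orthonormal_def cip_def lessThan_atLeast0)
  then have "U * V = 1\<^sub>m n" using mat_mult_left_right_inverse[OF car(2,1)] by simp
  then have "(U * V) $$ (k, l) = (if k = l then 1 else 0)" using assms by simp
  then show ?thesis using assms(2,3) by (simp add: U_def V_def scalar_prod_def lessThan_atLeast0)
qed

text \<open>This links eigenbases with the multiset of roots that defines the empirical spectral measure.\<close>

lemma char_poly_eigen_decomp:
  assumes A: "A \<in> carrier_mat n n" and dec: "eigen_decomp n (\<lambda>i j. A $$ (i, j)) a u"
  shows "char_poly A = (\<Prod>i<n. [:- of_real (a i), 1:])"
proof -
  define U where "U = mat n n (\<lambda>(k, i). u i k)"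
  define V where "V = mat n n (\<lambda>(i, k). cnj (u i k))"
  define D where "D = mat n n (\<lambda>(i, j). if i = j then of_real (a i) else 0 :: complex)"
  have car: "U \<in> carrier_mat n n" "V \<in> carrier_mat n n" "D \<in> carrier_mat n n"
    by (auto simp: U_def V_def D_def)
  have VU: "V * U = 1\<^sub>m n"
    using dec by (intro eq_matI)
      (auto simp: U_def V_def scalar_prod_def eigen_decomp_def orthonormal_def cip_def lessThan_atLeast0)
  then have UV: "U * V = 1\<^sub>m n" using mat_mult_left_right_inverse[OF car(2,1)] by simp
  have AU: "A * U = U * D"
  proof (intro eq_matI)
    fix k i assume "k < dim_row (U * D)" "i < dim_col (U * D)"
    then have ki: "k < n" "i < n" using car by auto
    have "(A * U) $$ (k, i) = mat_vec n (\<lambda>i j. A $$ (i, j)) (u i) k"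
      using ki A by (simp add: U_def scalar_prod_def mat_vec_def lessThan_atLeast0)
    also have "\<dots> = u i k * of_real (a i)" using dec ki by (simp add: eigen_decomp_def)
    also have "\<dots> = (\<Sum>j<n. u j k * (if j = i then of_real (a j) else 0))"
      using ki by (simp add: if_distrib[of "\<lambda>x. _ * x"] cong: if_cong)
    also have "\<dots> = (U * D) $$ (k, i)"
      using ki by (simp add: U_def D_def scalar_prod_def lessThan_atLeast0)
    finally show "(A * U) $$ (k, i) = (U * D) $$ (k, i)" .
  qed (use A car in auto)
  have "U * D * V = A * (U * V)"
    using A car AU by (metis assoc_mult_mat)
  then have "A = U * D * V" using A UV by simp
  then have "similar_mat A D"
    using A car VU UV by (intro similar_matI[of _ _ U V n]) auto
  then have "char_poly A = char_poly D" by (rule char_poly_similar)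
  also have "\<dots> = (\<Prod>a\<leftarrow>diag_mat D. [:- a, 1:])"
    by (rule char_poly_upper_triangular[OF car(3)]) (auto simp: D_def upper_triangular_def)
  also have "\<dots> = (\<Prod>i<n. [:- of_real (a i), 1:])"
    using car by (simp add: diag_mat_def D_def comp_def prod.list_conv_set_nth lessThan_atLeast0)
  finally show ?thesis .
qed

lemma parseval:
  assumes "orthonormal n n u"
  shows "(\<Sum>i<n. cip n x (u i) * cip n (u i) y) = cip n x y"
proof -
  have "(\<Sum>i<n. cip n x (u i) * cip n (u i) y)
      = (\<Sum>i<n. \<Sum>k<n. \<Sum>l<n. cnj (x k) * y l * (u i k * cnj (u i l)))"
    unfolding cip_def sum_product by (simp add: mult_ac)
  also have "\<dots> = (\<Sum>k<n. \<Sum>l<n. \<Sum>i<n. cnj (x k) * y l * (u i k * cnj (u i l)))"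
    by (subst sum.swap, rule sum.cong[OF refl], rule sum.swap)
  also have "\<dots> = (\<Sum>k<n. \<Sum>l<n. cnj (x k) * y l * (if k = l then 1 else 0))"
    using orthonormal_complete[OF assms] by (simp flip: sum_distrib_left)
  also have "\<dots> = cip n x y"
    by (simp add: cip_def if_distrib[of "\<lambda>x. _ * x"] cong: if_cong)
  finally show ?thesis .
qed

lemma parseval_norm:
  assumes "orthonormal n n u"
  shows "(\<Sum>i<n. (cmod (cip n (u i) x))\<^sup>2) = (\<Sum>k<n. (cmod (x k))\<^sup>2)"
proof -
  have "cip n x x = (\<Sum>i<n. cip n x (u i) * cip n (u i) x)" using parseval[OF assms] by simp
  also have "\<dots> = of_real (\<Sum>i<n. (cmod (cip n (u i) x))\<^sup>2)"
    unfolding of_real_sum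
    by (intro sum.cong refl) (metis cip_commute complex_norm_square mult.commute)
  finally show ?thesis unfolding cip_self of_real_eq_iff by simp
qed

lemma cip_self_eq_one: "cip n x x = 1 \<longleftrightarrow> (\<Sum>k<n. (cmod (x k))\<^sup>2) = 1"
  unfolding cip_self by (metis of_real_eq_1_iff)

lemma cip_mat_vec_eigenvector:
  assumes "hermitian n A" "eigen_decomp n A a u" "i < n"
  shows "cip n (u i) (mat_vec n A x) = of_real (a i) * cip n (u i) x"
proof -
  have "cip n (mat_vec n A (u i)) x = of_real (a i) * cip n (u i) x"
    using assms(2,3) by (simp add: cip_def eigen_decomp_def sum_distrib_left mult_ac)
  then show ?thesis using hermitian_cip_mat_vec[OF assms(1)] by simp
qed

lemma quadratic_form_eigen:
  assumes "hermitian n A" "eigen_decomp n A a u"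
  shows "cip n x (mat_vec n A x) = of_real (\<Sum>i<n. a i * (cmod (cip n (u i) x))\<^sup>2)"
proof -
  have "cip n x (mat_vec n A x) = (\<Sum>i<n. cip n x (u i) * cip n (u i) (mat_vec n A x))"
    using assms(2) by (subst parseval) (auto simp: eigen_decomp_def)
  also have "\<dots> = (\<Sum>i<n. of_real (a i * (cmod (cip n (u i) x))\<^sup>2))"
  proof (intro sum.cong refl)
    fix i assume "i \<in> {..<n}"
    then have "cip n (u i) (mat_vec n A x) = of_real (a i) * cip n (u i) x"
      using cip_mat_vec_eigenvector[OF assms] by simp
    then show "cip n x (u i) * cip n (u i) (mat_vec n A x) = of_real (a i * (cmod (cip n (u i) x))\<^sup>2)"
      using cip_commute[of n x "u i"] by (simp add: complex_norm_square mult_ac del: of_real_power)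
  qed
  finally show ?thesis by simp
qed

text \<open>For orthonormal bases these numbers form a doubly stochastic matrix, a coupling of the two
  spectra.\<close>

definition overlap :: "nat \<Rightarrow> (nat \<Rightarrow> nat \<Rightarrow> complex) \<Rightarrow> (nat \<Rightarrow> nat \<Rightarrow> complex) \<Rightarrow> nat \<Rightarrow> nat \<Rightarrow> real" where
  "overlap n u v i j = (cmod (cip n (u i) (v j)))\<^sup>2"

lemma overlap_commute: "overlap n u v i j = overlap n v u j i"
  unfolding overlap_def by (subst cip_commute) simp

lemma overlap_nonneg [simp]: "overlap n u v i j \<ge> 0"
  by (simp add: overlap_def)

lemma overlap_row_sum:
  assumes "orthonormal n n u" "orthonormal n n v" "i < n"
  shows "(\<Sum>j<n. overlap n u v i j) = 1"
proof -
  have "(\<Sum>j<n. overlap n u v i j) = (\<Sum>k<n. (cmod (u i k))\<^sup>2)"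
    using parseval_norm[OF assms(2), of "u i"] by (simp add: overlap_commute[of n u v] overlap_def[of n v u])
  also have "\<dots> = 1" using assms by (simp add: cip_self_eq_one[symmetric] orthonormal_def)
  finally show ?thesis .
qed

lemma overlap_col_sum:
  assumes "orthonormal n n u" "orthonormal n n v" "j < n"
  shows "(\<Sum>i<n. overlap n u v i j) = 1"
  using overlap_row_sum[OF assms(2,1,3)] by (simp add: overlap_commute[of n u v])

lemma mat_vec_diff: "mat_vec n (\<lambda>k l. B k l - A k l) x = (\<lambda>k. mat_vec n B x k - mat_vec n A x k)"
  by (rule ext) (simp add: mat_vec_def left_diff_distrib sum_subtractf)

lemma mat_vec_add: "mat_vec n (\<lambda>k l. A k l + B k l) x = (\<lambda>k. mat_vec n A x k + mat_vec n B x k)"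
  by (rule ext) (simp add: mat_vec_def distrib_right sum.distrib)

lemma mat_vec_scale: "mat_vec n (\<lambda>k l. c * A k l) x = (\<lambda>k. c * mat_vec n A x k)"
  by (rule ext) (simp add: mat_vec_def sum_distrib_left mult_ac)

text \<open>Both sides equal \<open>\<langle>u\<^sub>i, B u\<^sub>i\<rangle> - a\<^sub>i\<close>.\<close>

lemma overlap_first_moment:
  assumes A: "hermitian n A" "eigen_decomp n A a u" and B: "hermitian n B" "eigen_decomp n B b v"
    and "i < n"
  shows "(\<Sum>j<n. overlap n u v i j * (b j - a i)) = Re (cip n (u i) (mat_vec n (\<lambda>k l. B k l - A k l) (u i)))"
proof -
  have "Re (cip n (u i) (mat_vec n B (u i))) = (\<Sum>j<n. b j * overlap n u v i j)"
    unfolding quadratic_form_eigen[OF B] by (simp add: overlap_commute[of n u v] overlap_def[of n v u])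
  moreover have "cip n (u i) (mat_vec n A (u i)) = of_real (a i)"
    using cip_mat_vec_eigenvector[OF A \<open>i < n\<close>] A(2) \<open>i < n\<close> by (simp add: eigen_decomp_def orthonormal_def)
  moreover have "(\<Sum>j<n. a i * overlap n u v i j) = a i"
    using overlap_row_sum[of n u v i] A B \<open>i < n\<close> by (simp add: eigen_decomp_def flip: sum_distrib_left)
  ultimately show ?thesis
    by (simp add: mat_vec_diff cip_diff_right right_diff_distrib sum_subtractf mult.commute[of "overlap n u v i _"] left_diff_distrib)
qed

definition frob_sq :: "nat \<Rightarrow> (nat \<Rightarrow> nat \<Rightarrow> complex) \<Rightarrow> real" where
  "frob_sq n H = (\<Sum>k<n. \<Sum>l<n. (cmod (H k l))\<^sup>2)"

lemma frob_sq_nonneg [simp]: "frob_sq n H \<ge> 0"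
  by (simp add: frob_sq_def sum_nonneg)

lemma frob_sq_unitary:
  assumes "orthonormal n n u" "orthonormal n n v"
  shows "(\<Sum>i<n. \<Sum>j<n. (cmod (cip n (u i) (mat_vec n H (v j))))\<^sup>2) = frob_sq n H"
proof -
  have "(\<Sum>i<n. \<Sum>j<n. (cmod (cip n (u i) (mat_vec n H (v j))))\<^sup>2)
      = (\<Sum>j<n. \<Sum>k<n. (cmod (mat_vec n H (v j) k))\<^sup>2)"
    by (subst sum.swap) (simp add: parseval_norm[OF assms(1)])
  also have "\<dots> = (\<Sum>k<n. \<Sum>j<n. (cmod (cip n (v j) (\<lambda>l. cnj (H k l))))\<^sup>2)"
  proof (subst sum.swap, intro sum.cong refl)
    fix k j
    have "mat_vec n H (v j) k = cnj (cip n (v j) (\<lambda>l. cnj (H k l)))"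
      by (simp add: mat_vec_def cip_def mult.commute)
    then show "(cmod (mat_vec n H (v j) k))\<^sup>2 = (cmod (cip n (v j) (\<lambda>l. cnj (H k l))))\<^sup>2" by simp
  qed
  also have "\<dots> = frob_sq n H"
    by (simp add: parseval_norm[OF assms(2)] frob_sq_def)
  finally show ?thesis .
qed

text \<open>Since \<open>(b\<^sub>j - a\<^sub>i) \<langle>u\<^sub>i, v\<^sub>j\<rangle> = \<langle>u\<^sub>i, (B - A) v\<^sub>j\<rangle>\<close>, this is unitary invariance of the
  Frobenius norm.\<close>

lemma overlap_second_moment:
  assumes A: "hermitian n A" "eigen_decomp n A a u" and B: "hermitian n B" "eigen_decomp n B b v"
  shows "(\<Sum>i<n. \<Sum>j<n. overlap n u v i j * (b j - a i)\<^sup>2) = frob_sq n (\<lambda>k l. B k l - A k l)"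
proof -
  have "overlap n u v i j * (b j - a i)\<^sup>2
      = (cmod (cip n (u i) (mat_vec n (\<lambda>k l. B k l - A k l) (v j))))\<^sup>2" if "i < n" "j < n" for i j
  proof -
    have "cip n (u i) (mat_vec n B (v j)) = of_real (b j) * cip n (u i) (v j)"
      using B(2) \<open>j < n\<close> by (simp add: cip_def eigen_decomp_def sum_distrib_left mult_ac)
    moreover have "cip n (u i) (mat_vec n A (v j)) = of_real (a i) * cip n (u i) (v j)"
      using cip_mat_vec_eigenvector[OF A \<open>i < n\<close>] .
    ultimately have "cip n (u i) (mat_vec n (\<lambda>k l. B k l - A k l) (v j))
        = of_real (b j - a i) * cip n (u i) (v j)"
      by (simp add: mat_vec_diff cip_diff_right left_diff_distrib)
    then show ?thesis by (simp add: overlap_def norm_mult power_mult_distrib mult.commute del: of_real_diff)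
  qed
  then have "(\<Sum>i<n. \<Sum>j<n. overlap n u v i j * (b j - a i)\<^sup>2)
      = (\<Sum>i<n. \<Sum>j<n. (cmod (cip n (u i) (mat_vec n (\<lambda>k l. B k l - A k l) (v j))))\<^sup>2)" by simp
  then show ?thesis using frob_sq_unitary A(2) B(2) by (simp add: eigen_decomp_def)
qed

lemma overlap_sum_diff:
  assumes "orthonormal n n u" "orthonormal n n v"
  shows "(\<Sum>j<n. g j) - (\<Sum>i<n. f i) = (\<Sum>i<n. \<Sum>j<n. overlap n u v i j * (g j - f i))"
proof -
  have "(\<Sum>i<n. \<Sum>j<n. overlap n u v i j * g j) = (\<Sum>j<n. g j)"
    using overlap_col_sum[OF assms] by (subst sum.swap) (simp flip: sum_distrib_right)
  moreover have "(\<Sum>i<n. \<Sum>j<n. overlap n u v i j * f i) = (\<Sum>i<n. f i)"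
    using overlap_row_sum[OF assms] by (simp flip: sum_distrib_right)
  ultimately show ?thesis by (simp add: right_diff_distrib sum_subtractf)
qed

text \<open>The trace of \<open>f(A)\<close>.  An arbitrary eigenbasis may be chosen, by the next lemma.\<close>

definition spectral_sum :: "nat \<Rightarrow> (real \<Rightarrow> real) \<Rightarrow> (nat \<Rightarrow> nat \<Rightarrow> complex) \<Rightarrow> real" where
  "spectral_sum n f A = (\<Sum>i<n. f ((SOME a. \<exists>u. eigen_decomp n A a u) i))"

text \<open>The overlaps of two eigenbases of the same matrix have second moment \<open>0\<close>, so they only couple
  equal eigenvalues.\<close>

lemma spectral_sum_eq:
  assumes A: "hermitian n A" and dec: "eigen_decomp n A a u"
  shows "spectral_sum n f A = (\<Sum>i<n. f (a i))"
proof -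
  define b where "b = (SOME b. \<exists>v. eigen_decomp n A b v)"
  have "\<exists>v. eigen_decomp n A b v" using someI_ex[of "\<lambda>b. \<exists>v. eigen_decomp n A b v"] dec unfolding b_def by blast
  then obtain v where v: "eigen_decomp n A b v" by blast
  have "(\<Sum>i<n. \<Sum>j<n. overlap n u v i j * (b j - a i)\<^sup>2) = 0"
    by (subst overlap_second_moment[OF A dec A v]) (simp add: frob_sq_def)
  then have "overlap n u v i j * (b j - a i)\<^sup>2 = 0" if "i < n" "j < n" for i j
    using that by (simp add: sum_nonneg_eq_0_iff sum_nonneg)
  then have "overlap n u v i j * (f (b j) - f (a i)) = 0" if "i < n" "j < n" for i j
    using that by fastforce
  then have "(\<Sum>j<n. f (b j)) - (\<Sum>i<n. f (a i)) = 0"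
    using dec v by (subst overlap_sum_diff[of n u v]) (auto simp: eigen_decomp_def intro!: sum.neutral)
  then show ?thesis by (simp add: spectral_sum_def b_def)
qed

lemma spectral_sum_diff:
  assumes A: "hermitian n A" "eigen_decomp n A a u" and B: "hermitian n B" "eigen_decomp n B b v"
  shows "spectral_sum n f B - spectral_sum n f A
       = (\<Sum>i<n. \<Sum>j<n. overlap n u v i j * (f (b j) - f (a i)))"
  using overlap_sum_diff[of n u v] A B by (simp add: spectral_sum_eq eigen_decomp_def)

section \<open>Perturbation of Lipschitz spectral sums\<close>

lemma hermitian_add: "hermitian n A \<Longrightarrow> hermitian n B \<Longrightarrow> hermitian n (\<lambda>k l. A k l + B k l)"
  by (simp add: hermitian_def)

lemma hermitian_diff: "hermitian n A \<Longrightarrow> hermitian n B \<Longrightarrow> hermitian n (\<lambda>k l. A k l - B k l)"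
  by (simp add: hermitian_def)

lemma hermitian_scale: "hermitian n A \<Longrightarrow> hermitian n (\<lambda>k l. of_real t * A k l)"
  by (simp add: hermitian_def)

lemma frob_sq_scale: "frob_sq n (\<lambda>k l. of_real t * H k l) = t\<^sup>2 * frob_sq n H"
  by (simp add: frob_sq_def norm_mult power_mult_distrib sum_distrib_left)

text \<open>First-order expansion of \<open>tr F\<close> at \<open>A\<close> in the direction \<open>H\<close>.  The derivative is
  \<open>\<Sum>\<^sub>i F'(a\<^sub>i) \<langle>w\<^sub>i, H w\<^sub>i\<rangle>\<close>; the hypothesis bounds all sums of this form whose coefficients lie in the
  range \<open>[l, u]\<close> of the derivative, whatever the eigenbasis is.\<close>

lemma spectral_sum_step:
  assumes A: "hermitian n A" and H: "hermitian n H"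
    and F: "\<And>x. (F has_real_derivative F' x) (at x)"
    and lip: "\<And>x y. \<bar>F' x - F' y\<bar> \<le> C * \<bar>x - y\<bar>"
    and range: "\<And>x. F' x \<in> {l..u}"
    and K: "\<And>w d. orthonormal n n w \<Longrightarrow> (\<And>i. i < n \<Longrightarrow> d i \<in> {l..u}) \<Longrightarrow>
      (\<Sum>i<n. d i * Re (cip n (w i) (mat_vec n H (w i)))) \<le> K"
    and t: "t \<ge> 0"
  shows "spectral_sum n F (\<lambda>k l. A k l + of_real t * H k l) - spectral_sum n F A
    \<le> t * K + C * t\<^sup>2 * frob_sq n H"
proof -
  define B where "B = (\<lambda>k l. A k l + of_real t * H k l)"
  have B: "hermitian n B" unfolding B_def by (intro hermitian_add hermitian_scale A H)
  obtain a w where a: "eigen_decomp n A a w" using exists_eigen_decomp[OF A] by blast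
  obtain b v where b: "eigen_decomp n B b v" using exists_eigen_decomp[OF B] by blast
  have BA: "(\<lambda>k l. B k l - A k l) = (\<lambda>k l. of_real t * H k l)" by (simp add: B_def)
  have taylor: "F y - F x \<le> F' x * (y - x) + C * (y - x)\<^sup>2" for x y
  proof -
    have C: "C \<ge> 0" using lip[of 0 1] by (simp add: order_trans[OF abs_ge_zero])
    have "\<exists>z. \<bar>z - x\<bar> \<le> \<bar>y - x\<bar> \<and> F y - F x = F' z * (y - x)"
    proof (cases x y rule: linorder_cases)
      case less
      then obtain z where "x < z" "z < y" "F y - F x = (y - x) * F' z"
        using MVT2[of x y F F'] F by blast
      then show ?thesis by (intro exI[of _ z]) (auto simp: mult.commute)
    next
      case greater
      then obtain z where "y < z" "z < x" "F x - F y = (x - y) * F' z"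
        using MVT2[of y x F F'] F by blast
      then show ?thesis by (intro exI[of _ z]) (auto simp: algebra_simps)
    qed auto
    then obtain z where z: "\<bar>z - x\<bar> \<le> \<bar>y - x\<bar>" "F y - F x = F' z * (y - x)" by blast
    have "(F' z - F' x) * (y - x) \<le> \<bar>F' z - F' x\<bar> * \<bar>y - x\<bar>"
      by (metis abs_ge_self abs_mult)
    also have "\<dots> \<le> (C * \<bar>z - x\<bar>) * \<bar>y - x\<bar>" by (intro mult_right_mono lip) auto
    also have "\<dots> \<le> (C * \<bar>y - x\<bar>) * \<bar>y - x\<bar>" using z(1) C by (intro mult_right_mono mult_left_mono) auto
    finally show ?thesis using z(2) by (simp add: power2_eq_square algebra_simps)
  qed
  have "spectral_sum n F B - spectral_sum n F A
      \<le> (\<Sum>i<n. \<Sum>j<n. overlap n w v i j * (F' (a i) * (b j - a i) + C * (b j - a i)\<^sup>2))"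
    unfolding spectral_sum_diff[OF A a B b] by (intro sum_mono mult_left_mono taylor) simp
  also have "\<dots> = (\<Sum>i<n. F' (a i) * (\<Sum>j<n. overlap n w v i j * (b j - a i)))
      + C * (\<Sum>i<n. \<Sum>j<n. overlap n w v i j * (b j - a i)\<^sup>2)"
    by (simp add: distrib_left sum.distrib sum_distrib_left mult_ac)
  also have "(\<Sum>i<n. \<Sum>j<n. overlap n w v i j * (b j - a i)\<^sup>2) = t\<^sup>2 * frob_sq n H"
    unfolding overlap_second_moment[OF A a B b] BA frob_sq_scale ..
  also have "(\<Sum>i<n. F' (a i) * (\<Sum>j<n. overlap n w v i j * (b j - a i)))
      = t * (\<Sum>i<n. F' (a i) * Re (cip n (w i) (mat_vec n H (w i))))"
  proof (subst sum_distrib_left, intro sum.cong refl)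
    fix i assume "i \<in> {..<n}"
    then have "(\<Sum>j<n. overlap n w v i j * (b j - a i)) = t * Re (cip n (w i) (mat_vec n H (w i)))"
      using overlap_first_moment[OF A a B b, of i] by (simp add: BA mat_vec_scale cip_scale_right)
    then show "F' (a i) * (\<Sum>j<n. overlap n w v i j * (b j - a i))
        = t * (F' (a i) * Re (cip n (w i) (mat_vec n H (w i))))" by simp
  qed
  also have "\<dots> \<le> t * K"
    using t range K[of w "\<lambda>i. F' (a i)"] a by (intro mult_left_mono) (auto simp: eigen_decomp_def)
  finally show ?thesis by (simp add: B_def mult_ac)
qed

text \<open>In \<open>N\<close> equal steps the quadratic errors add up to \<open>O(1/N)\<close>.\<close>

lemma spectral_sum_smooth_mean_value:
  assumes A: "hermitian n A" and H: "hermitian n H"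
    and F: "\<And>x. (F has_real_derivative F' x) (at x)"
    and lip: "\<And>x y. \<bar>F' x - F' y\<bar> \<le> C * \<bar>x - y\<bar>"
    and range: "\<And>x. F' x \<in> {l..u}"
    and K: "\<And>w d. orthonormal n n w \<Longrightarrow> (\<And>i. i < n \<Longrightarrow> d i \<in> {l..u}) \<Longrightarrow>
      (\<Sum>i<n. d i * Re (cip n (w i) (mat_vec n H (w i)))) \<le> K"
  shows "spectral_sum n F (\<lambda>k l. A k l + H k l) - spectral_sum n F A \<le> K"
proof (rule LIMSEQ_le_const)
  show "(\<lambda>N. K + C * frob_sq n H * inverse (real (Suc N))) \<longlonglongrightarrow> K"
    using tendsto_add[OF tendsto_const[of K] tendsto_mult_right_zero[OF LIMSEQ_inverse_real_of_nat, of "C * frob_sq n H"]]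
    by simp
  have "spectral_sum n F (\<lambda>k l. A k l + H k l) - spectral_sum n F A
      \<le> K + C * frob_sq n H * inverse (real (Suc N))" for N
  proof -
    define h where "h = inverse (real (Suc N))"
    have h: "h \<ge> 0" "real (Suc N) * h = 1" by (auto simp: h_def)
    \<comment> \<open>Each step starts at another Hermitian matrix, but the bounds do not depend on it.\<close>
    have "spectral_sum n F (\<lambda>k l. A k l + of_real (real m * h) * H k l) - spectral_sum n F A
        \<le> real m * (h * K + C * h\<^sup>2 * frob_sq n H)" for m
    proof (induction m)
      case (Suc m)
      have "hermitian n (\<lambda>k l. A k l + of_real (real m * h) * H k l)"
        by (intro hermitian_add hermitian_scale A H)
      note step = spectral_sum_step[OF this H F lip range K h(1)]
      have "(\<lambda>k l. A k l + of_real (real m * h) * H k l + of_real h * H k l)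
          = (\<lambda>k l. A k l + of_real (real (Suc m) * h) * H k l)"
        by (simp add: distrib_right algebra_simps)
      with step Suc show ?case by (simp add: distrib_right)
    qed simp
    from this[of "Suc N"] have "spectral_sum n F (\<lambda>k l. A k l + H k l) - spectral_sum n F A
        \<le> real (Suc N) * (h * K + C * h\<^sup>2 * frob_sq n H)"
      unfolding h(2) by simp
    also have "\<dots> = (real (Suc N) * h) * K + C * frob_sq n H * h * (real (Suc N) * h)"
      by (simp only: power2_eq_square distrib_left mult_ac)
    finally show ?thesis unfolding h(2) by (simp add: h_def)
  qed
  then show "\<exists>N0. \<forall>N\<ge>N0. spectral_sum n F (\<lambda>k l. A k l + H k l) - spectral_sum n F A
      \<le> K + C * frob_sq n H * inverse (real (Suc N))" by blast
qed

lemma spectral_sum_close: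
  assumes "hermitian n A" and "\<And>x. \<bar>F x - f x\<bar> \<le> \<delta>"
  shows "\<bar>spectral_sum n F A - spectral_sum n f A\<bar> \<le> real n * \<delta>"
proof -
  obtain a u where a: "eigen_decomp n A a u" using exists_eigen_decomp[OF assms(1)] by blast
  have "\<bar>\<Sum>i<n. F (a i) - f (a i)\<bar> \<le> (\<Sum>i<n. \<delta>)"
    by (rule order_trans[OF sum_abs sum_mono]) (rule assms(2))
  then show ?thesis by (simp add: spectral_sum_eq[OF assms(1) a] sum_subtractf)
qed

text \<open>\<open>F\<close> is the moving average of \<open>f\<close> over \<open>[x, x + \<epsilon>]\<close>, so its derivative is a difference quotient
  of \<open>f\<close> and inherits both the range of the slopes and a Lipschitz bound.\<close>

lemma lipschitz_smoothing:
  fixes f :: "real \<Rightarrow> real"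
  assumes f: "L-lipschitz_on UNIV f" and \<epsilon>: "\<epsilon> > 0"
  obtains F where "\<And>x. (F has_real_derivative (f (x + \<epsilon>) - f x) / \<epsilon>) (at x)"
    "\<And>x. \<bar>F x - f x\<bar> \<le> L * \<epsilon>"
proof -
  have "continuous_on UNIV f" using f by (rule lipschitz_on_continuous_on)
  then have "\<exists>G. \<forall>x :: real. -\<infinity> < ereal x \<longrightarrow> ereal x < \<infinity> \<longrightarrow> (G has_vector_derivative f x) (at x)"
    by (intro einterval_antiderivative) (auto simp: continuous_on_eq_continuous_at)
  then obtain G where G: "\<And>x. (G has_real_derivative f x) (at x)"
    by (auto simp: has_real_derivative_iff_has_vector_derivative)
  show ?thesis
  proof
    show "((\<lambda>x. (G (x + \<epsilon>) - G x) / \<epsilon>) has_real_derivative (f (x + \<epsilon>) - f x) / \<epsilon>) (at x)" for x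
    proof -
      have "((\<lambda>x. G (x + \<epsilon>)) has_real_derivative f (x + \<epsilon>)) (at x)"
        using G[of "x + \<epsilon>"] by (simp add: DERIV_shift)
      then show ?thesis by (intro DERIV_cdivide DERIV_diff G)
    qed
    show "\<bar>(G (x + \<epsilon>) - G x) / \<epsilon> - f x\<bar> \<le> L * \<epsilon>" for x
    proof -
      obtain z where z: "x < z" "z < x + \<epsilon>" "G (x + \<epsilon>) - G x = (x + \<epsilon> - x) * f z"
        using MVT2[of x "x + \<epsilon>" G f] G \<epsilon> by auto
      then have "(G (x + \<epsilon>) - G x) / \<epsilon> = f z" using \<epsilon> by simp
      moreover have "\<bar>f z - f x\<bar> \<le> L * \<bar>z - x\<bar>"
        using lipschitz_onD[OF f, of z x] by (simp add: dist_real_def)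
      moreover have "L * \<bar>z - x\<bar> \<le> L * \<epsilon>"
        using z lipschitz_on_nonneg[OF f] by (intro mult_left_mono) auto
      ultimately show ?thesis by simp
    qed
  qed
qed

lemma spectral_sum_mean_value:
  assumes A: "hermitian n A" and H: "hermitian n H"
    and f: "L-lipschitz_on UNIV f"
    and slope: "\<And>x y. x < y \<Longrightarrow> (f y - f x) / (y - x) \<in> {l..u}"
    and K: "\<And>w d. orthonormal n n w \<Longrightarrow> (\<And>i. i < n \<Longrightarrow> d i \<in> {l..u}) \<Longrightarrow>
      (\<Sum>i<n. d i * Re (cip n (w i) (mat_vec n H (w i)))) \<le> K"
  shows "spectral_sum n f (\<lambda>k l. A k l + H k l) - spectral_sum n f A \<le> K"
proof (rule field_le_epsilon)
  fix e :: real assume "e > 0"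
  have L: "L \<ge> 0" using f by (rule lipschitz_on_nonneg)
  define \<epsilon> where "\<epsilon> = e / (2 * (real n * L + 1))"
  have "real n * L + 1 > 0" using L by (simp add: add_nonneg_pos)
  then have \<epsilon>: "\<epsilon> > 0" and "2 * (real n * L + 1) * \<epsilon> = e" using \<open>e > 0\<close> by (auto simp: \<epsilon>_def)
  then have small: "2 * (real n * (L * \<epsilon>)) \<le> e" by (simp add: algebra_simps)
  obtain F where F: "\<And>x. (F has_real_derivative (f (x + \<epsilon>) - f x) / \<epsilon>) (at x)"
    and close: "\<And>x. \<bar>F x - f x\<bar> \<le> L * \<epsilon>"
    using lipschitz_smoothing[OF f \<epsilon>] by metis
  have "spectral_sum n F (\<lambda>k l. A k l + H k l) - spectral_sum n F A \<le> K"
  proof (rule spectral_sum_smooth_mean_value[OF A H F _ _ K])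
    show "\<bar>(f (x + \<epsilon>) - f x) / \<epsilon> - (f (y + \<epsilon>) - f y) / \<epsilon>\<bar> \<le> (2 * L / \<epsilon>) * \<bar>x - y\<bar>" for x y
    proof -
      have "\<bar>f (x + \<epsilon>) - f (y + \<epsilon>)\<bar> \<le> L * \<bar>x - y\<bar>" "\<bar>f x - f y\<bar> \<le> L * \<bar>x - y\<bar>"
        using lipschitz_onD[OF f, of "x + \<epsilon>" "y + \<epsilon>"] lipschitz_onD[OF f, of x y]
        by (simp_all add: dist_real_def)
      then have "\<bar>(f (x + \<epsilon>) - f x) - (f (y + \<epsilon>) - f y)\<bar> \<le> 2 * L * \<bar>x - y\<bar>" by linarith
      then show ?thesis using \<epsilon> by (simp flip: diff_divide_distrib add: divide_right_mono abs_divide)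
    qed
    show "(f (x + \<epsilon>) - f x) / \<epsilon> \<in> {l..u}" for x using slope[of x "x + \<epsilon>"] \<epsilon> by simp
  qed
  moreover have "\<bar>spectral_sum n F A - spectral_sum n f A\<bar> \<le> real n * (L * \<epsilon>)"
    by (rule spectral_sum_close[OF A close])
  moreover have "\<bar>spectral_sum n F (\<lambda>k l. A k l + H k l) - spectral_sum n f (\<lambda>k l. A k l + H k l)\<bar>
      \<le> real n * (L * \<epsilon>)"
    by (rule spectral_sum_close[OF hermitian_add[OF A H] close])
  ultimately show "spectral_sum n f (\<lambda>k l. A k l + H k l) - spectral_sum n f A \<le> K + e"
    using small by linarith
qed

text \<open>The slopes of \<open>-f\<close> are nonpositive, whereas the quadratic form of \<open>H\<close> is nonnegative.\<close>

lemma spectral_sum_mono_lipschitz: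
  assumes A: "hermitian n A" and H: "hermitian n H"
    and f: "L-lipschitz_on UNIV f" and "mono f"
    and psd: "\<And>x. Re (cip n x (mat_vec n H x)) \<ge> 0"
  shows "spectral_sum n f A \<le> spectral_sum n f (\<lambda>k l. A k l + H k l)"
proof -
  have "spectral_sum n (\<lambda>x. - f x) (\<lambda>k l. A k l + H k l) - spectral_sum n (\<lambda>x. - f x) A \<le> 0"
  proof (rule spectral_sum_mean_value[OF A H lipschitz_on_minus[OF f], of "- L" 0])
    show "(- f y - - f x) / (y - x) \<in> {- L..0}" if "x < y" for x y
    proof -
      have "f y - f x \<le> L * (y - x)"
        using lipschitz_onD[OF f, of y x] that by (simp add: dist_real_def)
      then show ?thesis using that monoD[OF \<open>mono f\<close>, of x y] by (simp add: field_simps)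
    qed
    show "(\<Sum>i<n. d i * Re (cip n (w i) (mat_vec n H (w i)))) \<le> 0"
      if "\<And>i. i < n \<Longrightarrow> d i \<in> {- L..0}" for w d
      using that psd by (intro sum_nonpos mult_nonpos_nonneg) auto
  qed
  moreover have "spectral_sum n (\<lambda>x. - f x) B = - spectral_sum n f B" for B
    by (simp add: spectral_sum_def sum_negf)
  ultimately show ?thesis by simp
qed

text \<open>In any orthonormal basis the diagonal of \<open>H\<close> is the image of its spectrum under a doubly
  stochastic matrix, so the \<open>\<ell>\<^sup>1\<close> norm of the diagonal is at most the trace norm.\<close>

lemma spectral_sum_trace_norm:
  assumes A: "hermitian n A" and H: "hermitian n H" and h: "eigen_decomp n H h x"
    and f: "1-lipschitz_on UNIV f"
  shows "spectral_sum n f (\<lambda>k l. A k l + H k l) - spectral_sum n f A \<le> (\<Sum>i<n. \<bar>h i\<bar>)"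
proof (rule spectral_sum_mean_value[OF A H f, of "-1" 1])
  show "(f y - f x) / (y - x) \<in> {- 1..1}" if "x < y" for x y
  proof -
    have "\<bar>f y - f x\<bar> \<le> y - x" using lipschitz_onD[OF f, of y x] that by (simp add: dist_real_def)
    then show ?thesis using that unfolding abs_le_iff by (simp add: divide_le_eq le_divide_eq)
  qed
  fix w d assume w: "orthonormal n n w" and d: "\<And>i. i < n \<Longrightarrow> d i \<in> {- 1..(1::real)}"
  have x: "orthonormal n n x" using h by (simp add: eigen_decomp_def)
  have "(\<Sum>i<n. d i * Re (cip n (w i) (mat_vec n H (w i)))) \<le> (\<Sum>i<n. \<Sum>j<n. \<bar>h j\<bar> * overlap n x w j i)"
  proof (intro sum_mono)
    fix i assume "i \<in> {..<n}"
    have "d i * Re (cip n (w i) (mat_vec n H (w i))) = d i * (\<Sum>j<n. h j * overlap n x w j i)"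
      unfolding quadratic_form_eigen[OF H h] by (simp add: overlap_def)
    also have "\<dots> \<le> \<bar>d i\<bar> * \<bar>\<Sum>j<n. h j * overlap n x w j i\<bar>" by (metis abs_ge_self abs_mult)
    also have "\<dots> \<le> 1 * \<bar>\<Sum>j<n. h j * overlap n x w j i\<bar>"
      using d[of i] \<open>i \<in> {..<n}\<close> by (intro mult_right_mono) (auto simp: abs_le_iff)
    also have "\<dots> \<le> (\<Sum>j<n. \<bar>h j\<bar> * overlap n x w j i)"
      using sum_abs[of "\<lambda>j. h j * overlap n x w j i" "{..<n}"] by (simp add: abs_mult)
    finally show "d i * Re (cip n (w i) (mat_vec n H (w i))) \<le> (\<Sum>j<n. \<bar>h j\<bar> * overlap n x w j i)" .
  qed
  also have "\<dots> = (\<Sum>j<n. \<bar>h j\<bar>)"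
    using overlap_row_sum[OF x w] by (subst sum.swap) (simp flip: sum_distrib_left)
  finally show "(\<Sum>i<n. d i * Re (cip n (w i) (mat_vec n H (w i)))) \<le> (\<Sum>i<n. \<bar>h i\<bar>)" .
qed

text \<open>A concave power lies below its tangents; this is the weighted inequality of arithmetic and
  geometric means.\<close>

lemma powr_tangent:
  fixes a b q :: real
  assumes "0 \<le> q" "q \<le> 1" "a > 0" "b \<ge> 0"
  shows "b powr q \<le> a powr q + q * a powr (q - 1) * (b - a)"
proof -
  have aq: "a powr (q - 1) * a = a powr q" using assms by (simp add: powr_diff)
  have *: "a powr q + q * a powr (q - 1) * (b - a) = a powr (q - 1) * (q * b + (1 - q) * a)"
    by (simp add: aq[symmetric] algebra_simps)
  show ?thesis
  proof (cases "b = 0")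
    case True
    then show ?thesis unfolding * using assms by simp
  next
    case False
    then have b: "b > 0" using assms by simp
    have "exp ((1 - q) *\<^sub>R ln a + q *\<^sub>R ln b) \<le> (1 - q) * exp (ln a) + q * exp (ln b)"
      using convex_onD[OF exp_convex, of q "ln a" "ln b"] assms by simp
    then have "b powr q * a powr (1 - q) \<le> q * b + (1 - q) * a"
      using assms b by (simp add: powr_def exp_add mult_ac)
    then have "a powr (q - 1) * (b powr q * a powr (1 - q)) \<le> a powr (q - 1) * (q * b + (1 - q) * a)"
      by (intro mult_left_mono) auto
    moreover have "a powr (q - 1) * a powr (1 - q) = 1" using assms by (simp flip: powr_add)
    ultimately show ?thesis unfolding * by (simp add: mult_ac)
  qed
qed

lemma jensen_powr:
  fixes w y :: "'i \<Rightarrow> real"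
  assumes "finite I" "\<And>i. i \<in> I \<Longrightarrow> w i \<ge> 0" "sum w I = 1" "\<And>i. i \<in> I \<Longrightarrow> y i \<ge> 0" "0 < q" "q \<le> 1"
  shows "(\<Sum>i\<in>I. w i * y i powr q) \<le> (\<Sum>i\<in>I. w i * y i) powr q"
proof (cases "(\<Sum>i\<in>I. w i * y i) = 0")
  case True
  then have "\<And>i. i \<in> I \<Longrightarrow> w i * y i = 0"
    using assms by (subst (asm) sum_nonneg_eq_0_iff) auto
  then have "(\<Sum>i\<in>I. w i * y i powr q) = 0" by (intro sum.neutral) auto
  then show ?thesis by simp
next
  case False
  define c where "c = (\<Sum>i\<in>I. w i * y i)"
  have c: "c > 0" using False assms by (simp add: c_def order_less_le sum_nonneg)
  have "(\<Sum>i\<in>I. w i * y i powr q) \<le> (\<Sum>i\<in>I. w i * (c powr q + q * c powr (q - 1) * (y i - c)))"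
    using assms c by (intro sum_mono mult_left_mono powr_tangent) auto
  also have "\<dots> = sum w I * c powr q + q * c powr (q - 1) * ((\<Sum>i\<in>I. w i * y i) - sum w I * c)"
    by (simp add: sum.distrib sum_subtractf sum_distrib_left sum_distrib_right algebra_simps)
  finally show ?thesis by (simp add: assms(3) c_def)
qed

lemma powr_subadditive:
  fixes x y :: real
  assumes "x \<ge> 0" "y \<ge> 0" "0 < q" "q \<le> 1"
  shows "(x + y) powr q \<le> x powr q + y powr q"
proof (cases "x = 0 \<or> y = 0")
  case False
  then have pos: "x > 0" "y > 0" using assms by auto
  have "(x + y) powr q = (x + y) * (x + y) powr (q - 1)" using pos by (simp add: powr_diff)
  also have "\<dots> = x * (x + y) powr (q - 1) + y * (x + y) powr (q - 1)" by (rule distrib_right)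
  also have "\<dots> \<le> x * x powr (q - 1) + y * y powr (q - 1)"
    using pos assms by (intro add_mono mult_left_mono powr_mono2') auto
  also have "\<dots> = x powr q + y powr q" using pos by (simp add: powr_diff)
  finally show ?thesis .
qed auto

lemma powr_sum_subadditive:
  fixes x :: "'i \<Rightarrow> real"
  assumes "finite I" "\<And>i. i \<in> I \<Longrightarrow> x i \<ge> 0" "0 < q" "q \<le> 1"
  shows "(\<Sum>i\<in>I. x i) powr q \<le> (\<Sum>i\<in>I. x i powr q)"
  using assms(1,2)
proof (induction rule: finite_induct)
  case (insert i I)
  then have "(x i + sum x I) powr q \<le> x i powr q + sum x I powr q"
    using assms by (intro powr_subadditive sum_nonneg) auto
  with insert show ?case by fastforce
qed simp

text \<open>The vector of the squared row norms of \<open>H\<close> is the diagonal of \<open>H\<^sup>2\<close>, hence the image of the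
  squared eigenvalues under a doubly stochastic matrix.  By Jensen's inequality for the concave
  function \<open>y \<mapsto> y^{p/2}\<close> the \<open>p/2\<close>-th powers of the squared eigenvalues have the smaller sum, and
  subadditivity of that function splits each row into its entries.\<close>

lemma schatten_le_entries:
  assumes H: "hermitian n H" and h: "eigen_decomp n H h x" and p: "0 < p" "p \<le> 2"
  shows "(\<Sum>i<n. \<bar>h i\<bar> powr p) \<le> (\<Sum>k<n. \<Sum>l<n. cmod (H k l) powr p)"
proof -
  have x: "orthonormal n n x" using h by (simp add: eigen_decomp_def)
  have sq: "(t\<^sup>2) powr (p / 2) = t powr p" if "t \<ge> 0" for t :: real
    using that by (simp add: powr_powr flip: powr_numeral)
  have col: "(\<Sum>i<n. (cmod (x i k))\<^sup>2) = 1" if "k < n" for k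
  proof -
    have "complex_of_real (\<Sum>i<n. (cmod (x i k))\<^sup>2) = 1"
      using orthonormal_complete[OF x that that] by (simp add: complex_norm_square del: of_real_power)
    then show ?thesis using of_real_eq_1_iff by blast
  qed
  have row: "(\<Sum>i<n. (cmod (x i k))\<^sup>2 * \<bar>h i\<bar>\<^sup>2) = (\<Sum>l<n. (cmod (H k l))\<^sup>2)" if "k < n" for k
  proof -
    have "(cmod (x i k))\<^sup>2 * \<bar>h i\<bar>\<^sup>2 = (cmod (cip n (x i) (\<lambda>l. cnj (H k l))))\<^sup>2" if "i < n" for i
    proof -
      have "cip n (x i) (\<lambda>l. cnj (H k l)) = cnj (mat_vec n H (x i) k)"
        by (simp add: cip_def mat_vec_def mult.commute)
      also have "mat_vec n H (x i) k = of_real (h i) * x i k"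
        using h \<open>i < n\<close> \<open>k < n\<close> by (simp add: eigen_decomp_def)
      finally show ?thesis by (simp add: norm_mult power_mult_distrib)
    qed
    then show ?thesis using parseval_norm[OF x, of "\<lambda>l. cnj (H k l)"] by simp
  qed
  have "(\<Sum>i<n. \<bar>h i\<bar> powr p) = (\<Sum>i<n. \<Sum>k<n. (cmod (x i k))\<^sup>2 * \<bar>h i\<bar> powr p)"
  proof (intro sum.cong refl)
    fix i assume "i \<in> {..<n}"
    then have "(\<Sum>k<n. (cmod (x i k))\<^sup>2) = 1"
      using x by (simp add: orthonormal_def flip: cip_self_eq_one)
    then show "\<bar>h i\<bar> powr p = (\<Sum>k<n. (cmod (x i k))\<^sup>2 * \<bar>h i\<bar> powr p)"
      by (simp flip: sum_distrib_right)
  qed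
  also have "\<dots> = (\<Sum>k<n. \<Sum>i<n. (cmod (x i k))\<^sup>2 * (\<bar>h i\<bar>\<^sup>2) powr (p / 2))"
    by (subst sum.swap) (simp only: sq[OF abs_ge_zero])
  also have "\<dots> \<le> (\<Sum>k<n. (\<Sum>i<n. (cmod (x i k))\<^sup>2 * \<bar>h i\<bar>\<^sup>2) powr (p / 2))"
    using p by (intro sum_mono jensen_powr) (auto simp: col)
  also have "\<dots> = (\<Sum>k<n. (\<Sum>l<n. (cmod (H k l))\<^sup>2) powr (p / 2))"
    by (intro sum.cong refl) (simp only: row lessThan_iff)
  also have "\<dots> \<le> (\<Sum>k<n. \<Sum>l<n. ((cmod (H k l))\<^sup>2) powr (p / 2))"
    using p by (intro sum_mono powr_sum_subadditive) auto
  finally show ?thesis by (simp only: sq[OF norm_ge_zero])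
qed

text \<open>Jensen's inequality for the uniform distribution on the indices.\<close>

lemma power_mean:
  fixes y :: "nat \<Rightarrow> real"
  assumes "p \<ge> 1" "\<And>i. i < n \<Longrightarrow> y i \<ge> 0" "n \<ge> 1"
  shows "(\<Sum>i<n. y i) \<le> real n powr (1 - 1 / p) * (\<Sum>i<n. y i powr p) powr (1 / p)"
proof -
  have "(\<Sum>i<n. y i) = real n * (\<Sum>i<n. (1 / real n) * (y i powr p) powr (1 / p))"
    using assms by (simp add: powr_powr flip: sum_divide_distrib)
  also have "\<dots> \<le> real n * (\<Sum>i<n. (1 / real n) * y i powr p) powr (1 / p)"
    using assms by (intro mult_left_mono jensen_powr) auto
  also have "(\<Sum>i<n. (1 / real n) * y i powr p) = (\<Sum>i<n. y i powr p) / real n"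
    by (simp add: sum_divide_distrib)
  also have "real n * ((\<Sum>i<n. y i powr p) / real n) powr (1 / p) = real n powr (1 - 1 / p) * (\<Sum>i<n. y i powr p) powr (1 / p)"
    using assms by (simp add: powr_diff powr_divide sum_nonneg)
  finally show ?thesis .
qed

text \<open>The power of \<open>n\<close> is the price for passing from the Schatten \<open>1\<close>-norm to the Schatten \<open>p\<close>-norm.\<close>

lemma spectral_sum_lp_perturb:
  assumes A: "hermitian n A" and H: "hermitian n H" and f: "1-lipschitz_on UNIV f"
    and p: "1 \<le> p" "p \<le> 2" and n: "n \<ge> 1"
  shows "spectral_sum n f (\<lambda>k l. A k l + H k l) - spectral_sum n f A
    \<le> real n powr (1 - 1 / p) * (\<Sum>k<n. \<Sum>l<n. cmod (H k l) powr p) powr (1 / p)"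
proof -
  obtain h x where h: "eigen_decomp n H h x" using exists_eigen_decomp[OF H] by blast
  have "spectral_sum n f (\<lambda>k l. A k l + H k l) - spectral_sum n f A \<le> (\<Sum>i<n. \<bar>h i\<bar>)"
    by (rule spectral_sum_trace_norm[OF A H h f])
  also have "\<dots> \<le> real n powr (1 - 1 / p) * (\<Sum>i<n. \<bar>h i\<bar> powr p) powr (1 / p)"
    using p n by (intro power_mean) auto
  also have "\<dots> \<le> real n powr (1 - 1 / p) * (\<Sum>k<n. \<Sum>l<n. cmod (H k l) powr p) powr (1 / p)"
    using p by (intro mult_left_mono powr_mono2 schatten_le_entries[OF H h]) (auto intro: sum_nonneg)
  finally show ?thesis .
qed

lemma spectral_sum_frob:
  assumes A: "hermitian n A" and B: "hermitian n B" and f: "1-lipschitz_on UNIV f" and n: "n \<ge> 1"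
  shows "\<bar>spectral_sum n f B - spectral_sum n f A\<bar>
    \<le> sqrt (real n) * sqrt (frob_sq n (\<lambda>k l. B k l - A k l))"
proof -
  have *: "spectral_sum n f D - spectral_sum n f C
      \<le> sqrt (real n) * sqrt (frob_sq n (\<lambda>k l. D k l - C k l))"
    if C: "hermitian n C" and D: "hermitian n D" for C D
    using spectral_sum_lp_perturb[OF C hermitian_diff[OF D C] f _ _ n, of 2]
    by (simp add: frob_sq_def powr_half_sqrt sum_nonneg)
  have "frob_sq n (\<lambda>k l. A k l - B k l) = frob_sq n (\<lambda>k l. B k l - A k l)"
    by (simp add: frob_sq_def norm_minus_commute)
  then show ?thesis using *[OF A B] *[OF B A] by simp
qed

section \<open>Perturbation of spectral sums of truncated powers\<close>

lemma mat_vec_cong: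
  "(\<And>k l. k < n \<Longrightarrow> l < n \<Longrightarrow> A k l = B k l) \<Longrightarrow> k < n \<Longrightarrow> mat_vec n A x k = mat_vec n B x k"
  by (simp add: mat_vec_def)

lemma spectral_sum_cong:
  assumes "\<And>k l. k < n \<Longrightarrow> l < n \<Longrightarrow> A k l = B k l"
  shows "spectral_sum n f A = spectral_sum n f B"
proof -
  have "eigen_decomp n A = eigen_decomp n B"
    using mat_vec_cong[OF assms] by (intro ext) (simp add: eigen_decomp_def)
  then show ?thesis by (simp add: spectral_sum_def)
qed

definition rank_one :: "(nat \<Rightarrow> complex) \<Rightarrow> nat \<Rightarrow> nat \<Rightarrow> complex" where
  "rank_one v k l = v k * cnj (v l)"

lemma hermitian_rank_one: "hermitian n (rank_one v)"
  by (simp add: hermitian_def rank_one_def mult.commute)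

lemma mat_vec_rank_one: "mat_vec n (rank_one v) x = (\<lambda>k. cip n v x * v k)"
  by (rule ext) (simp add: mat_vec_def rank_one_def cip_def sum_distrib_right sum_distrib_left mult_ac)

lemma quadratic_form_rank_one: "cip n x (mat_vec n (rank_one v) x) = of_real ((cmod (cip n v x))\<^sup>2)"
  unfolding mat_vec_rank_one cip_scale_right
  by (simp add: complex_norm_square cip_commute[of n x v] mult.commute del: of_real_power)

lemma quadratic_form_add_rank_one:
  "Re (cip n x (mat_vec n (\<lambda>k l. A k l + of_real t * rank_one v k l) x))
    = Re (cip n x (mat_vec n A x)) + t * (cmod (cip n v x))\<^sup>2"
proof -
  have "cip n x (\<lambda>k. mat_vec n A x k + of_real t * mat_vec n (rank_one v) x k)
      = cip n x (mat_vec n A x) + of_real t * cip n x (mat_vec n (rank_one v) x)"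
    by (simp add: cip_def distrib_left sum.distrib sum_distrib_left mult_ac)
  then show ?thesis
    by (simp add: mat_vec_add mat_vec_scale quadratic_form_rank_one del: of_real_power)
qed

text \<open>The matrix with prescribed eigenvalues and eigenbasis.\<close>

definition from_eigen :: "nat \<Rightarrow> (nat \<Rightarrow> real) \<Rightarrow> (nat \<Rightarrow> nat \<Rightarrow> complex) \<Rightarrow> nat \<Rightarrow> nat \<Rightarrow> complex" where
  "from_eigen n a u k l = (\<Sum>i<n. of_real (a i) * rank_one (u i) k l)"

lemma hermitian_from_eigen: "hermitian n (from_eigen n a u)"
  by (simp add: hermitian_def from_eigen_def rank_one_def mult_ac)

lemma mat_vec_sum_left: "mat_vec n (\<lambda>k l. \<Sum>i\<in>I. A i k l) x = (\<lambda>k. \<Sum>i\<in>I. mat_vec n (A i) x k)"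
  by (rule ext) (simp add: mat_vec_def sum_distrib_right sum.swap[of _ I])

lemma eigen_decomp_from_eigen:
  assumes "orthonormal n n u"
  shows "eigen_decomp n (from_eigen n a u) a u"
proof -
  have "mat_vec n (from_eigen n a u) (u j) k = of_real (a j) * u j k" if "j < n" for j k
  proof -
    have "mat_vec n (from_eigen n a u) (u j) k = (\<Sum>i<n. of_real (a i) * (cip n (u i) (u j) * u i k))"
      unfolding from_eigen_def mat_vec_sum_left by (simp add: mat_vec_scale mat_vec_rank_one)
    also have "\<dots> = (\<Sum>i<n. if i = j then of_real (a j) * u j k else 0)"
      using assms that by (intro sum.cong) (auto simp: orthonormal_def)
    finally show ?thesis using that by simp
  qed
  then show ?thesis using assms by (simp add: eigen_decomp_def)
qed

lemma from_eigen_eq: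
  assumes dec: "eigen_decomp n A a u" and "k < n" "l < n"
  shows "from_eigen n a u k l = A k l"
proof -
  have u: "orthonormal n n u" using dec by (simp add: eigen_decomp_def)
  have "from_eigen n a u k l = (\<Sum>i<n. mat_vec n A (u i) k * cnj (u i l))"
    using dec \<open>k < n\<close> by (simp add: from_eigen_def rank_one_def eigen_decomp_def mult_ac)
  also have "\<dots> = (\<Sum>m<n. A k m * (\<Sum>i<n. u i m * cnj (u i l)))"
    unfolding mat_vec_def sum_distrib_left sum_distrib_right by (subst sum.swap) (simp only: mult_ac)
  also have "\<dots> = (\<Sum>m<n. A k m * (if m = l then 1 else 0))"
    using orthonormal_complete[OF u _ \<open>l < n\<close>] by simp
  also have "\<dots> = A k l" using \<open>l < n\<close> by (simp add: if_distrib[of "\<lambda>x. _ * x"] cong: if_cong)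
  finally show ?thesis .
qed

lemma eigenvalue_ge:
  assumes dec: "eigen_decomp n D d v" and "j < n"
    and ge: "\<And>x. Re (cip n x (mat_vec n D x)) \<ge> c * (\<Sum>k<n. (cmod (x k))\<^sup>2)"
  shows "d j \<ge> c"
proof -
  have "cip n (v j) (mat_vec n D (v j)) = of_real (d j) * cip n (v j) (v j)"
    using dec \<open>j < n\<close> by (simp add: cip_def eigen_decomp_def sum_distrib_left mult_ac)
  moreover have "cip n (v j) (v j) = 1" using dec \<open>j < n\<close> by (simp add: eigen_decomp_def orthonormal_def)
  ultimately show ?thesis using ge[of "v j"] by (simp add: cip_self_eq_one)
qed

lemma quadratic_form_ge_eigen:
  assumes A: "hermitian n A" "eigen_decomp n A a u" and "\<And>i. i < n \<Longrightarrow> a i \<ge> c"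
  shows "Re (cip n x (mat_vec n A x)) \<ge> c * (\<Sum>k<n. (cmod (x k))\<^sup>2)"
proof -
  have u: "orthonormal n n u" using A by (simp add: eigen_decomp_def)
  have "c * (\<Sum>k<n. (cmod (x k))\<^sup>2) = (\<Sum>i<n. c * (cmod (cip n (u i) x))\<^sup>2)"
    by (simp add: parseval_norm[OF u] flip: sum_distrib_left)
  also have "\<dots> \<le> (\<Sum>i<n. a i * (cmod (cip n (u i) x))\<^sup>2)"
    using assms(3) by (intro sum_mono mult_right_mono) auto
  finally show ?thesis by (simp add: quadratic_form_eigen[OF A])
qed

text \<open>The expansion of \<open>tr x^\<alpha>\<close> at a positive definite \<open>C\<close> in the direction \<open>v v\<^sup>*\<close>; by concavity there
  is no error term to control.\<close>

lemma spectral_sum_powr_step: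
  assumes C: "hermitian n C" "eigen_decomp n C c w" and pos: "\<And>i. i < n \<Longrightarrow> c i > 0"
    and h: "h \<ge> 0" and \<alpha>: "0 < \<alpha>" "\<alpha> < 1"
  shows "spectral_sum n (\<lambda>x. x powr \<alpha>) (\<lambda>k l. C k l + of_real h * rank_one v k l)
      - spectral_sum n (\<lambda>x. x powr \<alpha>) C
    \<le> h * (\<Sum>i<n. \<alpha> * c i powr (\<alpha> - 1) * (cmod (cip n (w i) v))\<^sup>2)"
proof -
  define D where "D = (\<lambda>k l. C k l + of_real h * rank_one v k l)"
  have D: "hermitian n D" unfolding D_def by (intro hermitian_add hermitian_scale C hermitian_rank_one)
  obtain d z where d: "eigen_decomp n D d z" using exists_eigen_decomp[OF D] by blast
  have "Re (cip n x (mat_vec n D x)) \<ge> 0 * (\<Sum>k<n. (cmod (x k))\<^sup>2)" for x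
    using quadratic_form_ge_eigen[OF C, of 0 x] pos h
    by (simp add: D_def quadratic_form_add_rank_one add_nonneg_nonneg less_imp_le)
  then have d_pos: "d j \<ge> 0" if "j < n" for j using eigenvalue_ge[OF d that, of 0] by blast
  have DC: "(\<lambda>k l. D k l - C k l) = (\<lambda>k l. of_real h * rank_one v k l)" by (simp add: D_def)
  have first: "(\<Sum>j<n. overlap n w z i j * (d j - c i)) = h * (cmod (cip n (w i) v))\<^sup>2" if "i < n" for i
    unfolding overlap_first_moment[OF C D d that] DC mat_vec_scale cip_scale_right quadratic_form_rank_one
    by (subst cip_commute) (simp del: of_real_power)
  have "spectral_sum n (\<lambda>x. x powr \<alpha>) D - spectral_sum n (\<lambda>x. x powr \<alpha>) C
      \<le> (\<Sum>i<n. \<Sum>j<n. overlap n w z i j * (\<alpha> * c i powr (\<alpha> - 1) * (d j - c i)))"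
    unfolding spectral_sum_diff[OF C D d]
  proof (intro sum_mono mult_left_mono)
    fix i j assume "i \<in> {..<n}" "j \<in> {..<n}"
    then show "d j powr \<alpha> - c i powr \<alpha> \<le> \<alpha> * c i powr (\<alpha> - 1) * (d j - c i)"
      using powr_tangent[of \<alpha> "c i" "d j"] pos[of i] d_pos[of j] \<alpha> by simp
  qed simp
  also have "\<dots> = (\<Sum>i<n. \<alpha> * c i powr (\<alpha> - 1) * (\<Sum>j<n. overlap n w z i j * (d j - c i)))"
    by (simp add: sum_distrib_left mult_ac)
  also have "\<dots> = h * (\<Sum>i<n. \<alpha> * c i powr (\<alpha> - 1) * (cmod (cip n (w i) v))\<^sup>2)"
    by (subst sum_distrib_left, intro sum.cong refl) (simp add: first)
  finally show ?thesis by (simp add: D_def)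
qed

text \<open>The left-hand side is \<open>q = \<langle>v, C\<^sup>-\<^sup>1 v\<rangle>\<close> for \<open>C = A + s v v\<^sup>*\<close>.  As \<open>C \<ge> s v v\<^sup>*\<close>, testing with
  \<open>x = C\<^sup>-\<^sup>1 v\<close> gives \<open>q \<ge> s q\<^sup>2\<close>.\<close>

lemma resolvent_rank_one_le:
  assumes psd: "\<And>x. Re (cip n x (mat_vec n A x)) \<ge> 0"
    and C: "hermitian n (\<lambda>k l. A k l + of_real s * rank_one v k l)"
      "eigen_decomp n (\<lambda>k l. A k l + of_real s * rank_one v k l) c w"
    and pos: "\<And>i. i < n \<Longrightarrow> c i > 0" and s: "s > 0"
  shows "(\<Sum>i<n. (cmod (cip n (w i) v))\<^sup>2 / c i) \<le> 1 / s"
proof -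
  define q where "q = (\<Sum>i<n. (cmod (cip n (w i) v))\<^sup>2 / c i)"
  define x where "x k = (\<Sum>i<n. cip n (w i) v / of_real (c i) * w i k)" for k
  have wx: "cip n (w j) x = cip n (w j) v / of_real (c j)" if "j < n" for j
  proof -
    have "cip n (w j) x = (\<Sum>i<n. cip n (w i) v / of_real (c i) * cip n (w j) (w i))"
      unfolding x_def cip_sum_right cip_scale_right ..
    also have "\<dots> = (\<Sum>i<n. if i = j then cip n (w j) v / of_real (c j) else 0)"
      using C that by (intro sum.cong) (auto simp: eigen_decomp_def orthonormal_def)
    finally show ?thesis using that by simp
  qed
  have vx: "cip n v x = of_real q"
  proof -
    have "cip n v x = (\<Sum>i<n. cip n v (w i) * cip n (w i) x)"
      using C by (subst parseval) (auto simp: eigen_decomp_def)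
    also have "\<dots> = (\<Sum>i<n. of_real ((cmod (cip n (w i) v))\<^sup>2 / c i))"
      by (intro sum.cong refl)
        (simp add: wx complex_norm_square cip_commute[of n v "w _"] mult.commute del: of_real_power)
    finally show ?thesis by (simp add: q_def)
  qed
  have "s * q\<^sup>2 \<le> Re (cip n x (mat_vec n (\<lambda>k l. A k l + of_real s * rank_one v k l) x))"
    unfolding quadratic_form_add_rank_one vx using psd[of x] by simp
  also have "\<dots> = (\<Sum>i<n. c i * (cmod (cip n (w i) x))\<^sup>2)"
    unfolding quadratic_form_eigen[OF C] by simp
  also have "\<dots> = q"
    unfolding q_def using pos
    by (intro sum.cong refl) (auto simp: wx norm_divide power_divide power2_eq_square less_imp_neq[symmetric])
  finally have "s * q * q \<le> 1 * q" by (simp add: power2_eq_square mult_ac)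
  moreover have "q \<ge> 0" unfolding q_def using pos by (intro sum_nonneg) (auto simp: less_imp_le)
  ultimately have "s * q \<le> 1" using mult_right_le_imp_le[of "s * q" q 1] by (cases "q = 0") auto
  then show ?thesis using s by (simp add: q_def field_simps)
qed

text \<open>Along \<open>C(s) = A + s v v\<^sup>*\<close> the trace of \<open>C(s)^\<alpha>\<close> grows at the rate \<open>\<alpha> \<langle>v, C(s)^{\<alpha>-1} v\<rangle>\<close>.
  Jensen's inequality for \<open>y \<mapsto> y^{1-\<alpha>}\<close> under the spectral distribution of \<open>v\<close> and the bound
  \<open>\<langle>v, C(s)\<^sup>-\<^sup>1 v\<rangle> \<le> 1/s\<close> make this at most \<open>\<alpha> s^{\<alpha>-1}\<close>, whose integral over \<open>[0, t]\<close> is \<open>t^\<alpha>\<close>.\<close>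

lemma spectral_sum_powr_rank_one_pd:
  assumes A: "hermitian n A" and dec: "eigen_decomp n A a u" and \<epsilon>: "\<epsilon> > 0" "\<And>i. i < n \<Longrightarrow> a i \<ge> \<epsilon>"
    and v: "cip n v v = 1" and t: "t \<ge> 0" and \<alpha>: "0 < \<alpha>" "\<alpha> < 1"
  shows "spectral_sum n (\<lambda>x. x powr \<alpha>) (\<lambda>k l. A k l + of_real t * rank_one v k l)
    \<le> spectral_sum n (\<lambda>x. x powr \<alpha>) A + t powr \<alpha>"
proof -
  let ?S = "spectral_sum n (\<lambda>x. x powr \<alpha>)"
  define C where "C s = (\<lambda>k l. A k l + of_real s * rank_one v k l)" for s :: real
  have C: "hermitian n (C s)" for s
    unfolding C_def by (intro hermitian_add hermitian_scale A hermitian_rank_one)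
  have ge: "Re (cip n x (mat_vec n A x)) \<ge> \<epsilon> * (\<Sum>k<n. (cmod (x k))\<^sup>2)" for x
    by (rule quadratic_form_ge_eigen[OF A dec \<epsilon>(2)])
  have psd: "Re (cip n x (mat_vec n A x)) \<ge> 0" for x
    by (rule order_trans[OF _ ge]) (use \<epsilon> in \<open>simp add: sum_nonneg\<close>)
  \<comment> \<open>At \<open>s = 0\<close> the rate \<open>\<alpha> s^{\<alpha>-1}\<close> is infinite; there the lower bound \<open>\<epsilon>\<close> on the spectrum is used instead.\<close>
  have step: "?S (C (s + h)) - ?S (C s) \<le> h * (\<alpha> * (if s = 0 then \<epsilon> else s) powr (\<alpha> - 1))"
    if s: "s \<ge> 0" and h: "h \<ge> 0" for s h
  proof -
    obtain c w where c: "eigen_decomp n (C s) c w" using exists_eigen_decomp[OF C] by blast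
    have on: "orthonormal n n w" using c by (simp add: eigen_decomp_def)
    have c_ge: "c i \<ge> \<epsilon>" if "i < n" for i
      by (rule eigenvalue_ge[OF c that])
        (use ge s in \<open>simp add: C_def quadratic_form_add_rank_one add_increasing2\<close>)
    have c_pos: "c i > 0" if "i < n" for i using c_ge[OF that] \<epsilon> by simp
    define \<nu> where "\<nu> i = (cmod (cip n (w i) v))\<^sup>2" for i
    have \<nu>: "(\<Sum>i<n. \<nu> i) = 1" "\<And>i. \<nu> i \<ge> 0"
      using v by (simp_all add: \<nu>_def parseval_norm[OF on] cip_self_eq_one)
    have C_add: "(\<lambda>k l. C s k l + of_real h * rank_one v k l) = C (s + h)"
      by (simp add: C_def algebra_simps)
    have "?S (C (s + h)) - ?S (C s) \<le> h * (\<alpha> * (\<Sum>i<n. \<nu> i * c i powr (\<alpha> - 1)))"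
      using spectral_sum_powr_step[OF C c c_pos h \<alpha>, of v]
      unfolding C_add \<nu>_def by (simp add: sum_distrib_left mult_ac)
    also have "(\<Sum>i<n. \<nu> i * c i powr (\<alpha> - 1)) \<le> (if s = 0 then \<epsilon> else s) powr (\<alpha> - 1)"
    proof (cases "s = 0")
      case True
      have "(\<Sum>i<n. \<nu> i * c i powr (\<alpha> - 1)) \<le> (\<Sum>i<n. \<nu> i * \<epsilon> powr (\<alpha> - 1))"
        using \<nu> c_ge \<epsilon> \<alpha> by (intro sum_mono mult_left_mono powr_mono2') auto
      also have "\<dots> = \<epsilon> powr (\<alpha> - 1)" using \<nu> by (simp flip: sum_distrib_right)
      finally show ?thesis using True by simp
    next
      case False
      then have s': "s > 0" using s by simp
      have inv: "(1 / y) powr (1 - \<alpha>) = y powr (\<alpha> - 1)" if "y > 0" for y :: real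
        using that by (simp add: powr_divide powr_diff)
      have "(\<Sum>i<n. \<nu> i * c i powr (\<alpha> - 1)) = (\<Sum>i<n. \<nu> i * (1 / c i) powr (1 - \<alpha>))"
        using c_pos by (intro sum.cong) (simp_all add: inv)
      also have "\<dots> \<le> (\<Sum>i<n. \<nu> i * (1 / c i)) powr (1 - \<alpha>)"
        using \<nu> c_pos \<alpha> by (intro jensen_powr) (auto simp: less_imp_le)
      also have "\<dots> \<le> (1 / s) powr (1 - \<alpha>)"
      proof (rule powr_mono2)
        show "0 \<le> (\<Sum>i<n. \<nu> i * (1 / c i))"
          using c_pos by (intro sum_nonneg) (simp add: \<nu>(2) less_imp_le)
        show "(\<Sum>i<n. \<nu> i * (1 / c i)) \<le> 1 / s"
          using resolvent_rank_one_le[OF psd C[unfolded C_def] c[unfolded C_def] c_pos s']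
          by (simp add: \<nu>_def)
      qed (use \<alpha> in simp)
      finally show ?thesis using inv[OF s'] False by simp
    qed
    finally show ?thesis using h \<alpha> by (simp add: mult_left_mono)
  qed
  have bound: "?S (C t) \<le> ?S (C 0) + t powr \<alpha> + t * (\<alpha> * \<epsilon> powr (\<alpha> - 1)) * inverse (real (Suc N))" for N
  proof -
    define h where "h = t * inverse (real (Suc N))"
    have h: "h \<ge> 0" "real (Suc N) * h = t" using t by (auto simp: h_def)
    \<comment> \<open>The rate at the left end of a step is compared with the increment of \<open>s^\<alpha>\<close> over the preceding step, whence the shift between \<open>Suc m\<close> and \<open>m\<close>.\<close>
    have "?S (C (real (Suc m) * h)) \<le> ?S (C 0) + h * (\<alpha> * \<epsilon> powr (\<alpha> - 1)) + (real m * h) powr \<alpha>" for m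
    proof (induction m)
      case 0
      show ?case using step[of 0 h] h by simp
    next
      case (Suc m)
      define s where "s = real (Suc m) * h"
      have s: "s \<ge> 0" "real (Suc (Suc m)) * h = s + h" "real m * h = s - h"
        using h by (auto simp: s_def algebra_simps)
      have "h * (\<alpha> * (if s = 0 then \<epsilon> else s) powr (\<alpha> - 1)) \<le> s powr \<alpha> - (s - h) powr \<alpha>"
      proof (cases "h = 0")
        case False
        then have "s > 0" "s - h \<ge> 0" using h s(3) by (auto simp: s_def intro!: mult_pos_pos)
        then show ?thesis using powr_tangent[of \<alpha> s "s - h"] \<alpha> by (simp add: algebra_simps)
      qed simp
      then have "?S (C (s + h)) \<le> ?S (C s) + (s powr \<alpha> - (s - h) powr \<alpha>)"
        using step[OF s(1) h(1)] by linarith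
      with Suc show ?case unfolding s(2,3) s_def[symmetric] by linarith
    qed
    from this[of N] have "?S (C t) \<le> ?S (C 0) + h * (\<alpha> * \<epsilon> powr (\<alpha> - 1)) + (real N * h) powr \<alpha>"
      unfolding h(2) .
    also have "(real N * h) powr \<alpha> \<le> t powr \<alpha>"
      using h \<alpha> by (intro powr_mono2) (auto simp: distrib_right)
    finally show ?thesis by (simp add: h_def mult_ac)
  qed
  have "?S (C t) \<le> ?S (C 0) + t powr \<alpha>"
  proof (rule LIMSEQ_le_const)
    show "(\<lambda>N. ?S (C 0) + t powr \<alpha> + t * (\<alpha> * \<epsilon> powr (\<alpha> - 1)) * inverse (real (Suc N)))
        \<longlonglongrightarrow> ?S (C 0) + t powr \<alpha>"
      using tendsto_add[OF tendsto_const tendsto_mult_right_zero[OF LIMSEQ_inverse_real_of_nat]]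
      by fastforce
  qed (use bound in blast)
  then show ?thesis by (simp add: C_def)
qed

definition pos_powr :: "real \<Rightarrow> real \<Rightarrow> real" where
  "pos_powr \<alpha> x = max x 0 powr \<alpha>"

text \<open>The truncated power is not Lipschitz at \<open>0\<close>, so it is first flattened below a small \<open>\<delta>\<close>.\<close>

lemma spectral_sum_pos_powr_mono:
  assumes A: "hermitian n A" and H: "hermitian n H" and \<alpha>: "0 < \<alpha>" "\<alpha> < 1"
    and psd: "\<And>x. Re (cip n x (mat_vec n H x)) \<ge> 0"
  shows "spectral_sum n (pos_powr \<alpha>) A \<le> spectral_sum n (pos_powr \<alpha>) (\<lambda>k l. A k l + H k l)"
proof (rule field_le_epsilon)
  fix e :: real assume e: "e > 0"
  define \<delta> where "\<delta> = (e / (2 * (real n + 1))) powr (1 / \<alpha>)"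
  have \<delta>: "\<delta> > 0" "\<delta> powr \<alpha> = e / (2 * (real n + 1))"
    using e \<alpha> by (auto simp: \<delta>_def powr_powr)
  define f where "f x = max x \<delta> powr \<alpha>" for x
  define L where "L = \<alpha> * \<delta> powr (\<alpha> - 1)"
  have "L-lipschitz_on UNIV f"
  proof -
    have up: "f y - f x \<le> L * (y - x)" if "x \<le> y" for x y
    proof -
      let ?x = "max x \<delta>" and ?y = "max y \<delta>"
      have "?x > 0" "?y \<ge> 0" using \<delta> by linarith+
      then have "f y - f x \<le> \<alpha> * ?x powr (\<alpha> - 1) * (?y - ?x)"
        using powr_tangent[of \<alpha> ?x ?y] \<alpha> unfolding f_def by linarith
      also have "\<dots> \<le> L * (?y - ?x)"
        unfolding L_def using \<alpha> \<delta> that by (intro mult_right_mono mult_left_mono powr_mono2') auto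
      also have "\<dots> \<le> L * (y - x)"
        using \<alpha> \<delta> that by (intro mult_left_mono) (auto simp: L_def)
      finally show ?thesis .
    qed
    have mono: "f x \<le> f y" if "x \<le> y" for x y
      unfolding f_def using that \<alpha> \<delta> by (intro powr_mono2) auto
    show ?thesis
    proof (rule lipschitz_onI)
      show "dist (f x) (f y) \<le> L * dist x y" for x y
        using up[of x y] up[of y x] mono[of x y] mono[of y x]
        by (cases x y rule: linorder_le_cases) (auto simp: dist_real_def)
      show "L \<ge> 0" using \<alpha> by (simp add: L_def)
    qed
  qed
  moreover have "mono f" unfolding f_def using \<alpha> \<delta> by (intro monoI powr_mono2) auto
  ultimately have "spectral_sum n f A \<le> spectral_sum n f (\<lambda>k l. A k l + H k l)"
    by (intro spectral_sum_mono_lipschitz[OF A H _ _ psd])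
  moreover have close: "\<bar>f x - pos_powr \<alpha> x\<bar> \<le> \<delta> powr \<alpha>" for x
  proof -
    have "f x \<ge> pos_powr \<alpha> x" unfolding f_def pos_powr_def using \<delta> \<alpha> by (intro powr_mono2) auto
    moreover have "f x \<le> pos_powr \<alpha> x + \<delta> powr \<alpha>"
      unfolding f_def pos_powr_def using \<delta>(1) \<alpha> by (cases "x \<le> \<delta>") (auto simp: max_def)
    ultimately show ?thesis by simp
  qed
  moreover have "\<bar>spectral_sum n f A - spectral_sum n (pos_powr \<alpha>) A\<bar> \<le> real n * \<delta> powr \<alpha>"
    by (rule spectral_sum_close[OF A close])
  moreover have "\<bar>spectral_sum n f (\<lambda>k l. A k l + H k l)
      - spectral_sum n (pos_powr \<alpha>) (\<lambda>k l. A k l + H k l)\<bar> \<le> real n * \<delta> powr \<alpha>"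
    by (rule spectral_sum_close[OF hermitian_add[OF A H] close])
  moreover have "2 * (real n * \<delta> powr \<alpha>) \<le> e" using e by (simp add: \<delta>(2) field_simps)
  ultimately show "spectral_sum n (pos_powr \<alpha>) A \<le> spectral_sum n (pos_powr \<alpha>) (\<lambda>k l. A k l + H k l) + e"
    by linarith
qed

text \<open>By monotonicity \<open>A\<close> may be replaced by its positive part plus \<open>\<epsilon>\<close>, which is positive definite
  and has almost the same truncated powers.\<close>

lemma spectral_sum_pos_powr_rank_one_le:
  assumes A: "hermitian n A" and v: "cip n v v = 1" and t: "t \<ge> 0" and \<alpha>: "0 < \<alpha>" "\<alpha> < 1"
  shows "spectral_sum n (pos_powr \<alpha>) (\<lambda>k l. A k l + of_real t * rank_one v k l)
    \<le> spectral_sum n (pos_powr \<alpha>) A + t powr \<alpha>"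
proof (rule field_le_epsilon)
  fix e :: real assume e: "e > 0"
  define \<epsilon> where "\<epsilon> = (e / (real n + 1)) powr (1 / \<alpha>)"
  have \<epsilon>: "\<epsilon> > 0" "\<epsilon> powr \<alpha> = e / (real n + 1)" using e \<alpha> by (auto simp: \<epsilon>_def powr_powr)
  obtain a u where a: "eigen_decomp n A a u" using exists_eigen_decomp[OF A] by blast
  have u: "orthonormal n n u" using a by (simp add: eigen_decomp_def)
  define b where "b i = max (a i) 0 + \<epsilon>" for i
  define B where "B = from_eigen n b u"
  have B: "hermitian n B" "eigen_decomp n B b u"
    unfolding B_def by (rule hermitian_from_eigen, rule eigen_decomp_from_eigen[OF u])
  let ?A' = "\<lambda>k l. A k l + of_real t * rank_one v k l"
  let ?B' = "\<lambda>k l. B k l + of_real t * rank_one v k l"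
  have A': "hermitian n ?A'" and B': "hermitian n ?B'"
    by (intro hermitian_add hermitian_scale A B hermitian_rank_one)+
  have "spectral_sum n (pos_powr \<alpha>) ?A' \<le> spectral_sum n (pos_powr \<alpha>) (\<lambda>k l. ?A' k l + (B k l - A k l))"
  proof (rule spectral_sum_pos_powr_mono[OF A' hermitian_diff[OF B(1) A] \<alpha>])
    fix x
    have "Re (cip n x (mat_vec n (\<lambda>k l. B k l - A k l) x)) = (\<Sum>i<n. (b i - a i) * (cmod (cip n (u i) x))\<^sup>2)"
      by (simp add: mat_vec_diff cip_diff_right quadratic_form_eigen[OF B] quadratic_form_eigen[OF A a]
          left_diff_distrib sum_subtractf)
    also have "\<dots> \<ge> 0" using \<epsilon> by (intro sum_nonneg mult_nonneg_nonneg) (auto simp: b_def)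
    finally show "0 \<le> Re (cip n x (mat_vec n (\<lambda>k l. B k l - A k l) x))" .
  qed
  also have "(\<lambda>k l. ?A' k l + (B k l - A k l)) = ?B'" by (intro ext) simp
  also have "spectral_sum n (pos_powr \<alpha>) ?B' = spectral_sum n (\<lambda>x. x powr \<alpha>) ?B'"
  proof -
    obtain d z where d: "eigen_decomp n ?B' d z" using exists_eigen_decomp[OF B'] by blast
    have "Re (cip n x (mat_vec n ?B' x)) \<ge> 0 * (\<Sum>k<n. (cmod (x k))\<^sup>2)" for x
      using quadratic_form_ge_eigen[OF B, of 0 x] \<epsilon> t
      by (simp add: quadratic_form_add_rank_one b_def)
    then have "d j \<ge> 0" if "j < n" for j using eigenvalue_ge[OF d that, of 0] by blast
    then have "max (d j) 0 = d j" if "j < n" for j using that by simp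
    then show ?thesis by (simp add: spectral_sum_eq[OF B' d] pos_powr_def)
  qed
  also have "\<dots> \<le> spectral_sum n (\<lambda>x. x powr \<alpha>) B + t powr \<alpha>"
    by (rule spectral_sum_powr_rank_one_pd[OF B \<epsilon>(1) _ v t \<alpha>]) (simp add: b_def)
  also have "spectral_sum n (\<lambda>x. x powr \<alpha>) B \<le> spectral_sum n (pos_powr \<alpha>) A + e"
  proof -
    have "spectral_sum n (\<lambda>x. x powr \<alpha>) B \<le> (\<Sum>i<n. max (a i) 0 powr \<alpha> + \<epsilon> powr \<alpha>)"
      unfolding spectral_sum_eq[OF B] b_def using \<epsilon> \<alpha> by (intro sum_mono powr_subadditive) auto
    also have "\<dots> = spectral_sum n (pos_powr \<alpha>) A + real n * \<epsilon> powr \<alpha>"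
      by (simp add: spectral_sum_eq[OF A a] pos_powr_def sum.distrib)
    also have "real n * \<epsilon> powr \<alpha> \<le> e" using e by (simp add: \<epsilon>(2) field_simps)
    finally show ?thesis by simp
  qed
  finally show "spectral_sum n (pos_powr \<alpha>) ?A' \<le> spectral_sum n (pos_powr \<alpha>) A + t powr \<alpha> + e" by simp
qed

lemma spectral_sum_pos_powr_rank_one:
  assumes A: "hermitian n A" and v: "cip n v v = 1" and \<alpha>: "0 < \<alpha>" "\<alpha> < 1"
  shows "\<bar>spectral_sum n (pos_powr \<alpha>) (\<lambda>k l. A k l + of_real t * rank_one v k l)
    - spectral_sum n (pos_powr \<alpha>) A\<bar> \<le> \<bar>t\<bar> powr \<alpha>"
proof -
  have *: "\<bar>spectral_sum n (pos_powr \<alpha>) (\<lambda>k l. B k l + of_real s * rank_one v k l)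
      - spectral_sum n (pos_powr \<alpha>) B\<bar> \<le> s powr \<alpha>" if B: "hermitian n B" and s: "s \<ge> 0" for B s
  proof -
    have "Re (cip n x (mat_vec n (\<lambda>k l. of_real s * rank_one v k l) x)) \<ge> 0" for x
      using s by (simp add: mat_vec_scale cip_scale_right quadratic_form_rank_one del: of_real_power)
    then have "spectral_sum n (pos_powr \<alpha>) B
        \<le> spectral_sum n (pos_powr \<alpha>) (\<lambda>k l. B k l + of_real s * rank_one v k l)"
      by (intro spectral_sum_pos_powr_mono[OF B hermitian_scale[OF hermitian_rank_one] \<alpha>])
    with spectral_sum_pos_powr_rank_one_le[OF B v s \<alpha>] show ?thesis by simp
  qed
  show ?thesis
  proof (cases "t \<ge> 0")
    case False
    have "hermitian n (\<lambda>k l. A k l + of_real t * rank_one v k l)"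
      by (intro hermitian_add hermitian_scale A hermitian_rank_one)
    from *[OF this, of "- t"] False show ?thesis by (simp add: abs_minus_commute)
  qed (use *[OF A, of t] in simp)
qed

text \<open>\<open>H\<close> is added one eigenvector at a time.\<close>

lemma spectral_sum_pos_powr_perturb:
  assumes A: "hermitian n A" and H: "hermitian n H" and \<alpha>: "0 < \<alpha>" "\<alpha> < 1"
  shows "\<bar>spectral_sum n (pos_powr \<alpha>) (\<lambda>k l. A k l + H k l) - spectral_sum n (pos_powr \<alpha>) A\<bar>
    \<le> (\<Sum>k<n. \<Sum>l<n. cmod (H k l) powr \<alpha>)"
proof -
  obtain h x where h: "eigen_decomp n H h x" using exists_eigen_decomp[OF H] by blast
  define P where "P m = (\<lambda>k l. A k l + (\<Sum>i<m. of_real (h i) * rank_one (x i) k l))" for m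
  have P: "hermitian n (P m)" for m
    using A by (simp add: P_def hermitian_def rank_one_def mult_ac)
  have "\<bar>spectral_sum n (pos_powr \<alpha>) (P m) - spectral_sum n (pos_powr \<alpha>) A\<bar> \<le> (\<Sum>i<m. \<bar>h i\<bar> powr \<alpha>)"
    if "m \<le> n" for m
    using that
  proof (induction m)
    case 0
    show ?case by (simp add: P_def)
  next
    case (Suc m)
    have "cip n (x m) (x m) = 1" using h Suc.prems by (simp add: eigen_decomp_def orthonormal_def)
    note spectral_sum_pos_powr_rank_one[OF P[of m] this \<alpha>, of "h m"]
    moreover have "(\<lambda>k l. P m k l + of_real (h m) * rank_one (x m) k l) = P (Suc m)"
      by (simp add: P_def add.assoc)
    ultimately show ?case using Suc by simp
  qed
  from this[of n] have "\<bar>spectral_sum n (pos_powr \<alpha>) (P n) - spectral_sum n (pos_powr \<alpha>) A\<bar>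
      \<le> (\<Sum>i<n. \<bar>h i\<bar> powr \<alpha>)" by simp
  also have "\<dots> \<le> (\<Sum>k<n. \<Sum>l<n. cmod (H k l) powr \<alpha>)"
    using \<alpha> by (intro schatten_le_entries[OF H h]) auto
  also have "spectral_sum n (pos_powr \<alpha>) (P n) = spectral_sum n (pos_powr \<alpha>) (\<lambda>k l. A k l + H k l)"
    using from_eigen_eq[OF h] by (intro spectral_sum_cong) (simp add: P_def from_eigen_def)
  finally show ?thesis .
qed

lemma affine_eigen_decomp:
  assumes "hermitian n A" "eigen_decomp n A a u"
  shows "hermitian n (\<lambda>k l. of_real s * A k l + (if k = l then of_real r else 0))"
    "eigen_decomp n (\<lambda>k l. of_real s * A k l + (if k = l then of_real r else 0)) (\<lambda>i. s * a i + r) u"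
proof -
  show "hermitian n (\<lambda>k l. of_real s * A k l + (if k = l then of_real r else 0))"
    using assms(1) by (simp add: hermitian_def)
  have "mat_vec n (\<lambda>k l. if k = l then of_real r else 0) x k = of_real r * x k" if "k < n" for x k
    using that by (simp add: mat_vec_def if_distrib[of "\<lambda>y. y * _"] cong: if_cong)
  then show "eigen_decomp n (\<lambda>k l. of_real s * A k l + (if k = l then of_real r else 0)) (\<lambda>i. s * a i + r) u"
    using assms(2) by (simp add: eigen_decomp_def mat_vec_add mat_vec_scale algebra_simps)
qed

lemma spectral_sum_affine:
  assumes "hermitian n A"
  shows "spectral_sum n (\<lambda>x. f (s * x + r)) A
    = spectral_sum n f (\<lambda>k l. of_real s * A k l + (if k = l then of_real r else 0))"
proof -
  obtain a u where a: "eigen_decomp n A a u" using exists_eigen_decomp[OF assms] by blast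
  show ?thesis
    by (simp add: spectral_sum_eq[OF assms a] spectral_sum_eq[OF affine_eigen_decomp[OF assms a]])
qed

text \<open>The sign \<open>s\<close> is \<open>1\<close> for the kernels of left-sided and \<open>-1\<close> for those of right-sided fractional
  integrals.\<close>

lemma spectral_sum_shifted_pos_powr_perturb:
  assumes A: "hermitian n A" and H: "hermitian n H" and \<alpha>: "0 < \<alpha>" "\<alpha> < 1" and s: "\<bar>s\<bar> = 1"
  shows "\<bar>spectral_sum n (\<lambda>x. pos_powr \<alpha> (s * x + r)) (\<lambda>k l. A k l + H k l)
      - spectral_sum n (\<lambda>x. pos_powr \<alpha> (s * x + r)) A\<bar> \<le> (\<Sum>k<n. \<Sum>l<n. cmod (H k l) powr \<alpha>)"
proof -
  obtain a u where a: "eigen_decomp n A a u" using exists_eigen_decomp[OF A] by blast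
  have split: "(\<lambda>k l. of_real s * (A k l + H k l) + (if k = l then of_real r else 0))
      = (\<lambda>k l. (of_real s * A k l + (if k = l then of_real r else 0)) + of_real s * H k l)"
    by (simp add: fun_eq_iff algebra_simps)
  have "cmod (of_real s * H k l) = cmod (H k l)" for k l using s by (simp add: norm_mult)
  then show ?thesis
    using spectral_sum_pos_powr_perturb[OF affine_eigen_decomp(1)[OF A a, of s r] hermitian_scale[OF H, of s] \<alpha>]
    unfolding spectral_sum_affine[OF A] spectral_sum_affine[OF hermitian_add[OF A H]] split by simp
qed

section \<open>Signed measures and fractional integrals\<close>

text \<open>If the variation of a set \<open>E\<close> is infinite, \<open>E\<close> splits into two sets on both of which \<open>|\<sigma>|\<close>
  exceeds \<open>1\<close>, and one of them has infinite variation again.  Iterating produces disjoint sets \<open>E\<^sub>n - E\<^sub>n\<^sub>+\<^sub>1\<close>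
  on which \<open>\<sigma>\<close> does not tend to \<open>0\<close>, against countable additivity.  Finiteness matters because
  \<^const>\<open>measure\<close> assigns \<open>0\<close> to sets of infinite measure, so that a bound on it alone would not bound the
  total variation.\<close>

lemma emeasure_upper_variation_finite:
  assumes \<sigma>: "signed_measure \<sigma>"
  shows "emeasure (upper_variation \<sigma>) UNIV \<noteq> \<infinity>"
proof
  assume inf: "emeasure (upper_variation \<sigma>) UNIV = \<infinity>"
  let ?u = "emeasure (upper_variation \<sigma>)"
  have split: "\<exists>F. (F \<in> sets borel \<and> ?u F = \<infinity>) \<and> F \<subseteq> E \<and> \<bar>\<sigma> (E - F)\<bar> > 1"
    if E: "E \<in> sets borel \<and> ?u E = \<infinity>" for E
  proof -
    \<comment> \<open>If \<open>\<sigma>(B)\<close> exceeds this, then \<open>\<sigma>(E - B) < -1\<close>.\<close>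
    define r where "r = \<bar>\<sigma> E\<bar> + 1"
    have "ennreal r < ?u E" using E by simp
    then have "ennreal r < (SUP B\<in>{B \<in> sets borel. B \<subseteq> E}. ennreal (\<sigma> B))"
      using emeasure_upper_variation[OF \<sigma>, of E] E by simp
    then obtain B where B: "B \<in> sets borel" "B \<subseteq> E" "ennreal r < ennreal (\<sigma> B)"
      unfolding less_SUP_iff by blast
    have "r \<ge> 0" by (simp add: r_def)
    then have "r < \<sigma> B" using B(3) by (simp add: ennreal_less_iff)
    then have \<sigma>B: "\<sigma> B > \<bar>\<sigma> E\<bar> + 1" unfolding r_def .
    have EB: "E - B \<in> sets borel" "B \<union> (E - B) = E" using E B by auto
    have "\<sigma> E = \<sigma> B + \<sigma> (E - B)"
      using signed_measure_Un[OF \<sigma> B(1) EB(1)] EB(2) by auto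
    then have \<sigma>EB: "\<bar>\<sigma> (E - B)\<bar> > 1" using \<sigma>B by linarith
    have "?u E = ?u B + ?u (E - B)"
      using plus_emeasure[of B "upper_variation \<sigma>" "E - B"] B EB by auto
    then consider "?u B = \<infinity>" | "?u (E - B) = \<infinity>"
      using E by (metis ennreal_add_eq_top infinity_ennreal_def)
    then show ?thesis
    proof cases
      case 1
      then show ?thesis using B \<sigma>EB by blast
    next
      case 2
      moreover have "E - (E - B) = B" using B by blast
      moreover have "\<bar>\<sigma> B\<bar> > 1" using \<sigma>B by linarith
      ultimately show ?thesis using EB by (intro exI[of _ "E - B"]) auto
    qed
  qed
  obtain E where E: "\<And>n. E n \<in> sets borel \<and> ?u (E n) = \<infinity>"
    and step: "\<And>n. E (Suc n) \<subseteq> E n \<and> \<bar>\<sigma> (E n - E (Suc n))\<bar> > 1"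
    using dependent_nat_choice[of "\<lambda>n E. E \<in> sets borel \<and> ?u E = \<infinity>"
        "\<lambda>n E F. F \<subseteq> E \<and> \<bar>\<sigma> (E - F)\<bar> > 1"] inf split by (metis UNIV_I sets.top space_borel)
  have dec: "E m \<subseteq> E n" if "n \<le> m" for n m
    using that step by (metis lift_Suc_antimono_le)
  have "disjoint_family (\<lambda>n. E n - E (Suc n))"
    unfolding disjoint_family_on_def
  proof (intro ballI impI)
    fix m n :: nat assume "m \<noteq> n"
    then have "Suc m \<le> n \<or> Suc n \<le> m" by linarith
    then show "(E m - E (Suc m)) \<inter> (E n - E (Suc n)) = {}" using dec by blast
  qed
  moreover have "range (\<lambda>n. E n - E (Suc n)) \<subseteq> sets borel" using E by auto
  ultimately have "(\<lambda>n. \<sigma> (E n - E (Suc n))) sums \<sigma> (\<Union>n. E n - E (Suc n))"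
    using \<sigma> unfolding signed_measure_def by blast
  then have "(\<lambda>n. \<sigma> (E n - E (Suc n))) \<longlonglongrightarrow> 0"
    by (intro summable_LIMSEQ_zero sums_summable)
  from LIMSEQ_D[OF this, of 1] obtain n where "\<forall>m\<ge>n. norm (\<sigma> (E m - E (Suc m)) - 0) < 1"
    by auto
  then have "norm (\<sigma> (E n - E (Suc n)) - 0) < 1" by blast
  then show False using step[of n] by simp
qed

lemma sets_total_variation [simp]: "sets (total_variation \<sigma>) = sets borel"
  unfolding total_variation_def by (simp add: sets.sigma_sets_eq[of borel, simplified])

lemma space_total_variation [simp]: "space (total_variation \<sigma>) = UNIV"
  unfolding total_variation_def by (simp add: space_measure_of_conv)

lemma measure_total_variation:
  assumes \<sigma>: "signed_measure \<sigma>"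
  shows "measure (total_variation \<sigma>) UNIV
    = measure (upper_variation \<sigma>) UNIV + measure (upper_variation (\<lambda>E. - \<sigma> E)) UNIV"
  using emeasure_upper_variation_finite[OF \<sigma>] emeasure_upper_variation_finite[OF signed_measure_uminus[OF \<sigma>]]
  by (simp add: measure_def emeasure_total_variation enn2real_plus less_top)

lemma upper_variation_le_total_variation:
  "upper_variation \<sigma> \<le> total_variation \<sigma>" "upper_variation (\<lambda>E. - \<sigma> E) \<le> total_variation \<sigma>"
  by (auto simp: le_measure le_fun_def emeasure_total_variation emeasure_notin_sets)

lemma integrable_shifted_pos_powr:
  assumes \<mu>: "sets \<mu> = sets borel" "emeasure \<mu> UNIV \<noteq> \<infinity>"
    and moment: "(\<integral>\<^sup>+x. ennreal (\<bar>x\<bar> powr \<alpha>) \<partial>\<mu>) < \<infinity>" and \<alpha>: "0 < \<alpha>" "\<alpha> < 1" and s: "\<bar>s\<bar> = 1"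
  shows "integrable \<mu> (\<lambda>x. pos_powr \<alpha> (s * t + - s * x))"
proof -
  have sp: "space \<mu> = UNIV" using sets_eq_imp_space_eq[OF \<mu>(1)] by simp
  have m: "f \<in> borel_measurable \<mu>" if "f \<in> borel_measurable borel" for f :: "real \<Rightarrow> real"
    using that measurable_cong_sets[OF \<mu>(1) refl] by blast
  have 1: "integrable \<mu> (\<lambda>x. \<bar>x\<bar> powr \<alpha>)"
    using moment by (intro integrableI_nonneg m) auto
  have 2: "integrable \<mu> (\<lambda>x. \<bar>t\<bar> powr \<alpha>)"
    using \<mu>(2) sp by (intro finite_measure.integrable_const finite_measureI) simp
  show ?thesis
  proof (rule Bochner_Integration.integrable_bound[OF Bochner_Integration.integrable_add[OF 1 2]])
    show "(\<lambda>x. pos_powr \<alpha> (s * t + - s * x)) \<in> borel_measurable \<mu>"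
      unfolding pos_powr_def by (intro m) measurable
    have "pos_powr \<alpha> (s * t + - s * x) \<le> \<bar>x\<bar> powr \<alpha> + \<bar>t\<bar> powr \<alpha>" for x
    proof -
      have "\<bar>s * t + - s * x\<bar> \<le> \<bar>x\<bar> + \<bar>t\<bar>"
        using abs_triangle_ineq[of "s * t" "- s * x"] s by (simp add: abs_mult)
      then have "pos_powr \<alpha> (s * t + - s * x) \<le> (\<bar>x\<bar> + \<bar>t\<bar>) powr \<alpha>"
        unfolding pos_powr_def using \<alpha> by (intro powr_mono2) auto
      also have "\<dots> \<le> \<bar>x\<bar> powr \<alpha> + \<bar>t\<bar> powr \<alpha>" using \<alpha> by (intro powr_subadditive) auto
      finally show ?thesis .
    qed
    moreover have "pos_powr \<alpha> y \<ge> 0" for y by (simp add: pos_powr_def)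
    ultimately show "AE x in \<mu>. norm (pos_powr \<alpha> (s * t + - s * x)) \<le> norm (\<bar>x\<bar> powr \<alpha> + \<bar>t\<bar> powr \<alpha>)"
      by simp
  qed
qed

lemma frac_int_eq_pos_powr:
  assumes "f = frac_int_plus \<alpha> \<sigma> \<or> f = frac_int_minus \<alpha> \<sigma>"
  obtains s :: real where "\<bar>s\<bar> = 1"
    "\<And>t. f t = 1 / Gamma (\<alpha> + 1) * signed_integral \<sigma> (\<lambda>x. pos_powr \<alpha> (s * t + - s * x))"
proof -
  have "(\<lambda>x. indicator {..t} x * (t - x) powr \<alpha>) = (\<lambda>x. pos_powr \<alpha> (1 * t + - 1 * x))" for t
    by (auto simp: fun_eq_iff pos_powr_def indicator_def max_def)
  moreover have "(\<lambda>x. indicator {t..} x * (x - t) powr \<alpha>) = (\<lambda>x. pos_powr \<alpha> (- 1 * t + - (- 1) * x))" for t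
    by (auto simp: fun_eq_iff pos_powr_def indicator_def max_def)
  ultimately show ?thesis
    using assms that[of 1] that[of "-1"] unfolding frac_int_plus_def[abs_def] frac_int_minus_def[abs_def]
    by auto
qed

text \<open>Spectral sums are finite sums, so they commute with the integral against \<open>\<sigma>\<close>; the bound for
  each truncated power is then integrated.\<close>

lemma spectral_sum_frac_int_perturb:
  assumes \<sigma>: "\<sigma> \<in> signed_measures_moment \<alpha>" and f: "f = frac_int_plus \<alpha> \<sigma> \<or> f = frac_int_minus \<alpha> \<sigma>"
    and m: "measure (total_variation \<sigma>) UNIV \<le> m"
    and A: "hermitian n A" and H: "hermitian n H" and \<alpha>: "0 < \<alpha>" "\<alpha> < 1"
  shows "\<bar>spectral_sum n f (\<lambda>k l. A k l + H k l) - spectral_sum n f A\<bar>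
    \<le> m / Gamma (\<alpha> + 1) * (\<Sum>k<n. \<Sum>l<n. cmod (H k l) powr \<alpha>)"
proof -
  define W where "W = (\<Sum>k<n. \<Sum>l<n. cmod (H k l) powr \<alpha>)"
  have W: "W \<ge> 0" by (simp add: W_def sum_nonneg)
  let ?B = "\<lambda>k l. A k l + H k l"
  have sm: "signed_measure \<sigma>" and moment: "(\<integral>\<^sup>+x. ennreal (\<bar>x\<bar> powr \<alpha>) \<partial>total_variation \<sigma>) < \<infinity>"
    using \<sigma> by (auto simp: signed_measures_moment_def)
  have G: "Gamma (\<alpha> + 1) > 0" using \<alpha> by (intro Gamma_real_pos) auto
  obtain s where s: "\<bar>s\<bar> = 1"
    and f_eq: "\<And>t. f t = 1 / Gamma (\<alpha> + 1) * signed_integral \<sigma> (\<lambda>x. pos_powr \<alpha> (s * t + - s * x))"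
    using frac_int_eq_pos_powr[OF f] by metis
  define S where "S x C = spectral_sum n (\<lambda>t. pos_powr \<alpha> (s * t + - s * x)) C" for x C
  define J where "J \<mu> C = (\<integral>x. S x C \<partial>\<mu>)" for \<mu> C
  have key: "integrable \<mu> (\<lambda>x. pos_powr \<alpha> (s * t + - s * x))" "finite_measure \<mu>"
    if "\<mu> = upper_variation \<sigma> \<or> \<mu> = upper_variation (\<lambda>E. - \<sigma> E)" for \<mu> t
  proof -
    have sets: "sets \<mu> = sets borel" and fin: "emeasure \<mu> UNIV \<noteq> \<infinity>" and sp: "space \<mu> = UNIV"
      using that emeasure_upper_variation_finite[OF sm]
        emeasure_upper_variation_finite[OF signed_measure_uminus[OF sm]] by auto
    have "\<mu> \<le> total_variation \<sigma>" using that upper_variation_le_total_variation by auto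
    then have "(\<integral>\<^sup>+x. ennreal (\<bar>x\<bar> powr \<alpha>) \<partial>\<mu>) \<le> (\<integral>\<^sup>+x. ennreal (\<bar>x\<bar> powr \<alpha>) \<partial>total_variation \<sigma>)"
      by (intro nn_integral_mono_measure) (auto simp: sets)
    then show "integrable \<mu> (\<lambda>x. pos_powr \<alpha> (s * t + - s * x))"
      by (intro integrable_shifted_pos_powr sets fin \<alpha> s) (use moment in auto)
    show "finite_measure \<mu>" using fin sp by (intro finite_measureI) simp
  qed
  have int: "integrable \<mu> (\<lambda>x. S x C)" and J_eq: "J \<mu> C = spectral_sum n (\<lambda>t. \<integral>x. pos_powr \<alpha> (s * t + - s * x) \<partial>\<mu>) C"
    if "\<mu> = upper_variation \<sigma> \<or> \<mu> = upper_variation (\<lambda>E. - \<sigma> E)" for \<mu> C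
    using key(1)[OF that] unfolding J_def S_def spectral_sum_def
    by (simp_all add: Bochner_Integration.integral_sum)
  have J_diff: "\<bar>J \<mu> ?B - J \<mu> A\<bar> \<le> W * measure \<mu> UNIV"
    if \<mu>: "\<mu> = upper_variation \<sigma> \<or> \<mu> = upper_variation (\<lambda>E. - \<sigma> E)" for \<mu>
  proof -
    interpret finite_measure \<mu> by (rule key(2)[OF \<mu>])
    have sp: "space \<mu> = UNIV" using \<mu> by auto
    have "\<bar>J \<mu> ?B - J \<mu> A\<bar> = \<bar>\<integral>x. S x ?B - S x A \<partial>\<mu>\<bar>"
      by (simp add: J_def int[OF \<mu>])
    also have "\<dots> \<le> (\<integral>x. \<bar>S x ?B - S x A\<bar> \<partial>\<mu>)" by (rule integral_abs_bound)
    also have "\<dots> \<le> (\<integral>x. W \<partial>\<mu>)"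
      unfolding W_def S_def using int[OF \<mu>]
      by (intro integral_mono spectral_sum_shifted_pos_powr_perturb[OF A H \<alpha> s]) (auto simp: S_def)
    also have "\<dots> = W * measure \<mu> UNIV" by (simp add: sp mult.commute)
    finally show ?thesis .
  qed
  have "spectral_sum n f C = 1 / Gamma (\<alpha> + 1) * (J (upper_variation \<sigma>) C - J (upper_variation (\<lambda>E. - \<sigma> E)) C)" for C
    unfolding J_eq[OF disjI1[OF refl]] J_eq[OF disjI2[OF refl]]
    by (simp add: spectral_sum_def f_eq signed_integral_def sum_subtractf flip: sum_divide_distrib)
  then have "\<bar>spectral_sum n f ?B - spectral_sum n f A\<bar> = 1 / Gamma (\<alpha> + 1) *
      \<bar>(J (upper_variation \<sigma>) ?B - J (upper_variation \<sigma>) A)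
       - (J (upper_variation (\<lambda>E. - \<sigma> E)) ?B - J (upper_variation (\<lambda>E. - \<sigma> E)) A)\<bar>"
    using G by (simp add: abs_mult abs_divide algebra_simps flip: diff_divide_distrib)
  also have "\<dots> \<le> 1 / Gamma (\<alpha> + 1) *
      (W * measure (upper_variation \<sigma>) UNIV + W * measure (upper_variation (\<lambda>E. - \<sigma> E)) UNIV)"
    using G J_diff[OF disjI1[OF refl]] J_diff[OF disjI2[OF refl]]
    by (intro mult_left_mono) (auto intro: order_trans[OF abs_triangle_ineq4 add_mono])
  also have "\<dots> = 1 / Gamma (\<alpha> + 1) * (W * measure (total_variation \<sigma>) UNIV)"
    by (simp add: measure_total_variation[OF sm] distrib_left)
  also have "\<dots> \<le> 1 / Gamma (\<alpha> + 1) * (W * m)"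
    using G W m by (intro mult_left_mono) auto
  finally show ?thesis by (simp add: W_def mult_ac)
qed

section \<open>Borel structure of Hermitian matrices\<close>

lemma proots_eigen_decomp:
  assumes "A \<in> carrier_mat n n" "eigen_decomp n (\<lambda>i j. A $$ (i, j)) a u"
  shows "image_mset Re (proots (char_poly A)) = image_mset a (mset_set {..<n})"
proof -
  have "proots (char_poly A) = (\<Sum>i<n. {#complex_of_real (a i)#})"
    unfolding char_poly_eigen_decomp[OF assms] by (subst proots_prod) auto
  also have "\<dots> = image_mset (\<lambda>i. complex_of_real (a i)) (mset_set {..<n})"
    by (induction n) (auto simp: lessThan_Suc)
  finally show ?thesis by (simp add: multiset.map_comp comp_def)
qed

lemma integral_empirical_spectral_measure:
  assumes A: "A \<in> carrier_mat n n" and herm: "hermitian n (\<lambda>i j. A $$ (i, j))" and "n \<ge> 1"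
  shows "(\<integral>x. f x \<partial>empirical_spectral_measure A) = spectral_sum n f (\<lambda>i j. A $$ (i, j)) / real n"
proof -
  obtain a u where a: "eigen_decomp n (\<lambda>i j. A $$ (i, j)) a u" using exists_eigen_decomp[OF herm] by blast
  have ne: "{..<n} \<noteq> {}" using \<open>n \<ge> 1\<close> by (auto simp: lessThan_empty_iff)
  have "pmf_of_multiset (image_mset Re (proots (char_poly A))) = map_pmf a (pmf_of_set {..<n})"
    using ne by (simp add: proots_eigen_decomp[OF A a] map_pmf_of_set)
  then have "(\<integral>x. f x \<partial>empirical_spectral_measure A) = (\<Sum>i<n. f (a i)) / real n"
    using ne by (simp add: empirical_spectral_measure_def integral_pmf_of_set)
  then show ?thesis by (simp add: spectral_sum_eq[OF herm a])
qed

text \<open>Hermitian matrices are embedded into a countable product of complex planes, whose topology is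
  metrizable and satisfies Tychonoff's theorem; entries outside the matrix are \<open>0\<close>.\<close>

definition entries :: "nat \<Rightarrow> complex mat \<Rightarrow> nat \<times> nat \<Rightarrow> complex" where
  "entries n Y = (\<lambda>(i, j). if i < n \<and> j < n then Y $$ (i, j) else 0)"

definition herm_entries :: "nat \<Rightarrow> nat \<Rightarrow> (nat \<times> nat \<Rightarrow> complex) set" where
  "herm_entries \<beta> n = {x. \<forall>i j. (if i < n \<and> j < n then cnj (x (i, j)) = x (j, i) \<and> (\<beta> = 1 \<longrightarrow> Im (x (i, j)) = 0)
     else x (i, j) = 0)}"

text \<open>The symmetry condition is turned around, so that it terminates as a rewrite rule.\<close>

lemma herm_mat_iff:
  "Y \<in> herm_mat \<beta> n \<longleftrightarrow> Y \<in> carrier_mat n n \<and>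
     (\<forall>i<n. \<forall>j<n. cnj (Y $$ (i, j)) = Y $$ (j, i) \<and> (\<beta> = 1 \<longrightarrow> Im (Y $$ (i, j)) = 0))"
proof -
  have "(\<forall>i<n. \<forall>j<n. Y $$ (j, i) = cnj (Y $$ (i, j))) \<longleftrightarrow> (\<forall>i<n. \<forall>j<n. cnj (Y $$ (i, j)) = Y $$ (j, i))"
    by (simp only: eq_commute)
  then show ?thesis unfolding herm_mat_def complex_is_Real_iff by blast
qed

lemma entries_herm_mat: "entries n ` herm_mat \<beta> n = herm_entries \<beta> n"
proof (intro equalityI subsetI)
  fix x assume "x \<in> entries n ` herm_mat \<beta> n"
  then show "x \<in> herm_entries \<beta> n"
    by (auto simp: entries_def herm_mat_iff herm_entries_def)
next
  fix x assume x: "x \<in> herm_entries \<beta> n"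
  then have "mat n n x \<in> herm_mat \<beta> n"
    by (auto simp: herm_mat_iff herm_entries_def)
  moreover have "x = entries n (mat n n x)"
    using x by (auto simp: entries_def herm_entries_def fun_eq_iff)
  ultimately show "x \<in> entries n ` herm_mat \<beta> n" by blast
qed

lemma inj_on_entries: "inj_on (entries n) (carrier_mat n n)"
proof (rule inj_onI)
  fix Y Z :: "complex mat" assume Y: "Y \<in> carrier_mat n n" "Z \<in> carrier_mat n n" and eq: "entries n Y = entries n Z"
  show "Y = Z"
  proof (rule eq_matI)
    fix i j assume "i < dim_row Z" "j < dim_col Z"
    then show "Y $$ (i, j) = Z $$ (i, j)" using fun_cong[OF eq, of "(i, j)"] Y by (simp add: entries_def)
  qed (use Y in auto)
qed

lemma entries_Collect:
  assumes "\<And>Y. Y \<in> herm_mat \<beta> n \<Longrightarrow> P Y \<longleftrightarrow> Q (entries n Y)"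
  shows "entries n ` {Y \<in> herm_mat \<beta> n. P Y} = {x \<in> herm_entries \<beta> n. Q x}"
  unfolding entries_herm_mat[symmetric] using assms by blast

lemma continuous_on_entry [continuous_intros]:
  "continuous_on S (\<lambda>x :: nat \<times> nat \<Rightarrow> complex. x p)"
  by (rule continuous_on_subset[OF continuous_on_product_coordinates]) simp

lemma closed_herm_entries: "closed (herm_entries \<beta> n)"
  unfolding herm_entries_def
proof (intro closed_Collect_all)
  fix i j
  show "closed {x. if i < n \<and> j < n then cnj (x (i, j)) = x (j, i) \<and> (\<beta> = 1 \<longrightarrow> Im (x (i, j)) = 0)
     else x (i, j) = 0}"
    by (cases "i < n \<and> j < n"; cases "\<beta> = 1")
      (auto intro!: closed_Collect_conj closed_Collect_eq continuous_intros)
qed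

lemma tendsto_fun_iff:
  fixes f :: "'a \<Rightarrow> 'i \<Rightarrow> 'b::topological_space"
  shows "(f \<longlongrightarrow> l) F \<longleftrightarrow> (\<forall>i. ((\<lambda>c. f c i) \<longlongrightarrow> l i) F)"
  using limitin_componentwise[of "\<lambda>_. euclidean" UNIV f l F]
  unfolding euclidean_product_topology by simp

text \<open>Along a subsequence the summands from \<open>K\<close> converge, hence so do those from \<open>A\<close>.\<close>

lemma closed_plus_compact:
  fixes A K :: "('i::countable \<Rightarrow> 'b::real_normed_vector) set"
  assumes "closed A" "compact K"
  shows "closed {\<lambda>i. a i + b i | a b. a \<in> A \<and> b \<in> K}"
  unfolding closed_sequential_limits
proof (intro allI impI, elim conjE)
  fix x l assume "\<forall>m. x m \<in> {\<lambda>i. a i + b i | a b. a \<in> A \<and> b \<in> K}" and lim: "x \<longlonglongrightarrow> l"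
  then have "\<forall>m. \<exists>a b. x m = (\<lambda>i. a i + b i) \<and> a \<in> A \<and> b \<in> K" by blast
  then obtain a b where x: "\<And>m. x m = (\<lambda>i. a m i + b m i)" and a: "\<And>m. a m \<in> A" and b: "\<And>m. b m \<in> K"
    by metis
  have "seq_compact K" using \<open>compact K\<close> by (simp add: compact_eq_seq_compact_metric)
  then obtain k r where k: "k \<in> K" and r: "strict_mono (r :: nat \<Rightarrow> nat)" and bk: "(b \<circ> r) \<longlonglongrightarrow> k"
    using b seq_compactE by metis
  have "(x \<circ> r) \<longlonglongrightarrow> l" using lim r by (rule LIMSEQ_subseq_LIMSEQ)
  then have "(a \<circ> r) \<longlonglongrightarrow> (\<lambda>i. l i - k i)"
    using bk unfolding tendsto_fun_iff
  proof (intro allI)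
    fix i
    assume "\<forall>i. (\<lambda>c. (x \<circ> r) c i) \<longlonglongrightarrow> l i" "\<forall>i. (\<lambda>c. (b \<circ> r) c i) \<longlonglongrightarrow> k i"
    then have "(\<lambda>c. (x \<circ> r) c i - (b \<circ> r) c i) \<longlonglongrightarrow> l i - k i" by (intro tendsto_diff) auto
    then show "(\<lambda>c. (a \<circ> r) c i) \<longlonglongrightarrow> l i - k i" by (simp add: x)
  qed
  then have "(\<lambda>i. l i - k i) \<in> A"
    by (rule closed_sequentially[OF \<open>closed A\<close>, rotated]) (simp add: a)
  with k show "l \<in> {\<lambda>i. a i + b i | a b. a \<in> A \<and> b \<in> K}"
    by (intro CollectI exI[of _ "\<lambda>i. l i - k i"] exI[of _ k]) auto
qed

lemma compact_plus_compact:
  fixes A K :: "(nat \<times> nat \<Rightarrow> complex) set"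
  assumes "compact A" "compact K"
  shows "compact {\<lambda>i. a i + b i | a b. a \<in> A \<and> b \<in> K}"
proof -
  have "continuous_on (A \<times> K) (\<lambda>p i. fst p i + snd p i)"
    unfolding continuous_on_coordinatewise_iff
    by (intro allI continuous_intros continuous_on_compose2[OF continuous_on_entry]) auto
  from compact_continuous_image[OF this compact_Times[OF assms]]
  show ?thesis by (rule back_subst[of compact]) (force simp: image_iff)
qed

lemma entries_plus:
  assumes "A \<subseteq> herm_mat \<beta> n" "B \<subseteq> herm_mat \<beta> n"
  shows "entries n ` (A +\<^sub>S B) = {\<lambda>i. a i + b i | a b. a \<in> entries n ` A \<and> b \<in> entries n ` B}"
proof -
  have eq: "entries n (a + b) = (\<lambda>i. entries n a i + entries n b i)" if "a \<in> A" "b \<in> B" for a b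
  proof -
    have "a \<in> carrier_mat n n" "b \<in> carrier_mat n n" using assms that by (auto simp: herm_mat_iff)
    then show ?thesis by (auto simp: entries_def fun_eq_iff)
  qed
  have "x \<in> entries n ` (A +\<^sub>S B) \<longleftrightarrow> (\<exists>a\<in>A. \<exists>b\<in>B. x = entries n (a + b))" for x
    unfolding mat_set_plus_def by blast
  also have "\<dots> x \<longleftrightarrow> (\<exists>a\<in>A. \<exists>b\<in>B. x = (\<lambda>i. entries n a i + entries n b i))" for x
    by (simp add: eq cong: bex_cong)
  finally show ?thesis by blast
qed

lemma entries_scale:
  assumes "B \<subseteq> herm_mat \<beta> n"
  shows "entries n ` (r \<cdot>\<^sub>S B) = (\<lambda>x i. of_real r * x i) ` entries n ` B"
proof -
  have "entries n (of_real r \<cdot>\<^sub>m b) = (\<lambda>i. of_real r * entries n b i)" if "b \<in> B" for b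
  proof -
    have "b \<in> carrier_mat n n" using assms that by (auto simp: herm_mat_iff)
    then show ?thesis by (auto simp: entries_def fun_eq_iff)
  qed
  then show ?thesis by (simp add: mat_set_scale_def image_image)
qed

lemma herm_mat_plus: "A \<subseteq> herm_mat \<beta> n \<Longrightarrow> B \<subseteq> herm_mat \<beta> n \<Longrightarrow> A +\<^sub>S B \<subseteq> herm_mat \<beta> n"
  unfolding mat_set_plus_def
proof safe
  fix a b assume "A \<subseteq> herm_mat \<beta> n" "B \<subseteq> herm_mat \<beta> n" "a \<in> A" "b \<in> B"
  then have ab: "a \<in> herm_mat \<beta> n" "b \<in> herm_mat \<beta> n" by auto
  then have "dim_row b = n" "dim_col b = n" by (auto simp: herm_mat_iff)
  with ab show "a + b \<in> herm_mat \<beta> n" by (simp add: herm_mat_iff)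
qed

lemma herm_mat_scale: "B \<subseteq> herm_mat \<beta> n \<Longrightarrow> r \<cdot>\<^sub>S B \<subseteq> herm_mat \<beta> n"
  unfolding mat_set_scale_def
proof safe
  fix b assume "B \<subseteq> herm_mat \<beta> n" "b \<in> B"
  then have b: "b \<in> herm_mat \<beta> n" by auto
  then have "dim_row b = n" "dim_col b = n" by (auto simp: herm_mat_iff)
  with b show "of_real r \<cdot>\<^sub>m b \<in> herm_mat \<beta> n" by (simp add: herm_mat_iff)
qed

definition closed_herm :: "nat \<Rightarrow> nat \<Rightarrow> complex mat set \<Rightarrow> bool" where
  "closed_herm \<beta> n A \<longleftrightarrow> A \<subseteq> herm_mat \<beta> n \<and> closed (entries n ` A)"

definition compact_herm :: "nat \<Rightarrow> nat \<Rightarrow> complex mat set \<Rightarrow> bool" where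
  "compact_herm \<beta> n A \<longleftrightarrow> A \<subseteq> herm_mat \<beta> n \<and> compact (entries n ` A)"

lemma closed_herm_plus:
  assumes "closed_herm \<beta> n A" "compact_herm \<beta> n B"
  shows "closed_herm \<beta> n (A +\<^sub>S B)"
proof -
  have sub: "A \<subseteq> herm_mat \<beta> n" "B \<subseteq> herm_mat \<beta> n"
    using assms by (simp_all add: closed_herm_def compact_herm_def)
  have "closed (entries n ` (A +\<^sub>S B))"
    unfolding entries_plus[OF sub] using assms
    by (intro closed_plus_compact) (simp_all add: closed_herm_def compact_herm_def)
  then show ?thesis using herm_mat_plus[OF sub] by (simp add: closed_herm_def)
qed

lemma compact_herm_plus:
  assumes "compact_herm \<beta> n A" "compact_herm \<beta> n B"
  shows "compact_herm \<beta> n (A +\<^sub>S B)"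
proof -
  have sub: "A \<subseteq> herm_mat \<beta> n" "B \<subseteq> herm_mat \<beta> n"
    using assms by (simp_all add: compact_herm_def)
  have "compact (entries n ` (A +\<^sub>S B))"
    unfolding entries_plus[OF sub] using assms
    by (intro compact_plus_compact) (simp_all add: compact_herm_def)
  then show ?thesis using herm_mat_plus[OF sub] by (simp add: compact_herm_def)
qed

lemma compact_herm_scale:
  assumes "compact_herm \<beta> n B"
  shows "compact_herm \<beta> n (r \<cdot>\<^sub>S B)"
proof -
  have "continuous_on (entries n ` B) (\<lambda>x i. of_real r * x i)"
    unfolding continuous_on_coordinatewise_iff by (intro allI continuous_intros)
  then show ?thesis
    using assms compact_continuous_image herm_mat_scale[of B \<beta> n r] entries_scale[of B \<beta> n r]
    by (auto simp: compact_herm_def)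
qed

lemma compact_unit_polydisc: "compact {x :: 'i::countable \<Rightarrow> complex. \<forall>i. norm (x i) \<le> 1}"
proof -
  have "compact_space (top_of_set (cball (0 :: complex) 1))"
    by (simp add: compact_space_subtopology)
  then have "compact_space (subtopology (product_topology (\<lambda>i::'i. euclidean) UNIV) (\<Pi>\<^sub>E i\<in>UNIV. cball (0 :: complex) 1))"
    unfolding subtopology_product_topology compact_space_product_topology by simp
  then have "compact (\<Pi>\<^sub>E i\<in>(UNIV :: 'i set). cball (0 :: complex) 1)"
    unfolding euclidean_product_topology
    by (metis compactin_euclidean_iff compactin_subspace subset_UNIV topspace_euclidean)
  moreover have "(\<Pi>\<^sub>E i\<in>(UNIV :: 'i set). cball (0 :: complex) 1) = {x. \<forall>i. norm (x i) \<le> 1}"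
    by (auto simp: PiE_def)
  ultimately show ?thesis by simp
qed

text \<open>A closed subset of the polydisc, because every single term of the sum is at most \<open>1\<close>.\<close>

lemma compact_herm_lp_ball:
  assumes p: "p > 0"
  shows "compact_herm \<beta> n (lp_ball \<beta> n p)"
proof -
  define N where "N x = (\<Sum>i<n. \<Sum>j<n. norm (x (i, j)) powr p) powr (1 / p)" for x :: "nat \<times> nat \<Rightarrow> complex"
  have "lp_norm_mat n p Y = N (entries n Y)" for Y
    by (simp add: lp_norm_mat_def N_def entries_def)
  then have eq: "entries n ` lp_ball \<beta> n p = {x \<in> herm_entries \<beta> n. N x \<le> 1}"
    unfolding lp_ball_def by (intro entries_Collect) simp
  have closed: "closed {x \<in> herm_entries \<beta> n. N x \<le> 1}"
    using p unfolding N_def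
    by (intro continuous_on_closed_Collect_le closed_herm_entries continuous_on_powr' continuous_intros)
      (auto intro!: sum_nonneg)
  have sub: "{x \<in> herm_entries \<beta> n. N x \<le> 1} \<subseteq> {x. \<forall>i. norm (x i) \<le> 1}"
  proof safe
    fix x i j assume x: "x \<in> herm_entries \<beta> n" "N x \<le> 1"
    show "norm (x (i, j)) \<le> 1"
    proof (cases "i < n \<and> j < n")
      case True
      have "norm (x (i, j)) powr p \<le> (\<Sum>j<n. norm (x (i, j)) powr p)"
        using True by (intro member_le_sum) auto
      also have "\<dots> \<le> (\<Sum>i<n. \<Sum>j<n. norm (x (i, j)) powr p)"
        using True by (intro member_le_sum[of i "{..<n}" "\<lambda>i. \<Sum>j<n. norm (x (i, j)) powr p"]) (auto intro: sum_nonneg)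
      finally have "(norm (x (i, j)) powr p) powr (1 / p) \<le> N x"
        unfolding N_def using p by (intro powr_mono2) auto
      then show ?thesis using x p by (simp add: powr_powr)
    next
      case False
      then show ?thesis using x(1) by (auto simp: herm_entries_def split: if_splits)
    qed
  qed
  have "compact {x \<in> herm_entries \<beta> n. N x \<le> 1}"
    using compact_Int_closed[OF compact_unit_polydisc closed] by (simp only: Int_absorb1[OF sub])
  then show ?thesis unfolding compact_herm_def eq by (auto simp: lp_ball_def)
qed

lemma measurable_entries: "entries n \<in> borel_measurable (borel_herm_mat \<beta> n)"
proof (rule measurable_coordinatewise_then_product)
  fix p :: "nat \<times> nat"
  obtain i j where p: "p = (i, j)" by force
  let ?g = "\<lambda>A :: complex mat. \<lambda>(i, j)\<in>{..<n} \<times> {..<n}. A $$ (i, j)"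
  show "(\<lambda>Y. entries n Y p) \<in> borel_measurable (borel_herm_mat \<beta> n)"
  proof (cases "i < n \<and> j < n")
    case True
    have "?g \<in> measurable (borel_herm_mat \<beta> n) (\<Pi>\<^sub>M ij\<in>{..<n} \<times> {..<n}. borel)"
      unfolding borel_herm_mat_def by (intro measurable_vimage_algebra1) (auto simp: space_PiM)
    then have "(\<lambda>Y. ?g Y (i, j)) \<in> borel_measurable (borel_herm_mat \<beta> n)"
      by (rule measurable_compose[OF _ measurable_component_singleton]) (use True in simp)
    then show ?thesis using True by (simp add: p entries_def)
  next
    case False
    then have "(\<lambda>Y. entries n Y p) = (\<lambda>_. 0)" by (auto simp: p entries_def)
    then show ?thesis by simp
  qed
qed

lemma space_borel_herm_mat [simp]: "space (borel_herm_mat \<beta> n) = herm_mat \<beta> n"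
  by (simp add: borel_herm_mat_def)

lemma sets_closed_herm:
  assumes "closed_herm \<beta> n A"
  shows "A \<in> sets (borel_herm_mat \<beta> n)"
proof -
  have "A = entries n -` (entries n ` A) \<inter> space (borel_herm_mat \<beta> n)"
    using assms inj_on_entries[of n] by (auto simp: closed_herm_def herm_mat_iff dest!: inj_onD)
  moreover have "\<dots> \<in> sets (borel_herm_mat \<beta> n)"
    using assms by (intro measurable_sets[OF measurable_entries]) (auto simp: closed_herm_def borel_closed)
  ultimately show ?thesis by simp
qed

lemma hermitian_herm_mat:
  assumes "Y \<in> herm_mat \<beta> n"
  shows "hermitian n (\<lambda>i j. of_real r * Y $$ (i, j))"
  unfolding hermitian_def
proof (intro allI impI)
  fix i j assume "i < n" "j < n"
  then have "cnj (Y $$ (i, j)) = Y $$ (j, i)" using assms unfolding herm_mat_iff by blast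
  then show "cnj (of_real r * Y $$ (i, j)) = of_real r * Y $$ (j, i)" by simp
qed

text \<open>Spectral sums of Lipschitz functions are continuous in the entries.\<close>

lemma closed_herm_spectral_sublevel:
  assumes f: "1-lipschitz_on UNIV f" and n: "n \<ge> 1"
  shows "closed_herm \<beta> n {Y \<in> herm_mat \<beta> n. spectral_sum n f (\<lambda>i j. of_real r * Y $$ (i, j)) \<le> c}"
proof -
  define g where "g x = spectral_sum n f (\<lambda>i j. of_real r * x (i, j))" for x :: "nat \<times> nat \<Rightarrow> complex"
  have "spectral_sum n f (\<lambda>i j. of_real r * Y $$ (i, j)) = g (entries n Y)" for Y
    unfolding g_def by (rule spectral_sum_cong) (simp add: entries_def)
  then have eq: "entries n ` {Y \<in> herm_mat \<beta> n. spectral_sum n f (\<lambda>i j. of_real r * Y $$ (i, j)) \<le> c}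
      = {x \<in> herm_entries \<beta> n. g x \<le> c}"
    by (intro entries_Collect) simp
  have herm: "hermitian n (\<lambda>i j. of_real r * x (i, j))" if "x \<in> herm_entries \<beta> n" for x
    using that by (auto simp: hermitian_def herm_entries_def)
  have "continuous_on (herm_entries \<beta> n) g"
    unfolding continuous_on_def
  proof
    fix x assume x: "x \<in> herm_entries \<beta> n"
    define d where "d y = sqrt (real n) * sqrt (frob_sq n (\<lambda>i j. of_real r * y (i, j) - of_real r * x (i, j)))"
      for y :: "nat \<times> nat \<Rightarrow> complex"
    have "continuous_on (herm_entries \<beta> n) d" unfolding d_def frob_sq_def by (intro continuous_intros)
    then have "(d \<longlongrightarrow> d x) (at x within herm_entries \<beta> n)" using x by (simp add: continuous_on_def)
    then have "(d \<longlongrightarrow> 0) (at x within herm_entries \<beta> n)" by (simp add: d_def frob_sq_def)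
    moreover have "eventually (\<lambda>y. norm (g y - g x) \<le> d y) (at x within herm_entries \<beta> n)"
      unfolding eventually_at_filter g_def d_def
      using spectral_sum_frob[OF herm[OF x] herm f n] by (intro always_eventually) auto
    ultimately have "((\<lambda>y. g y - g x) \<longlongrightarrow> 0) (at x within herm_entries \<beta> n)"
      by (rule Lim_null_comparison[rotated])
    then show "(g \<longlongrightarrow> g x) (at x within herm_entries \<beta> n)" by (rule LIM_zero_cancel)
  qed
  then have "closed {x \<in> herm_entries \<beta> n. g x \<le> c}"
    by (intro continuous_on_closed_Collect_le closed_herm_entries) auto
  then show ?thesis by (auto simp: closed_herm_def eq)
qed

section \<open>Concentration of spectral means\<close>

lemma sum_lp_ball_le:
  assumes Z: "Z \<in> lp_ball \<beta> n p" and p: "p > 0" and q: "q \<ge> 0"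
  shows "(\<Sum>k<n. \<Sum>l<n. cmod (of_real q * Z $$ (k, l)) powr p) \<le> q powr p"
proof -
  define S where "S = (\<Sum>k<n. \<Sum>l<n. cmod (Z $$ (k, l)) powr p)"
  have S: "S \<ge> 0" by (simp add: S_def sum_nonneg)
  have "S powr (1 / p) \<le> 1" using Z by (simp add: lp_ball_def lp_norm_mat_def S_def)
  then have "(S powr (1 / p)) powr p \<le> 1 powr p" using p by (intro powr_mono2) auto
  then have "S \<le> 1" using p S by (simp add: powr_powr)
  have "(\<Sum>k<n. \<Sum>l<n. cmod (of_real q * Z $$ (k, l)) powr p) = q powr p * S"
    using q by (simp add: S_def norm_mult powr_mult sum_distrib_left)
  also have "\<dots> \<le> q powr p" using \<open>S \<le> 1\<close> by (simp add: mult_left_le)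
  finally show ?thesis .
qed

lemma lp_ball_subset: "lp_ball \<beta> n p \<subseteq> herm_mat \<beta> n"
  by (auto simp: lp_ball_def)

lemma spectral_sum_lp_ball:
  assumes A: "hermitian n A" and Z: "Z \<in> lp_ball \<beta> n p" and f: "1-lipschitz_on UNIV f"
    and p: "1 \<le> p" "p \<le> 2" and n: "n \<ge> 1" and q: "q \<ge> 0"
  shows "spectral_sum n f (\<lambda>k l. A k l + of_real q * Z $$ (k, l))
    \<le> spectral_sum n f A + q * real n powr (1 - 1 / p)"
proof -
  have H: "hermitian n (\<lambda>k l. of_real q * Z $$ (k, l))"
    using Z lp_ball_subset by (intro hermitian_herm_mat) auto
  have "(\<Sum>k<n. \<Sum>l<n. cmod (of_real q * Z $$ (k, l)) powr p) powr (1 / p) \<le> (q powr p) powr (1 / p)"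
    using p by (intro powr_mono2 sum_lp_ball_le[OF Z _ q]) (auto intro!: sum_nonneg)
  also have "\<dots> = q" using p q by (simp add: powr_powr)
  finally have "real n powr (1 - 1 / p) * (\<Sum>k<n. \<Sum>l<n. cmod (of_real q * Z $$ (k, l)) powr p) powr (1 / p)
      \<le> real n powr (1 - 1 / p) * q" by (intro mult_left_mono) auto
  then show ?thesis using spectral_sum_lp_perturb[OF A H f p n] by (simp add: mult.commute)
qed

lemma spectral_sum_frac_int_lp_ball:
  assumes A: "hermitian n A" and Z: "Z \<in> lp_ball \<beta> n \<alpha>"
    and \<sigma>: "\<sigma> \<in> signed_measures_moment \<alpha>" and f: "f = frac_int_plus \<alpha> \<sigma> \<or> f = frac_int_minus \<alpha> \<sigma>"
    and m: "measure (total_variation \<sigma>) UNIV \<le> m" and \<alpha>: "0 < \<alpha>" "\<alpha> < 1" and q: "q \<ge> 0"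
  shows "spectral_sum n f (\<lambda>k l. A k l + of_real q * Z $$ (k, l))
    \<le> spectral_sum n f A + m / Gamma (\<alpha> + 1) * q powr \<alpha>"
proof -
  have H: "hermitian n (\<lambda>k l. of_real q * Z $$ (k, l))"
    using Z lp_ball_subset by (intro hermitian_herm_mat) auto
  have "m \<ge> 0" using m measure_nonneg[of "total_variation \<sigma>" UNIV] by linarith
  then have "m / Gamma (\<alpha> + 1) \<ge> 0" using \<alpha> by (intro divide_nonneg_pos Gamma_real_pos) auto
  then have "m / Gamma (\<alpha> + 1) * (\<Sum>k<n. \<Sum>l<n. cmod (of_real q * Z $$ (k, l)) powr \<alpha>)
      \<le> m / Gamma (\<alpha> + 1) * q powr \<alpha>"
    using \<alpha> by (intro mult_left_mono sum_lp_ball_le[OF Z _ q]) auto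
  with spectral_sum_frac_int_perturb[OF \<sigma> f m A H \<alpha>] show ?thesis by linarith
qed

definition scaled_entries :: "nat \<Rightarrow> complex mat \<Rightarrow> nat \<Rightarrow> nat \<Rightarrow> complex" where
  "scaled_entries n Y k l = of_real (1 / sqrt (real n)) * Y $$ (k, l)"

definition spectral_sublevel :: "nat \<Rightarrow> nat \<Rightarrow> (real \<Rightarrow> real) \<Rightarrow> real \<Rightarrow> complex mat set" where
  "spectral_sublevel \<beta> n f c = {Y \<in> herm_mat \<beta> n. spectral_sum n f (scaled_entries n Y) \<le> real n * c}"

lemma hermitian_scaled_entries: "Y \<in> herm_mat \<beta> n \<Longrightarrow> hermitian n (scaled_entries n Y)"
  unfolding scaled_entries_def[abs_def] by (rule hermitian_herm_mat)

lemma closed_herm_sublevel: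
  "1-lipschitz_on UNIV f \<Longrightarrow> n \<ge> 1 \<Longrightarrow> closed_herm \<beta> n (spectral_sublevel \<beta> n f c)"
  unfolding spectral_sublevel_def scaled_entries_def[abs_def] by (rule closed_herm_spectral_sublevel)

lemma spectral_mean_le_iff:
  assumes "X \<omega> \<in> herm_mat \<beta> n" "n \<ge> 1"
  shows "spectral_mean n X f \<omega> \<le> c \<longleftrightarrow> X \<omega> \<in> spectral_sublevel \<beta> n f c"
proof -
  let ?Y = "complex_of_real (1 / sqrt (real n)) \<cdot>\<^sub>m X \<omega>"
  have car: "X \<omega> \<in> carrier_mat n n" using assms(1) by (simp add: herm_mat_iff)
  have eq: "?Y $$ (i, j) = scaled_entries n (X \<omega>) i j" if "i < n" "j < n" for i j
    using car that by (simp add: scaled_entries_def)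
  have "hermitian n (\<lambda>i j. ?Y $$ (i, j))"
    unfolding hermitian_def
  proof (intro allI impI)
    fix k l assume "k < n" "l < n"
    then show "cnj (?Y $$ (k, l)) = ?Y $$ (l, k)"
      using hermitian_scaled_entries[OF assms(1)] unfolding eq[OF \<open>k < n\<close> \<open>l < n\<close>] eq[OF \<open>l < n\<close> \<open>k < n\<close>]
      by (simp add: hermitian_def)
  qed
  then have "spectral_mean n X f \<omega> = spectral_sum n f (\<lambda>i j. ?Y $$ (i, j)) / real n"
    unfolding spectral_mean_def using car assms(2) by (intro integral_empirical_spectral_measure) auto
  also have "spectral_sum n f (\<lambda>i j. ?Y $$ (i, j)) = spectral_sum n f (scaled_entries n (X \<omega>))"
    by (rule spectral_sum_cong) (rule eq)
  finally show ?thesis using assms by (simp add: spectral_sublevel_def divide_le_eq mult.commute)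
qed

text \<open>As \<open>E\<close> is closed, the event \<open>X \<notin> E\<close> is measurable and the two probabilities can be
  compared.\<close>

lemma tail_le_completion:
  assumes M: "prob_space M" and X: "X \<in> measurable M (borel_herm_mat \<beta> n)" and n: "n \<ge> 1"
    and f: "1-lipschitz_on UNIV f" and E: "closed_herm \<beta> n E" "E \<subseteq> spectral_sublevel \<beta> n f (c + t)"
  shows "measure M {\<omega> \<in> space M. spectral_mean n X f \<omega> - c > t}
    \<le> measure (completion M) {\<omega> \<in> space M. X \<omega> \<notin> E}"
proof -
  interpret prob_space M by (rule M)
  have Xh: "X \<omega> \<in> herm_mat \<beta> n" if "\<omega> \<in> space M" for \<omega>
    using measurable_space[OF X that] by simp
  have meas: "{\<omega> \<in> space M. X \<omega> \<notin> F} \<in> sets M" if "closed_herm \<beta> n F" for F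
  proof -
    have "{\<omega> \<in> space M. X \<omega> \<notin> F} = space M - (X -` F \<inter> space M)" by auto
    then show ?thesis using measurable_sets[OF X sets_closed_herm[OF that]] by simp
  qed
  have "spectral_mean n X f \<omega> - c > t \<longleftrightarrow> X \<omega> \<notin> spectral_sublevel \<beta> n f (c + t)" if "\<omega> \<in> space M" for \<omega>
    unfolding spectral_mean_le_iff[of X \<omega> \<beta> n f "c + t", OF Xh[OF that] n, symmetric] by linarith
  then have "{\<omega> \<in> space M. spectral_mean n X f \<omega> - c > t} = {\<omega> \<in> space M. X \<omega> \<notin> spectral_sublevel \<beta> n f (c + t)}"
    by blast
  then have "measure M {\<omega> \<in> space M. spectral_mean n X f \<omega> - c > t} \<le> measure M {\<omega> \<in> space M. X \<omega> \<notin> E}"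
    using E meas[OF E(1)] by (intro finite_measure_mono) auto
  also have "\<dots> = measure (completion M) {\<omega> \<in> space M. X \<omega> \<notin> E}"
    using meas[OF E(1)] by simp
  finally show ?thesis .
qed

lemma median_sublevel:
  assumes X: "X \<in> measurable M (borel_herm_mat \<beta> n)" and n: "n \<ge> 1" and "is_median M (spectral_mean n X f) c"
  shows "measure M {\<omega> \<in> space M. X \<omega> \<in> spectral_sublevel \<beta> n f c} \<ge> 1 / 2"
proof -
  have "spectral_mean n X f \<omega> \<le> c \<longleftrightarrow> X \<omega> \<in> spectral_sublevel \<beta> n f c" if "\<omega> \<in> space M" for \<omega>
    using measurable_space[OF X that] by (intro spectral_mean_le_iff n) simp
  then have "{\<omega> \<in> space M. X \<omega> \<in> spectral_sublevel \<beta> n f c} = {\<omega> \<in> space M. spectral_mean n X f \<omega> \<le> c}"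
    by blast
  then show ?thesis using assms(3) by (simp add: is_median_def)
qed

text \<open>The two summands in the last hypothesis bound the changes of the spectral sum caused by the
  \<open>\<ell>\<^sup>2\<close> ball and by the \<open>\<ell>\<^sup>\<alpha>\<close> ball, after scaling by \<open>1/\<surd>n\<close>.\<close>

lemma lipschitz_tail_bound:
  assumes M: "prob_space M" and X: "X \<in> measurable M (borel_herm_mat \<beta> n)" and n: "n \<ge> 1"
    and conc: "concentration_property M \<beta> n X \<alpha> \<kappa>" and \<kappa>: "\<kappa> > 0" and \<alpha>: "1 \<le> \<alpha>" "\<alpha> \<le> 2"
    and f: "1-lipschitz_on UNIV f" and med: "is_median M (spectral_mean n X f) c" and s: "s > 0"
    and small: "\<kappa> * sqrt s + \<kappa> * s powr (1 / \<alpha>) / sqrt (real n) * real n powr (1 - 1 / \<alpha>) \<le> real n * t"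
  shows "measure M {\<omega> \<in> space M. spectral_mean n X f \<omega> - c > t} \<le> 2 * exp (- s)"
proof -
  let ?A = "spectral_sublevel \<beta> n f c"
  define E where "E = ?A +\<^sub>S (\<kappa> * sqrt s) \<cdot>\<^sub>S lp_ball \<beta> n 2 +\<^sub>S (\<kappa> * s powr (1/\<alpha>)) \<cdot>\<^sub>S lp_ball \<beta> n \<alpha>"
  have A: "closed_herm \<beta> n ?A" using f n by (rule closed_herm_sublevel)
  have E: "closed_herm \<beta> n E"
    unfolding E_def using \<alpha> by (intro closed_herm_plus compact_herm_scale compact_herm_lp_ball A) auto
  have "E \<subseteq> spectral_sublevel \<beta> n f (c + t)"
  proof
    fix Y assume "Y \<in> E"
    then obtain a b d where a: "a \<in> ?A" and b: "b \<in> lp_ball \<beta> n 2" and d: "d \<in> lp_ball \<beta> n \<alpha>"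
      and Y: "Y = a + of_real (\<kappa> * sqrt s) \<cdot>\<^sub>m b + of_real (\<kappa> * s powr (1/\<alpha>)) \<cdot>\<^sub>m d"
      unfolding E_def mat_set_plus_def mat_set_scale_def by blast
    define q1 where "q1 = \<kappa> * sqrt s / sqrt (real n)"
    define q2 where "q2 = \<kappa> * s powr (1/\<alpha>) / sqrt (real n)"
    have q: "q1 \<ge> 0" "q2 \<ge> 0" using \<kappa> s by (auto simp: q1_def q2_def)
    have ah: "a \<in> herm_mat \<beta> n" using a by (simp add: spectral_sublevel_def)
    have bd: "b \<in> herm_mat \<beta> n" "d \<in> herm_mat \<beta> n" using b d lp_ball_subset by auto
    have dims: "dim_row b = n" "dim_col b = n" "dim_row d = n" "dim_col d = n"
      using bd by (auto simp: herm_mat_iff)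
    let ?B = "\<lambda>k l. scaled_entries n a k l + of_real q1 * b $$ (k, l)"
    have B: "hermitian n ?B"
      by (intro hermitian_add hermitian_scaled_entries[OF ah] hermitian_herm_mat[OF bd(1)])
    have "spectral_sum n f (scaled_entries n Y) = spectral_sum n f (\<lambda>k l. ?B k l + of_real q2 * d $$ (k, l))"
      by (rule spectral_sum_cong) (simp add: Y scaled_entries_def q1_def q2_def dims add_divide_distrib)
    also have "\<dots> \<le> spectral_sum n f ?B + q2 * real n powr (1 - 1 / \<alpha>)"
      by (rule spectral_sum_lp_ball[OF B d f \<alpha> n q(2)])
    also have "spectral_sum n f ?B \<le> spectral_sum n f (scaled_entries n a) + q1 * real n powr (1 - 1 / 2)"
      by (rule spectral_sum_lp_ball[OF hermitian_scaled_entries[OF ah] b f _ _ n q(1)]) auto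
    also have "q1 * real n powr (1 - 1 / 2) = \<kappa> * sqrt s" using n by (simp add: q1_def powr_half_sqrt)
    also have "spectral_sum n f (scaled_entries n a) \<le> real n * c" using a by (simp add: spectral_sublevel_def)
    finally have "spectral_sum n f (scaled_entries n Y) \<le> real n * (c + t)"
      using small by (simp add: q2_def distrib_left)
    moreover have "Y \<in> herm_mat \<beta> n" using E \<open>Y \<in> E\<close> by (auto simp: closed_herm_def)
    ultimately show "Y \<in> spectral_sublevel \<beta> n f (c + t)" by (simp add: spectral_sublevel_def)
  qed
  then have "measure M {\<omega> \<in> space M. spectral_mean n X f \<omega> - c > t}
      \<le> measure (completion M) {\<omega> \<in> space M. X \<omega> \<notin> E}"
    by (rule tail_le_completion[OF M X n f E])
  also have "\<dots> \<le> 2 * exp (- s)"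
    using conc sets_closed_herm[OF A] s median_sublevel[OF X n med] \<alpha>
    unfolding concentration_property_def E_def by auto
  finally show ?thesis .
qed

text \<open>The three summands in the last hypothesis come from the \<open>\<ell>\<^sup>2\<close>, the \<open>\<ell>\<^sup>1\<close> and the \<open>\<ell>\<^sup>\<alpha>\<close> ball.  The
  first two are controlled by the Lipschitz property, the third one by the representation of \<open>f\<close> as a
  fractional integral.\<close>

lemma frac_int_tail_bound:
  assumes M: "prob_space M" and X: "X \<in> measurable M (borel_herm_mat \<beta> n)" and n: "n \<ge> 1"
    and conc: "concentration_property M \<beta> n X \<alpha> \<kappa>" and \<kappa>: "\<kappa> > 0" and \<alpha>: "0 < \<alpha>" "\<alpha> < 1"
    and f: "1-lipschitz_on UNIV f" and \<sigma>: "\<sigma> \<in> signed_measures_moment \<alpha>"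
    and frac: "f = frac_int_plus \<alpha> \<sigma> \<or> f = frac_int_minus \<alpha> \<sigma>"
    and m: "measure (total_variation \<sigma>) UNIV \<le> m"
    and med: "is_median M (spectral_mean n X f) c" and s: "s > 0"
    and small: "\<kappa> * ln (real n) powr (1/\<alpha> - 1) * sqrt s + \<kappa> * ln (real n) powr (1/\<alpha> - 1) * s / sqrt (real n)
      + m / Gamma (\<alpha> + 1) * (\<kappa> powr \<alpha> * s / real n powr (\<alpha> / 2)) \<le> real n * t"
  shows "measure M {\<omega> \<in> space M. spectral_mean n X f \<omega> - c > t} \<le> 4 * exp (- s)"
proof -
  define L where "L = \<kappa> * ln (real n) powr (1/\<alpha> - 1)"
  have L: "L \<ge> 0" using \<kappa> by (simp add: L_def)
  let ?A = "spectral_sublevel \<beta> n f c"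
  define E where "E = ?A +\<^sub>S L \<cdot>\<^sub>S (sqrt s \<cdot>\<^sub>S lp_ball \<beta> n 2 +\<^sub>S s \<cdot>\<^sub>S lp_ball \<beta> n 1)
    +\<^sub>S (\<kappa> * s powr (1/\<alpha>)) \<cdot>\<^sub>S lp_ball \<beta> n \<alpha>"
  have A: "closed_herm \<beta> n ?A" using f n by (rule closed_herm_sublevel)
  have E: "closed_herm \<beta> n E"
    unfolding E_def using \<alpha>
    by (intro closed_herm_plus compact_herm_plus compact_herm_scale compact_herm_lp_ball A) auto
  have "E \<subseteq> spectral_sublevel \<beta> n f (c + t)"
  proof
    fix Y assume "Y \<in> E"
    then obtain a b e d where a: "a \<in> ?A" and b: "b \<in> lp_ball \<beta> n 2" and e: "e \<in> lp_ball \<beta> n 1"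
      and d: "d \<in> lp_ball \<beta> n \<alpha>"
      and Y: "Y = a + of_real L \<cdot>\<^sub>m (of_real (sqrt s) \<cdot>\<^sub>m b + of_real s \<cdot>\<^sub>m e)
        + of_real (\<kappa> * s powr (1/\<alpha>)) \<cdot>\<^sub>m d"
      unfolding E_def mat_set_plus_def mat_set_scale_def by blast
    define q1 where "q1 = L * sqrt s / sqrt (real n)"
    define q2 where "q2 = L * s / sqrt (real n)"
    define q3 where "q3 = \<kappa> * s powr (1/\<alpha>) / sqrt (real n)"
    have q: "q1 \<ge> 0" "q2 \<ge> 0" "q3 \<ge> 0" using \<kappa> s L by (auto simp: q1_def q2_def q3_def)
    have ah: "a \<in> herm_mat \<beta> n" using a by (simp add: spectral_sublevel_def)
    have bed: "b \<in> herm_mat \<beta> n" "e \<in> herm_mat \<beta> n" "d \<in> herm_mat \<beta> n" using b e d lp_ball_subset by auto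
    have dims: "dim_row b = n" "dim_col b = n" "dim_row e = n" "dim_col e = n" "dim_row d = n" "dim_col d = n"
      using bed by (auto simp: herm_mat_iff)
    let ?B = "\<lambda>k l. scaled_entries n a k l + of_real q1 * b $$ (k, l)"
    let ?C = "\<lambda>k l. ?B k l + of_real q2 * e $$ (k, l)"
    have B: "hermitian n ?B"
      by (intro hermitian_add hermitian_scaled_entries[OF ah] hermitian_herm_mat[OF bed(1)])
    have C: "hermitian n ?C"
      by (intro hermitian_add B hermitian_herm_mat[OF bed(2)])
    have "spectral_sum n f (scaled_entries n Y) = spectral_sum n f (\<lambda>k l. ?C k l + of_real q3 * d $$ (k, l))"
      by (rule spectral_sum_cong)
        (simp add: Y scaled_entries_def q1_def q2_def q3_def dims add_divide_distrib distrib_left mult.assoc)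
    also have "\<dots> \<le> spectral_sum n f ?C + m / Gamma (\<alpha> + 1) * q3 powr \<alpha>"
      by (rule spectral_sum_frac_int_lp_ball[OF C d \<sigma> frac m \<alpha> q(3)])
    also have "q3 powr \<alpha> = \<kappa> powr \<alpha> * s / real n powr (\<alpha> / 2)"
      using \<kappa> s \<alpha> n by (simp add: q3_def powr_divide powr_mult powr_powr flip: powr_half_sqrt)
    also have "spectral_sum n f ?C \<le> spectral_sum n f ?B + q2 * real n powr (1 - 1 / 1)"
      by (rule spectral_sum_lp_ball[OF B e f _ _ n q(2)]) auto
    also have "q2 * real n powr (1 - 1 / 1) = q2" using n by simp
    also have "spectral_sum n f ?B \<le> spectral_sum n f (scaled_entries n a) + q1 * real n powr (1 - 1 / 2)"
      by (rule spectral_sum_lp_ball[OF hermitian_scaled_entries[OF ah] b f _ _ n q(1)]) auto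
    also have "q1 * real n powr (1 - 1 / 2) = L * sqrt s" using n by (simp add: q1_def powr_half_sqrt)
    also have "spectral_sum n f (scaled_entries n a) \<le> real n * c" using a by (simp add: spectral_sublevel_def)
    finally have "spectral_sum n f (scaled_entries n Y) \<le> real n * (c + t)"
      using small unfolding L_def[symmetric] q2_def distrib_left by linarith
    moreover have "Y \<in> herm_mat \<beta> n" using E \<open>Y \<in> E\<close> by (auto simp: closed_herm_def)
    ultimately show "Y \<in> spectral_sublevel \<beta> n f (c + t)" by (simp add: spectral_sublevel_def)
  qed
  then have "measure M {\<omega> \<in> space M. spectral_mean n X f \<omega> - c > t}
      \<le> measure (completion M) {\<omega> \<in> space M. X \<omega> \<notin> E}"
    by (rule tail_le_completion[OF M X n f E])
  also have "\<dots> \<le> 4 * exp (- s)"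
    using conc sets_closed_herm[OF A] s median_sublevel[OF X n med] \<alpha>
    unfolding concentration_property_def E_def L_def by auto
  finally show ?thesis .
qed

lemma ereal_divide_pos:
  assumes "a > 0" "b \<ge> 0"
  shows "0 < ereal a / ereal b"
  using assms by (cases "b = 0") (auto simp: divide_ereal_def)

text \<open>Clearing the denominator also covers \<open>b = 0\<close>, where the quotient is infinite.\<close>

lemma ereal_le_divide_imp:
  assumes "ereal s \<le> ereal c * (ereal a / ereal b)" "a > 0" "b \<ge> 0" "c > 0"
  shows "s * b \<le> c * a"
proof (cases "b = 0")
  case False
  then have "ereal c * (ereal a / ereal b) = ereal (c * a / b)" by (simp add: divide_ereal_def divide_inverse)
  then have "s \<le> c * a / b" using assms(1) by simp
  then show ?thesis using False assms(3) by (simp add: pos_le_divide_eq)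
qed (use assms in simp)

text \<open>An infinite rate is approached by arbitrarily large finite ones.\<close>

lemma le_exp_neg:
  assumes "\<And>s. s > 0 \<Longrightarrow> ereal s \<le> r \<Longrightarrow> P \<le> K * exp (- s)" "r > 0"
  shows "P \<le> K * exp_neg r"
proof (cases r)
  case (real s)
  then show ?thesis using assms by (simp add: exp_neg_def)
next
  case PInf
  have "((\<lambda>s. K * exp (- s)) \<longlongrightarrow> K * 0) at_top"
    by (intro tendsto_mult tendsto_const filterlim_compose[OF exp_at_bot] filterlim_uminus_at_bot_at_top)
  moreover have "eventually (\<lambda>s. P \<le> K * exp (- s)) at_top"
    using eventually_gt_at_top[of 0] by eventually_elim (use assms(1) PInf in simp)
  ultimately have "P \<le> K * 0" by (intro tendsto_lowerbound) auto
  then show ?thesis using PInf by (simp add: exp_neg_def)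
qed (use assms in auto)

theorem proposition2p14:
  fixes \<alpha> :: real
  assumes "0 < \<alpha>" and "\<alpha> \<le> 2"
  shows "\<exists>c::real. c > 0 \<and>
    (\<forall>(M :: complex mat measure) (X :: complex mat \<Rightarrow> complex mat) (\<beta>::nat) (n::nat) (\<kappa>::real).
      \<beta> \<in> {1, 2} \<and> n \<ge> 1 \<and> \<kappa> > 0 \<and> wigner M \<beta> n X \<and> concentration_property M \<beta> n X \<alpha> \<kappa> \<longrightarrow>
      (\<alpha> \<in> {1..2} \<longrightarrow>
        (\<forall>(f :: real \<Rightarrow> real) (m\<^sub>f :: real).
          1-lipschitz_on UNIV f \<and> is_median M (spectral_mean n X f) m\<^sub>f \<longrightarrow>
          (\<forall>t>0.
            measure M {\<omega> \<in> space M. spectral_mean n X f \<omega> - m\<^sub>f > t}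
              \<le> 2 * exp (- c * min (real n ^ 2 * t ^ 2 / \<kappa> ^ 2)
                                   (real n powr (1 + \<alpha>/2) * t powr \<alpha> / \<kappa> powr \<alpha>))))) \<and>
      (\<alpha> \<in> {0<..<1} \<longrightarrow>
        (\<forall>(f :: real \<Rightarrow> real) (m\<^sub>f :: real) \<sigma> (m :: real).
          1-lipschitz_on UNIV f \<and> \<sigma> \<in> signed_measures_moment \<alpha> \<and>
          (f = frac_int_plus \<alpha> \<sigma> \<or> f = frac_int_minus \<alpha> \<sigma>) \<and>
          measure (total_variation \<sigma>) UNIV \<le> m \<and>
          is_median M (spectral_mean n X f) m\<^sub>f \<longrightarrow>
          (\<forall>t>0.
            measure M {\<omega> \<in> space M. spectral_mean n X f \<omega> - m\<^sub>f > t}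
              \<le> 4 * exp_neg (ereal c *
                  min (ereal (real n ^ 2 * t ^ 2) / ereal (\<kappa> ^ 2 * ln (real n) powr (2 * (1/\<alpha> - 1))))
                 (min (ereal (real n powr (3/2) * t) / ereal (\<kappa> * ln (real n) powr (1/\<alpha> - 1)))
                      (ereal (real n powr (1 + \<alpha>/2) * t) / ereal (\<kappa> powr \<alpha> * m))))))))"
proof -
  \<comment> \<open>Each ball may contribute \<open>t/3\<close>.  The \<open>\<ell>\<^sup>2\<close> ball enters with \<open>\<surd>s\<close>, which explains \<open>1/9\<close>; this also suffices for \<open>s^{1/\<alpha>}\<close>, as \<open>1/\<alpha> \<ge> 1/2\<close>.  The other constant compensates the factor \<open>1/\<Gamma>(\<alpha> + 1)\<close> of the fractional integral.\<close>
  define c where "c = min (1 / 9) (Gamma (\<alpha> + 1) / 3)"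
  have G: "Gamma (\<alpha> + 1) > 0" using assms by (intro Gamma_real_pos) auto
  have c: "c > 0" "c \<le> 1 / 9" "c \<le> Gamma (\<alpha> + 1) / 3" using G by (auto simp: c_def)
  have convex: "measure M {\<omega> \<in> space M. spectral_mean n X f \<omega> - m\<^sub>f > t}
      \<le> 2 * exp (- c * min (real n ^ 2 * t ^ 2 / \<kappa> ^ 2) (real n powr (1 + \<alpha>/2) * t powr \<alpha> / \<kappa> powr \<alpha>))"
    if n: "n \<ge> 1" and \<kappa>: "\<kappa> > 0" and W: "wigner M \<beta> n X" and conc: "concentration_property M \<beta> n X \<alpha> \<kappa>"
      and \<alpha>: "1 \<le> \<alpha>" and f: "1-lipschitz_on UNIV f" and med: "is_median M (spectral_mean n X f) m\<^sub>f" and t: "t > 0"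
    for M :: "complex mat measure" and X :: "complex mat \<Rightarrow> complex mat" and \<beta> n :: nat and \<kappa> f m\<^sub>f t
  proof -
    define N where "N = real n"
    have N: "N > 0" using n by (simp add: N_def)
    define r1 where "r1 = N ^ 2 * t ^ 2 / \<kappa> ^ 2"
    define r2 where "r2 = N powr (1 + \<alpha>/2) * t powr \<alpha> / \<kappa> powr \<alpha>"
    define s where "s = c * min r1 r2"
    have r: "r1 > 0" "r2 > 0" using N t \<kappa> by (auto simp: r1_def r2_def)
    have s: "s > 0" using c r by (simp add: s_def)
    have "s \<le> 1 / 9 * min r1 r2"
      unfolding s_def using c r by (intro mult_right_mono) auto
    then have "s \<le> 1 / 9 * r1" "s \<le> 1 / 9 * r2" by linarith+
    have "sqrt s \<le> sqrt ((N * t / (3 * \<kappa>))\<^sup>2)"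
      using \<open>s \<le> 1 / 9 * r1\<close> by (simp add: r1_def power_divide power_mult_distrib)
    also have "\<dots> = N * t / (3 * \<kappa>)" using N t \<kappa> by simp
    finally have 1: "\<kappa> * sqrt s \<le> N * t / 3" using \<kappa> by (simp add: field_simps)
    have "(1 / 9 :: real) powr (1 / \<alpha>) \<le> (1 / 9) powr (1 / 2)"
      using \<alpha> assms by (intro powr_mono') (auto simp: field_simps)
    also have "\<dots> = 1 / 3" by (simp add: powr_half_sqrt real_sqrt_divide)
    finally have third: "(1 / 9 :: real) powr (1 / \<alpha>) \<le> 1 / 3" .
    have "s powr (1 / \<alpha>) \<le> (1 / 9 * r2) powr (1 / \<alpha>)"
      using s \<open>s \<le> 1 / 9 * r2\<close> \<alpha> by (intro powr_mono2) auto
    also have "\<dots> = (1 / 9) powr (1 / \<alpha>) * (N powr (1 / \<alpha> + 1 / 2) * t / \<kappa>)"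
      using N t \<kappa> \<alpha> by (simp add: r2_def powr_mult powr_divide powr_powr add_divide_distrib)
    also have "\<dots> \<le> 1 / 3 * (N powr (1 / \<alpha> + 1 / 2) * t / \<kappa>)"
      using third N t \<kappa> by (intro mult_right_mono) auto
    finally have "s powr (1 / \<alpha>) \<le> 1 / 3 * (N powr (1 / \<alpha> + 1 / 2) * t / \<kappa>)" .
    then have "\<kappa> * s powr (1 / \<alpha>) / sqrt N * N powr (1 - 1 / \<alpha>)
        \<le> \<kappa> * (1 / 3 * (N powr (1 / \<alpha> + 1 / 2) * t / \<kappa>)) / sqrt N * N powr (1 - 1 / \<alpha>)"
      using N \<kappa> by (intro mult_right_mono divide_right_mono mult_left_mono) auto
    also have "\<dots> = N * t / 3"
      using N \<kappa> by (simp add: powr_add powr_diff powr_half_sqrt)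
    finally have 2: "\<kappa> * s powr (1 / \<alpha>) / sqrt N * N powr (1 - 1 / \<alpha>) \<le> N * t / 3" .
    have "\<kappa> * sqrt s + \<kappa> * s powr (1 / \<alpha>) / sqrt (real n) * real n powr (1 - 1 / \<alpha>) \<le> real n * t"
      using 1 2 N t mult_pos_pos[of N t] unfolding N_def by linarith
    then have "measure M {\<omega> \<in> space M. spectral_mean n X f \<omega> - m\<^sub>f > t} \<le> 2 * exp (- s)"
      using W by (intro lipschitz_tail_bound[OF _ _ n conc \<kappa> \<alpha> assms(2) f med s]) (auto simp: wigner_def)
    then show ?thesis by (simp add: s_def r1_def r2_def N_def)
  qed
  have concave: "measure M {\<omega> \<in> space M. spectral_mean n X f \<omega> - m\<^sub>f > t}
      \<le> 4 * exp_neg (ereal c *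
          min (ereal (real n ^ 2 * t ^ 2) / ereal (\<kappa> ^ 2 * ln (real n) powr (2 * (1/\<alpha> - 1))))
         (min (ereal (real n powr (3/2) * t) / ereal (\<kappa> * ln (real n) powr (1/\<alpha> - 1)))
              (ereal (real n powr (1 + \<alpha>/2) * t) / ereal (\<kappa> powr \<alpha> * m))))"
    (is "_ \<le> 4 * exp_neg (ereal c * min (ereal ?a1 / ereal ?b1) (min (ereal ?a2 / ereal ?b2) (ereal ?a3 / ereal ?b3)))")
    if n: "n \<ge> 1" and \<kappa>: "\<kappa> > 0" and W: "wigner M \<beta> n X" and conc: "concentration_property M \<beta> n X \<alpha> \<kappa>"
      and \<alpha>: "\<alpha> < 1" and f: "1-lipschitz_on UNIV f" and \<sigma>: "\<sigma> \<in> signed_measures_moment \<alpha>"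
      and frac: "f = frac_int_plus \<alpha> \<sigma> \<or> f = frac_int_minus \<alpha> \<sigma>"
      and m: "measure (total_variation \<sigma>) UNIV \<le> m"
      and med: "is_median M (spectral_mean n X f) m\<^sub>f" and t: "t > 0"
    for M :: "complex mat measure" and X :: "complex mat \<Rightarrow> complex mat" and \<beta> n :: nat and \<kappa> f m\<^sub>f \<sigma> m t
  proof (rule le_exp_neg)
    define N where "N = real n"
    have N: "N > 0" using n by (simp add: N_def)
    define L where "L = ln (real n) powr (1/\<alpha> - 1)"
    have L: "L \<ge> 0" "ln (real n) powr (2 * (1/\<alpha> - 1)) = L\<^sup>2"
      by (auto simp: L_def power2_eq_square simp flip: powr_add)
    have "m \<ge> 0" using m measure_nonneg[of "total_variation \<sigma>" UNIV] by linarith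
    have a: "?a1 > 0" "?a2 > 0" "?a3 > 0" using n t by auto
    have b: "?b1 \<ge> 0" "?b2 \<ge> 0" "?b3 \<ge> 0" using \<kappa> \<open>m \<ge> 0\<close> by auto
    have "0 < min (ereal ?a1 / ereal ?b1) (min (ereal ?a2 / ereal ?b2) (ereal ?a3 / ereal ?b3))"
      using ereal_divide_pos[OF a(1) b(1)] ereal_divide_pos[OF a(2) b(2)] ereal_divide_pos[OF a(3) b(3)]
      by (simp only: min_less_iff_conj)
    moreover have "0 < ereal c" using c by simp
    ultimately show "0 < ereal c * min (ereal ?a1 / ereal ?b1) (min (ereal ?a2 / ereal ?b2) (ereal ?a3 / ereal ?b3))"
      unfolding ereal_zero_less_0_iff by blast
    fix s :: real
    assume s: "s > 0"
      and le: "ereal s \<le> ereal c * min (ereal ?a1 / ereal ?b1) (min (ereal ?a2 / ereal ?b2) (ereal ?a3 / ereal ?b3))"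
    \<comment> \<open>The three rates are used in the form \<open>s \<cdot> denominator \<le> c \<cdot> numerator\<close>, which is meaningful for vanishing denominators, that is for \<open>n = 1\<close> or \<open>m = 0\<close>.\<close>
    have le_each: "ereal s \<le> ereal c * x"
      if "min (ereal ?a1 / ereal ?b1) (min (ereal ?a2 / ereal ?b2) (ereal ?a3 / ereal ?b3)) \<le> x" for x
      using c by (intro order_trans[OF le] ereal_mult_left_mono that) auto
    have s1: "s * ?b1 \<le> c * ?a1" by (rule ereal_le_divide_imp[OF le_each[OF min.cobounded1] a(1) b(1) c(1)])
    have s2: "s * ?b2 \<le> c * ?a2"
      by (rule ereal_le_divide_imp[OF le_each[OF min.coboundedI2[OF min.cobounded1]] a(2) b(2) c(1)])
    have s3: "s * ?b3 \<le> c * ?a3"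
      by (rule ereal_le_divide_imp[OF le_each[OF min.coboundedI2[OF min.cobounded2]] a(3) b(3) c(1)])
    have 1: "\<kappa> * L * sqrt s \<le> N * t / 3"
    proof (rule power2_le_imp_le)
      have "(\<kappa> * L * sqrt s)\<^sup>2 = s * ?b1" using s L by (simp add: power_mult_distrib)
      also have "\<dots> \<le> 1 / 9 * ?a1" using s1 c a by (meson mult_right_mono order_trans less_imp_le)
      also have "\<dots> = (N * t / 3)\<^sup>2" by (simp add: N_def power_divide power_mult_distrib)
      finally show "(\<kappa> * L * sqrt s)\<^sup>2 \<le> (N * t / 3)\<^sup>2" .
    qed (use N t in simp)
    have "\<kappa> * L * s = s * ?b2" by (simp add: L_def)
    also have "\<dots> \<le> c * ?a2" by (rule s2)
    also have "\<dots> \<le> 1 / 9 * ?a2" by (rule mult_right_mono[OF c(2) less_imp_le[OF a(2)]])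
    finally have "\<kappa> * L * s \<le> 1 / 9 * ?a2" .
    then have "\<kappa> * L * s / sqrt N \<le> 1 / 9 * ?a2 / sqrt N" using N by (intro divide_right_mono) auto
    also have "\<dots> = N * t / 9"
    proof -
      have "N powr (3 / 2) = N * sqrt N" using N powr_add[of N 1 "1 / 2"] by (simp add: powr_half_sqrt)
      then show ?thesis using N by (simp flip: N_def)
    qed
    finally have 2: "\<kappa> * L * s / sqrt N \<le> N * t / 9" .
    have "\<kappa> powr \<alpha> * s * m = s * ?b3" by simp
    also have "\<dots> \<le> c * ?a3" by (rule s3)
    also have "\<dots> \<le> Gamma (\<alpha> + 1) / 3 * ?a3" by (rule mult_right_mono[OF c(3) less_imp_le[OF a(3)]])
    finally have "\<kappa> powr \<alpha> * s * m \<le> Gamma (\<alpha> + 1) / 3 * ?a3" .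
    then have "\<kappa> powr \<alpha> * s * m / (Gamma (\<alpha> + 1) * N powr (\<alpha> / 2))
        \<le> Gamma (\<alpha> + 1) / 3 * ?a3 / (Gamma (\<alpha> + 1) * N powr (\<alpha> / 2))"
      using G N by (intro divide_right_mono) auto
    also have "\<dots> = N * t / 3"
      using G N by (simp add: powr_add flip: N_def)
    finally have 3: "m / Gamma (\<alpha> + 1) * (\<kappa> powr \<alpha> * s / N powr (\<alpha> / 2)) \<le> N * t / 3"
      by (simp add: mult_ac)
    have "\<kappa> * L * sqrt s + \<kappa> * L * s / sqrt N + m / Gamma (\<alpha> + 1) * (\<kappa> powr \<alpha> * s / N powr (\<alpha> / 2)) \<le> N * t"
      using 1 2 3 mult_pos_pos[OF N t] by linarith
    then show "measure M {\<omega> \<in> space M. spectral_mean n X f \<omega> - m\<^sub>f > t} \<le> 4 * exp (- s)"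
      using W unfolding N_def L_def
      by (intro frac_int_tail_bound[OF _ _ n conc \<kappa> assms(1) \<alpha> f \<sigma> frac m med s]) (auto simp: wigner_def)
  qed
  show ?thesis
  proof (rule exI[of _ c], intro conjI allI impI)
    show "c > 0" by (rule c(1))
  next
    fix M :: "complex mat measure" and X :: "complex mat \<Rightarrow> complex mat" and \<beta> n :: nat
      and \<kappa> m\<^sub>f t :: real and f :: "real \<Rightarrow> real"
    assume "\<beta> \<in> {1, 2} \<and> n \<ge> 1 \<and> \<kappa> > 0 \<and> wigner M \<beta> n X \<and> concentration_property M \<beta> n X \<alpha> \<kappa>"
      and \<alpha>: "\<alpha> \<in> {1..2}" and "1-lipschitz_on UNIV f \<and> is_median M (spectral_mean n X f) m\<^sub>f" and "t > 0"
    then show "measure M {\<omega> \<in> space M. spectral_mean n X f \<omega> - m\<^sub>f > t}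
        \<le> 2 * exp (- c * min (real n ^ 2 * t ^ 2 / \<kappa> ^ 2) (real n powr (1 + \<alpha>/2) * t powr \<alpha> / \<kappa> powr \<alpha>))"
      by (elim conjE, intro convex[where \<beta> = \<beta>]) simp_all
  next
    fix M :: "complex mat measure" and X :: "complex mat \<Rightarrow> complex mat" and \<beta> n :: nat
      and \<kappa> m\<^sub>f m t :: real and f :: "real \<Rightarrow> real" and \<sigma>
    assume "\<beta> \<in> {1, 2} \<and> n \<ge> 1 \<and> \<kappa> > 0 \<and> wigner M \<beta> n X \<and> concentration_property M \<beta> n X \<alpha> \<kappa>"
      and "\<alpha> \<in> {0<..<1}"
      and "1-lipschitz_on UNIV f \<and> \<sigma> \<in> signed_measures_moment \<alpha> \<and>
          (f = frac_int_plus \<alpha> \<sigma> \<or> f = frac_int_minus \<alpha> \<sigma>) \<and>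
          measure (total_variation \<sigma>) UNIV \<le> m \<and>
          is_median M (spectral_mean n X f) m\<^sub>f" and "t > 0"
    then show "measure M {\<omega> \<in> space M. spectral_mean n X f \<omega> - m\<^sub>f > t}
        \<le> 4 * exp_neg (ereal c *
            min (ereal (real n ^ 2 * t ^ 2) / ereal (\<kappa> ^ 2 * ln (real n) powr (2 * (1/\<alpha> - 1))))
           (min (ereal (real n powr (3/2) * t) / ereal (\<kappa> * ln (real n) powr (1/\<alpha> - 1)))
                (ereal (real n powr (1 + \<alpha>/2) * t) / ereal (\<kappa> powr \<alpha> * m))))"
      by (elim conjE, intro concave[where \<beta> = \<beta> and \<sigma> = \<sigma>]) simp_all
  qed
qed

end
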